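(* Let \(D\subset\mathbb{R}^2\) be a bounded convex planar domain. Then no co-adapted coupling of reflected Brownian motions in \(\overline{D}\) is shy; that is, for every co-adapted coupling \((X,Y)\), every pair of starting points \(x_0\ne y_0\) and every \(\varepsilon>0\), \[ \mathbb{P}\big(\|X_t-Y_t\|>\varepsilon\text{ for all }t\ge0 \,\big|\, X_0=x_0,Y_0=y_0\big)=0. \]
   Context: A reflected (reflecting) Brownian motion in \(\overline{D}\) started at \(x_0\) is the process \(X\) in \(\overline{D}\) solving \(X_t=x_0+B_t+\int_0^t\nu(X_s)\,dL^X_s\), where \(B\) is a standard planar Brownian motion, \(\nu\) is an inward-pointing unit normal vector field on \(\partial D\), and \(L^X\) is the minimal non-decreasing boundary local time keeping \(X\) in \(\overline{D}\). A coupling is a family of processes \((X,Y)\) on \(\overline{D}^2\), one for each pair of starting points, with \(X\) and \(Y\) each separately reflected Brownian motions sharing the transition semigroup \(P^z_t\); it is co-adapted if for all \(s,t\ge0\), \(z\), measurable \(A\): \(\mathbb{P}(X_{s+t}\in A\mid X_s=z, X_u,Y_u:u\le s)=P^z_t(A)\) and \(\mathbb{P}(Y_{s+t}\in A\mid Y_s=z, X_u,Y_u:u\le s)=P^z_t(A)\). A coupling is shy if there exist starting points \(x_0\ne y_0\) and \(\varepsilon>0\) with \(\mathbb{P}(\|X_t-Y_t\|>\varepsilon\text{ for all }t\mid X_0=x_0,Y_0=y_0)>0\). *)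

theory Defs
  imports "HOL-Probability.Probability"
begin

type_synonym pt = "real ^ 2"

definition std_planar_bm :: "'a measure \<Rightarrow> (real \<Rightarrow> 'a \<Rightarrow> pt) \<Rightarrow> bool" where
  "std_planar_bm M B \<longleftrightarrow>
     prob_space M \<and>
     (\<forall>t\<ge>0. B t \<in> borel_measurable M) \<and>
     (AE \<omega> in M. B 0 \<omega> = 0 \<and> continuous_on {0..} (\<lambda>t. B t \<omega>)) \<and>
     (\<forall>(\<tau>::nat \<Rightarrow> real) (n::nat). strict_mono \<tau> \<and> 0 \<le> \<tau> 0 \<longrightarrow>
        prob_space.indep_vars M (\<lambda>_. borel)
          (\<lambda>(k, i) \<omega>. (B (\<tau> (Suc k)) \<omega> - B (\<tau> k) \<omega>) $ i) ({..<n} \<times> (UNIV :: 2 set)) \<and>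
        (\<forall>k i. distributed M lborel (\<lambda>\<omega>. (B (\<tau> (Suc k)) \<omega> - B (\<tau> k) \<omega>) $ i)
                 (\<lambda>x. ennreal (normal_density 0 (sqrt (\<tau> (Suc k) - \<tau> k)) x))))"

definition inward_unit_normal :: "pt set \<Rightarrow> (pt \<Rightarrow> pt) \<Rightarrow> bool" where
  "inward_unit_normal D \<nu> \<longleftrightarrow>
     (\<forall>z\<in>frontier D. norm (\<nu> z) = 1 \<and> (\<forall>w\<in>D. 0 \<le> (w - z) \<bullet> \<nu> z))"

text \<open>Deterministic Skorokhod (reflection) problem for a single path:
  x t = x0 + b t + \<integral>_0^t \<nu>(x s) dl s, with x in the closure of D, and l continuous,
  non-decreasing, l 0 = 0, increasing only when x is on the boundary (minimality).
  The Stieltjes integral is taken w.r.t. the Lebesgue-Stieltjes measure of l.\<close>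
definition skorokhod ::
  "pt set \<Rightarrow> (pt \<Rightarrow> pt) \<Rightarrow> pt \<Rightarrow> (real \<Rightarrow> pt) \<Rightarrow> (real \<Rightarrow> pt) \<Rightarrow> (real \<Rightarrow> real) \<Rightarrow> bool" where
  "skorokhod D \<nu> x0 b x l \<longleftrightarrow>
     continuous_on {0..} x \<and> (\<forall>t\<ge>0. x t \<in> closure D) \<and>
     l 0 = 0 \<and> mono_on {0..} l \<and> continuous_on {0..} l \<and>
     emeasure (interval_measure (\<lambda>s. l (max 0 s))) {s. 0 \<le> s \<and> x s \<notin> frontier D} = 0 \<and>
     (\<forall>t\<ge>0. set_integrable (interval_measure (\<lambda>s. l (max 0 s))) {0..t} (\<lambda>s. \<nu> (x s)) \<and>
        x t = x0 + b t + set_lebesgue_integral (interval_measure (\<lambda>s. l (max 0 s))) {0..t} (\<lambda>s. \<nu> (x s)))"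

definition rbm :: "'a measure \<Rightarrow> pt set \<Rightarrow> (pt \<Rightarrow> pt) \<Rightarrow> pt \<Rightarrow> (real \<Rightarrow> 'a \<Rightarrow> pt) \<Rightarrow> bool" where
  "rbm M D \<nu> x0 X \<longleftrightarrow>
     prob_space M \<and> (\<forall>t\<ge>0. X t \<in> borel_measurable M) \<and>
     (\<exists>B (L :: real \<Rightarrow> 'a \<Rightarrow> real). std_planar_bm M B \<and>
        (AE \<omega> in M. skorokhod D \<nu> x0 (\<lambda>t. B t \<omega>) (\<lambda>t. X t \<omega>) (\<lambda>t. L t \<omega>)))"

definition joint_filt :: "'a measure \<Rightarrow> (real \<Rightarrow> 'a \<Rightarrow> pt) \<Rightarrow> (real \<Rightarrow> 'a \<Rightarrow> pt) \<Rightarrow> real \<Rightarrow> 'a measure" where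
  "joint_filt M X Y s = sigma (space M)
     ({X u -` A \<inter> space M | u A. 0 \<le> u \<and> u \<le> s \<and> A \<in> sets borel} \<union>
      {Y u -` A \<inter> space M | u A. 0 \<le> u \<and> u \<le> s \<and> A \<in> sets borel})"

definition rbm_semigroup :: "'a itself \<Rightarrow> pt set \<Rightarrow> (pt \<Rightarrow> pt) \<Rightarrow> (pt \<Rightarrow> real \<Rightarrow> pt set \<Rightarrow> real) \<Rightarrow> bool" where
  "rbm_semigroup _ D \<nu> P \<longleftrightarrow>
     (\<forall>(M :: 'a measure) X z. z \<in> closure D \<longrightarrow> rbm M D \<nu> z X \<longrightarrow>
        (\<forall>t\<ge>0. \<forall>A\<in>sets borel. measure M {\<omega> \<in> space M. X t \<omega> \<in> A} = P z t A))"

definition coadapted :: "'a measure \<Rightarrow> (pt \<Rightarrow> real \<Rightarrow> pt set \<Rightarrow> real) \<Rightarrow>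
    (real \<Rightarrow> 'a \<Rightarrow> pt) \<Rightarrow> (real \<Rightarrow> 'a \<Rightarrow> pt) \<Rightarrow> bool" where
  "coadapted M P X Y \<longleftrightarrow>
     (\<forall>s\<ge>0. \<forall>t\<ge>0. \<forall>A\<in>sets borel.
        (AE \<omega> in M. real_cond_exp M (joint_filt M X Y s) (\<lambda>\<omega>. indicator A (X (s + t) \<omega>)) \<omega>
                     = P (X s \<omega>) t A) \<and>
        (AE \<omega> in M. real_cond_exp M (joint_filt M X Y s) (\<lambda>\<omega>. indicator A (Y (s + t) \<omega>)) \<omega>
                     = P (Y s \<omega>) t A))"

definition coadapted_rbm_coupling :: "pt set \<Rightarrow> (pt \<Rightarrow> pt) \<Rightarrow> (pt \<times> pt \<Rightarrow> 'a measure) \<Rightarrow>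
    (pt \<times> pt \<Rightarrow> real \<Rightarrow> 'a \<Rightarrow> pt) \<Rightarrow> (pt \<times> pt \<Rightarrow> real \<Rightarrow> 'a \<Rightarrow> pt) \<Rightarrow> bool" where
  "coadapted_rbm_coupling D \<nu> Mc Xc Yc \<longleftrightarrow>
     (\<exists>P. rbm_semigroup TYPE('a) D \<nu> P \<and>
        (\<forall>x\<in>closure D. \<forall>y\<in>closure D.
           rbm (Mc (x, y)) D \<nu> x (Xc (x, y)) \<and> rbm (Mc (x, y)) D \<nu> y (Yc (x, y)) \<and>
           coadapted (Mc (x, y)) P (Xc (x, y)) (Yc (x, y))))"

end

theory Submission
  imports Defs
begin

text \<open>Playing the lion \<open>X\<close> against the man \<open>Y\<close> produces a function \<open>W\<close> on pairs of points at distance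
  at least \<open>\<epsilon>\<close> whose normal derivatives are positive on the boundary and whose gradients satisfy
  \<open>|W\<^sub>x| > |W\<^sub>y|\<close>. Whatever the correlation of the two driving noises, the martingale part of
  \<open>W(X, Y)\<close> then has quadratic variation bounded below, because the noise of \<open>Y\<close> cannot cancel that
  of \<open>X\<close>; hence for large \<open>K\<close> the bounded process \<open>exp (K W(X, Y))\<close> has drift bounded below while
  the processes stay \<open>\<epsilon>\<close> apart, which they therefore cannot do forever.

  For \<open>W\<close> take \<open>- |x - y|\<^sup>2 / 2\<close>, for which \<open>|W\<^sub>x| = |W\<^sub>y|\<close> and the normal derivatives are
  nonnegative, plus a small multiple of \<open>(|y - p|\<^sup>2 - |x - p|\<^sup>2) / 2\<close>, which favours the lion strictly.
  The latter has the wrong normal derivative only where \<open>x\<close> and \<open>y\<close> lie on a common boundary segment;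
  the finitely many directions of segments of length at least \<open>\<epsilon>\<close> are corrected one by one.

  No stochastic calculus is needed. Over a time step of fixed small length \<open>h\<close> the strict positivity of the
  normal derivatives absorbs all errors caused by the local time, provided the Brownian path stays
  small, and the exceptional event has probability \<open>O(h\<^sup>2)\<close>. The cross term of the two increments is
  removed by \<open>(\<alpha> + \<beta>)\<^sup>2 \<ge> \<mu> \<alpha>\<^sup>2 - \<mu> / (1 - \<mu>) \<beta>\<^sup>2\<close>, so that only the conditional law of each process
  separately, and hence only the transition semigroup, is used.\<close>

section \<open>Normals of a convex planar domain\<close>

text \<open>Write W = - |x - y|^2 / 2 + d g. Then |W_x|^2 - |W_y|^2 = - 2 d (x - y).(g_x + g_y) +
  O(d^2), so to first order only the derivative of g under a common translation of both points
  counts. For g = (|y - p|^2 - |x - p|^2) / 2, (x - y).(g_x + g_y) is - |x - y|^2, which is the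
  lion's advantage. By convexity the normal derivative (y - x).n of the main term at x is
  nonnegative; it vanishes only if y lies on the supporting line with normal n at x, so the sign of
  g_x.n matters there alone. This is where the plane is used: the supporting lines that meet the
  closure in a segment of length at least \<epsilon> have finitely many normals. Strict positivity
  is needed because the local time gathered in a step of length h can be of order sqrt h, far above
  the drift gain of order h: an error proportional to the local time must be paid by a gain
  proportional to it. In exp (K W) the terms of unknown sign have order K and the quadratic
  variation has order K^2, hence a large K.\<close>

definition normals :: "pt set \<Rightarrow> (pt \<times> pt) set" where
  "normals D = {(z, n). z \<in> closure D \<and> norm n = 1 \<and> (\<forall>w\<in>closure D. 0 \<le> (w - z) \<bullet> n)}"

definition flat_normals :: "pt set \<Rightarrow> real \<Rightarrow> pt set" where
  "flat_normals D e = {n. \<exists>a\<in>closure D. (a, n) \<in> normals D \<and>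
     (\<exists>b\<in>closure D. e \<le> norm (b - a) \<and> (b - a) \<bullet> n = 0)}"

lemma inward_unit_normal_normals:
  assumes "inward_unit_normal D \<nu>" "z \<in> frontier D"
  shows "(z, \<nu> z) \<in> normals D"
proof -
  have "closure D \<subseteq> {w. 0 \<le> (w - z) \<bullet> \<nu> z}"
    using assms by (intro closure_minimal closed_Collect_le continuous_intros)
      (auto simp: inward_unit_normal_def)
  then show ?thesis using assms by (auto simp: normals_def inward_unit_normal_def frontier_def)
qed

text \<open>The plane has a single direction orthogonal to \<open>n\<close>, that of
  \<open>w\<close>; so this is Pythagoras for the components of the unit vector \<open>m\<close>
  along \<open>n\<close> and along \<open>w\<close>, and \<open>m \<bullet> w\<close> is the length
  of \<open>w\<close> times the sine of the angle between \<open>m\<close> and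
  \<open>n\<close>.\<close>

lemma planar_orthogonal:
  fixes w m n :: pt
  assumes "w \<bullet> n = 0" "norm n = 1" "norm m = 1"
  shows "(m \<bullet> w)\<^sup>2 = (norm w)\<^sup>2 * (1 - (m \<bullet> n)\<^sup>2)"
proof -
  have w: "w $ 1 * n $ 1 + w $ 2 * n $ 2 = 0"
    using assms(1) by (simp add: inner_vec_def sum_2)
  have n: "n $ 1 * n $ 1 + n $ 2 * n $ 2 = 1"
    using assms(2) by (simp add: norm_eq_1 inner_vec_def sum_2)
  have m: "m $ 1 * m $ 1 + m $ 2 * m $ 2 = 1"
    using assms(3) by (simp add: norm_eq_1 inner_vec_def sum_2)
  have "(m $ 1 * w $ 1 + m $ 2 * w $ 2)\<^sup>2
      = (w $ 1 * w $ 1 + w $ 2 * w $ 2) * (1 - (m $ 1 * n $ 1 + m $ 2 * n $ 2)\<^sup>2)"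
    using w n m by algebra
  then show ?thesis
    by (simp add: inner_vec_def sum_2 power2_norm_eq_inner)
qed

text \<open>A selected field \<nu> may jump, for instance at corners. The relation
  \<open>normals\<close> keeps every normal at a boundary point and is therefore closed, so
  positivity of normal derivatives becomes uniform positivity. Interior points need not be excluded
  in it: the inequality has no solution \<open>n\<close> there.\<close>

lemma compact_normals:
  assumes "bounded D"
  shows "compact (normals D)"
proof -
  have "normals D = (closure D \<times> sphere 0 1) \<inter> (\<Inter>w\<in>closure D. {p. 0 \<le> (w - fst p) \<bullet> snd p})"
    by (auto simp: normals_def)
  moreover have "compact (closure D \<times> sphere (0::pt) 1)"
    using assms by (intro compact_Times) (auto simp: compact_closure)
  moreover have "closed (\<Inter>w\<in>closure D. {p. 0 \<le> (w - fst p) \<bullet> snd p})"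
    by (intro closed_INT ballI closed_Collect_le continuous_intros)
  ultimately show ?thesis by (simp add: compact_Int_closed)
qed

text \<open>Attach to each flat normal the midpoint of its boundary segment. Each midpoint lies
  above the supporting line of the other segment by at least half a length times the sine of the
  angle. Adding both estimates shows that distinct normals at distance below 1 have midpoints at
  least \<open>e / 2\<close> apart. So the pairs of midpoint and normal are uniformly separated in a
  compact set.\<close>

lemma finite_flat_normals:
  assumes "bounded D" "convex D" "e > 0"
  shows "finite (flat_normals D e)"
proof -
  let ?N = "flat_normals D e"
  define K where "K = closure D \<times> sphere (0::pt) 1"
  have cK: "compact K" unfolding K_def
    using assms by (intro compact_Times) (auto simp: compact_closure)
  have "\<forall>n\<in>?N. \<exists>a b. a \<in> closure D \<and> b \<in> closure D \<and> (a, n) \<in> normals D \<and>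
      e \<le> norm (b - a) \<and> (b - a) \<bullet> n = 0"
    unfolding flat_normals_def by blast
  then obtain a b where ab: "\<And>n. n \<in> ?N \<Longrightarrow> a n \<in> closure D \<and> b n \<in> closure D \<and>
      (a n, n) \<in> normals D \<and> e \<le> norm (b n - a n) \<and> (b n - a n) \<bullet> n = 0"
    by metis
  define m where "m n = (1/2) *\<^sub>R a n + (1/2) *\<^sub>R b n" for n
  have mid: "m n \<in> closure D" if "n \<in> ?N" for n
    unfolding m_def using ab[OF that] convex_closure[OF assms(2)]
    by (intro convexD) auto
  have one: "norm n = 1" if "n \<in> ?N" for n
    using ab[OF that] by (auto simp: normals_def)
  \<comment> \<open>Both endpoints of the segment of \<open>n'\<close> have nonnegative height over
    the supporting line of \<open>n\<close>, so their mean height is at least half the difference of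
    the two heights.\<close>
  have half: "e * (1/2) * sqrt (1 - (n' \<bullet> n)\<^sup>2) \<le> (m n' - m n) \<bullet> n"
    if n: "n \<in> ?N" and n': "n' \<in> ?N" for n n'
  proof -
    let ?t = "b n' - a n'"
    have "0 \<le> (a n' - a n) \<bullet> n" "0 \<le> (b n' - a n) \<bullet> n"
      using ab[OF n] ab[OF n'] by (auto simp: normals_def)
    moreover have "(m n - a n) \<bullet> n = 0"
      using ab[OF n] unfolding m_def by (simp add: algebra_simps)
    ultimately have *: "\<bar>?t \<bullet> n\<bar> / 2 \<le> (m n' - m n) \<bullet> n"
      unfolding m_def by (simp add: inner_diff_left inner_add_left abs_if; linarith)
    have "(n \<bullet> ?t)\<^sup>2 = (norm ?t)\<^sup>2 * (1 - (n \<bullet> n')\<^sup>2)"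
      using ab[OF n'] one n n' by (intro planar_orthogonal) auto
    then have "\<bar>?t \<bullet> n\<bar> = norm ?t * sqrt (1 - (n' \<bullet> n)\<^sup>2)"
      by (metis real_sqrt_abs real_sqrt_mult abs_norm_cancel inner_commute)
    moreover have "0 \<le> sqrt (1 - (n' \<bullet> n)\<^sup>2)"
      using Cauchy_Schwarz_ineq2[of n' n] one[OF n] one[OF n']
      by (simp add: abs_square_le_1)
    ultimately have "e * sqrt (1 - (n' \<bullet> n)\<^sup>2) \<le> \<bar>?t \<bullet> n\<bar>"
      using ab[OF n'] by (simp add: mult_right_mono)
    with * show ?thesis by simp
  qed
  have sep: "n = n'" if n: "n \<in> ?N" and n': "n' \<in> ?N" and d: "norm (m n - m n') < e / 2"
    and d': "norm (n - n') < 1" for n n'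
  proof (rule ccontr)
    assume "n \<noteq> n'"
    then have pos: "norm (n - n') > 0" by simp
    have sq: "(norm (n - n'))\<^sup>2 = 2 - 2 * (n \<bullet> n')"
      using one[OF n] one[OF n']
      by (simp add: power2_norm_eq_inner algebra_simps inner_commute norm_eq_1)
    \<comment> \<open>Closeness excludes nearly opposite normals, whose angle also has a small sine.
      Once \<open>n \<bullet> n'\<close> is nonnegative, the sine is at least half the distance of
      the normals.\<close>
    have "(norm (n - n'))\<^sup>2 \<le> 1" using d' by (simp add: abs_square_le_1)
    with sq have c0: "0 \<le> n \<bullet> n'" by simp
    have c1: "n \<bullet> n' \<le> 1" using sq by (smt (verit) zero_le_power2)
    have "(norm (n - n') / 2)\<^sup>2 \<le> 1 - (n \<bullet> n')\<^sup>2"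
    proof -
      have "(n \<bullet> n')\<^sup>2 \<le> n \<bullet> n'"
        using c0 c1 by (simp add: power2_eq_square mult_left_le)
      then show ?thesis using sq c1 by (simp add: power_divide)
    qed
    then have "norm (n - n') / 2 \<le> sqrt (1 - (n \<bullet> n')\<^sup>2)"
      using real_le_rsqrt by blast
    then have "e * (1/2) * (norm (n - n') / 2) * 2 \<le> e * (1/2) * sqrt (1 - (n \<bullet> n')\<^sup>2) * 2"
      using assms(3) by simp
    also have "\<dots> \<le> (m n' - m n) \<bullet> n + (m n - m n') \<bullet> n'"
      using half[OF n n'] half[OF n' n] by (simp add: inner_commute)
    also have "\<dots> = (m n' - m n) \<bullet> (n - n')" by (simp add: algebra_simps)
    also have "\<dots> \<le> norm (m n - m n') * norm (n - n')"
      by (metis norm_cauchy_schwarz norm_minus_commute)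
    finally have "e / 2 * norm (n - n') \<le> norm (m n - m n') * norm (n - n')" by simp
    then have "e / 2 \<le> norm (m n - m n')" using pos by simp
    with d show False by simp
  qed
  \<comment> \<open>Two points of one ball of radius \<open>r\<close> are closer than
    \<open>2 * r\<close>, which meets both thresholds \<open>e / 2\<close> and 1 of
    \<open>sep\<close>.\<close>
  define r where "r = min (e/4) (1/2)"
  have r0: "r > 0" using assms by (simp add: r_def)
  obtain C where C: "finite C" "K \<subseteq> (\<Union>c\<in>C. ball c r)"
    using cK r0 unfolding compact_eq_totally_bounded by meson
  have "\<forall>n\<in>?N. \<exists>c\<in>C. (m n, n) \<in> ball c r"
    using C mid one unfolding K_def by (force simp: subset_iff)
  then obtain f where f: "\<And>n. n \<in> ?N \<Longrightarrow> f n \<in> C \<and> (m n, n) \<in> ball (f n) r" by metis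
  have "inj_on f ?N"
  proof (rule inj_onI)
    fix n n' assume n: "n \<in> ?N" and n': "n' \<in> ?N" and eq: "f n = f n'"
    have "dist (m n, n) (m n', n') < 2 * r"
      using f[OF n] f[OF n'] eq dist_triangle2[of "(m n, n)" "(m n', n')" "f n'"]
      by (simp add: dist_commute)
    moreover have "dist (m n) (m n') \<le> dist (m n, n) (m n', n')" "dist n n' \<le> dist (m n, n) (m n', n')"
      using dist_fst_le[of "(m n, n)" "(m n', n')"] dist_snd_le[of "(m n, n)" "(m n', n')"] by auto
    ultimately show "n = n'"
      using sep[OF n n'] unfolding r_def dist_norm by auto
  qed
  moreover have "f ` ?N \<subseteq> C" using f by blast
  ultimately show ?thesis using C(1) finite_subset inj_on_finite by blast
qed

section \<open>Functions with a quadratic Taylor remainder\<close>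

text \<open>A two-sided quadratic remainder on \<open>K\<close> replaces second derivatives: only
  gradients are ever named. Continuity is required on the whole space because the processes stay in
  the closed domain only almost surely, while compositions with them must be measurable
  everywhere.\<close>

definition taylor2 :: "'a::euclidean_space set \<Rightarrow> ('a \<Rightarrow> real) \<Rightarrow> ('a \<Rightarrow> 'a) \<Rightarrow> bool" where
  "taylor2 K f f' \<longleftrightarrow> continuous_on UNIV f \<and> continuous_on UNIV f' \<and>
     (\<exists>C. \<forall>z\<in>K. \<forall>z'\<in>K. \<bar>f z' - f z - f' z \<bullet> (z' - z)\<bar> \<le> C * (norm (z' - z))\<^sup>2)"

lemma taylor2I:
  assumes "continuous_on UNIV f" "continuous_on UNIV f'"
    "\<And>z z'. z \<in> K \<Longrightarrow> z' \<in> K \<Longrightarrow> \<bar>f z' - f z - f' z \<bullet> (z' - z)\<bar> \<le> C * (norm (z' - z))\<^sup>2"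
  shows "taylor2 K f f'"
  using assms unfolding taylor2_def by blast

text \<open>The set \<open>K\<close> need not be convex, so no mean value theorem is available: the
  Lipschitz bound combines the gradient bound with the remainder, one factor of which is bounded by
  the diameter of \<open>K\<close>.\<close>

lemma taylor2_bounds:
  assumes "taylor2 K f f'" "compact K"
  obtains C where "C > 0" "\<And>z. z \<in> K \<Longrightarrow> \<bar>f z\<bar> \<le> C" "\<And>z. z \<in> K \<Longrightarrow> norm (f' z) \<le> C"
    "\<And>z z'. z \<in> K \<Longrightarrow> z' \<in> K \<Longrightarrow> \<bar>f z' - f z\<bar> \<le> C * norm (z' - z)"
    "\<And>z z'. z \<in> K \<Longrightarrow> z' \<in> K \<Longrightarrow> \<bar>f z' - f z - f' z \<bullet> (z' - z)\<bar> \<le> C * (norm (z' - z))\<^sup>2"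
proof -
  obtain C0 where C0: "\<And>z z'. z \<in> K \<Longrightarrow> z' \<in> K \<Longrightarrow>
      \<bar>f z' - f z - f' z \<bullet> (z' - z)\<bar> \<le> C0 * (norm (z' - z))\<^sup>2"
    using assms(1) unfolding taylor2_def by blast
  have "bounded (f ` K)" "bounded (f' ` K)"
    using assms unfolding taylor2_def
    by (metis compact_continuous_image compact_imp_bounded continuous_on_subset subset_UNIV)+
  then obtain C1 C2 where C12: "\<And>z. z \<in> K \<Longrightarrow> \<bar>f z\<bar> \<le> C1" "\<And>z. z \<in> K \<Longrightarrow> norm (f' z) \<le> C2"
    unfolding bounded_iff by (metis imageI real_norm_def)
  obtain d where d: "\<And>z. z \<in> K \<Longrightarrow> norm z \<le> d"
    using assms(2) compact_imp_bounded bounded_iff by metis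
  define C where "C = 1 + \<bar>C0\<bar> + \<bar>C1\<bar> + \<bar>C2\<bar> + \<bar>C0\<bar> * (2 * \<bar>d\<bar>)"
  have "\<bar>C0\<bar> * (2 * \<bar>d\<bar>) \<ge> 0" by simp
  then have C: "C > 0" "C1 \<le> C" "C2 \<le> C" "C0 \<le> C" "\<bar>C2\<bar> + \<bar>C0\<bar> * (2 * \<bar>d\<bar>) \<le> C"
    unfolding C_def by linarith+
  show thesis
  proof (rule that[OF C(1)])
    fix z assume z: "z \<in> K"
    show "\<bar>f z\<bar> \<le> C" "norm (f' z) \<le> C" using C12[OF z] C by auto
    fix z' assume z': "z' \<in> K"
    let ?n = "norm (z' - z)"
    show "\<bar>f z' - f z - f' z \<bullet> (z' - z)\<bar> \<le> C * ?n\<^sup>2"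
      using C0[OF z z'] C(4) by (smt (verit) mult_right_mono zero_le_power2)
    have "?n \<le> 2 * \<bar>d\<bar>" using d[OF z] d[OF z'] norm_triangle_ineq4[of z' z] by linarith
    then have "\<bar>C0\<bar> * ?n * ?n \<le> \<bar>C0\<bar> * (2 * \<bar>d\<bar>) * ?n"
      by (intro mult_right_mono mult_left_mono) auto
    moreover have "C0 * ?n\<^sup>2 \<le> \<bar>C0\<bar> * ?n * ?n"
      by (simp add: power2_eq_square mult.assoc mult_right_mono)
    moreover have "\<bar>f' z \<bullet> (z' - z)\<bar> \<le> \<bar>C2\<bar> * ?n"
    proof -
      have "\<bar>f' z \<bullet> (z' - z)\<bar> \<le> norm (f' z) * ?n" by (rule Cauchy_Schwarz_ineq2)
      also have "\<dots> \<le> \<bar>C2\<bar> * ?n" using C12(2)[OF z] by (intro mult_right_mono) auto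
      finally show ?thesis .
    qed
    ultimately have "\<bar>f z' - f z\<bar> \<le> (\<bar>C2\<bar> + \<bar>C0\<bar> * (2 * \<bar>d\<bar>)) * ?n"
      using C0[OF z z'] by (simp only: distrib_right) linarith
    also have "\<dots> \<le> C * ?n" using C by (intro mult_right_mono) auto
    finally show "\<bar>f z' - f z\<bar> \<le> C * ?n" .
  qed
qed

lemma taylor2_affine: "taylor2 K (\<lambda>z. u \<bullet> z + k) (\<lambda>z. u)"
  by (rule taylor2I[where C=0]) (auto intro!: continuous_intros simp: inner_diff_right)

lemma taylor2_const: "taylor2 K (\<lambda>z. k) (\<lambda>z. 0)"
  by (rule taylor2I[where C=0]) auto

lemma taylor2_add:
  assumes "taylor2 K f f'" "taylor2 K g g'"
  shows "taylor2 K (\<lambda>z. f z + g z) (\<lambda>z. f' z + g' z)"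
proof -
  obtain C D where C: "\<forall>z\<in>K. \<forall>z'\<in>K. \<bar>f z' - f z - f' z \<bullet> (z' - z)\<bar> \<le> C * (norm (z' - z))\<^sup>2"
    and D: "\<forall>z\<in>K. \<forall>z'\<in>K. \<bar>g z' - g z - g' z \<bullet> (z' - z)\<bar> \<le> D * (norm (z' - z))\<^sup>2"
    using assms unfolding taylor2_def by blast
  show ?thesis
  proof (rule taylor2I[where C="C + D"])
    fix z z' assume "z \<in> K" "z' \<in> K"
    with C D have "\<bar>f z' - f z - f' z \<bullet> (z' - z)\<bar> \<le> C * (norm (z' - z))\<^sup>2"
      "\<bar>g z' - g z - g' z \<bullet> (z' - z)\<bar> \<le> D * (norm (z' - z))\<^sup>2" by auto
    then show "\<bar>f z' + g z' - (f z + g z) - (f' z + g' z) \<bullet> (z' - z)\<bar> \<le> (C + D) * (norm (z' - z))\<^sup>2"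
      by (simp add: algebra_simps)
  qed (use assms in \<open>auto simp: taylor2_def intro!: continuous_intros\<close>)
qed

lemma taylor2_cmult:
  assumes "taylor2 K f f'"
  shows "taylor2 K (\<lambda>z. k * f z) (\<lambda>z. k *\<^sub>R f' z)"
proof -
  obtain C where C: "\<forall>z\<in>K. \<forall>z'\<in>K. \<bar>f z' - f z - f' z \<bullet> (z' - z)\<bar> \<le> C * (norm (z' - z))\<^sup>2"
    using assms unfolding taylor2_def by blast
  show ?thesis
  proof (rule taylor2I[where C="\<bar>k\<bar> * C"])
    fix z z' assume "z \<in> K" "z' \<in> K"
    with C have "\<bar>f z' - f z - f' z \<bullet> (z' - z)\<bar> \<le> C * (norm (z' - z))\<^sup>2" by auto
    then have "\<bar>k\<bar> * \<bar>f z' - f z - f' z \<bullet> (z' - z)\<bar> \<le> \<bar>k\<bar> * (C * (norm (z' - z))\<^sup>2)"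
      by (rule mult_left_mono) auto
    moreover have "k * f z' - k * f z - (k *\<^sub>R f' z) \<bullet> (z' - z) = k * (f z' - f z - f' z \<bullet> (z' - z))"
      by (simp add: algebra_simps)
    ultimately show "\<bar>k * f z' - k * f z - (k *\<^sub>R f' z) \<bullet> (z' - z)\<bar> \<le> \<bar>k\<bar> * C * (norm (z' - z))\<^sup>2"
      by (metis abs_mult mult.assoc)
  qed (use assms in \<open>auto simp: taylor2_def intro!: continuous_intros\<close>)
qed

lemma taylor2_sum:
  assumes "finite S" "\<And>s. s \<in> S \<Longrightarrow> taylor2 K (f s) (f' s)"
  shows "taylor2 K (\<lambda>z. \<Sum>s\<in>S. f s z) (\<lambda>z. \<Sum>s\<in>S. f' s z)"
  using assms by (induction S rule: finite_induct) (auto intro!: taylor2_const taylor2_add)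

lemma taylor2_mult:
  assumes "taylor2 K f f'" "taylor2 K g g'" "compact K"
  shows "taylor2 K (\<lambda>z. f z * g z) (\<lambda>z. g z *\<^sub>R f' z + f z *\<^sub>R g' z)"
proof -
  obtain C where C: "C > 0" "\<And>z. z \<in> K \<Longrightarrow> \<bar>f z\<bar> \<le> C" "\<And>z. z \<in> K \<Longrightarrow> norm (f' z) \<le> C"
    "\<And>z z'. z \<in> K \<Longrightarrow> z' \<in> K \<Longrightarrow> \<bar>f z' - f z\<bar> \<le> C * norm (z' - z)"
    "\<And>z z'. z \<in> K \<Longrightarrow> z' \<in> K \<Longrightarrow> \<bar>f z' - f z - f' z \<bullet> (z' - z)\<bar> \<le> C * (norm (z' - z))\<^sup>2"
    using taylor2_bounds[OF assms(1,3)] by blast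
  obtain D where D: "D > 0" "\<And>z. z \<in> K \<Longrightarrow> \<bar>g z\<bar> \<le> D" "\<And>z. z \<in> K \<Longrightarrow> norm (g' z) \<le> D"
    "\<And>z z'. z \<in> K \<Longrightarrow> z' \<in> K \<Longrightarrow> \<bar>g z' - g z\<bar> \<le> D * norm (z' - z)"
    "\<And>z z'. z \<in> K \<Longrightarrow> z' \<in> K \<Longrightarrow> \<bar>g z' - g z - g' z \<bullet> (z' - z)\<bar> \<le> D * (norm (z' - z))\<^sup>2"
    using taylor2_bounds[OF assms(2,3)] by blast
  show ?thesis
  proof (rule taylor2I[where C="3 * (C * D)"])
    fix z z' assume z: "z \<in> K" "z' \<in> K"
    let ?n = "norm (z' - z)"
    have "f z' * g z' - f z * g z - (g z *\<^sub>R f' z + f z *\<^sub>R g' z) \<bullet> (z' - z)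
      = (f z' - f z - f' z \<bullet> (z' - z)) * g z + f z' * (g z' - g z - g' z \<bullet> (z' - z))
        + (f z' - f z) * (g' z \<bullet> (z' - z))"
      by (simp add: algebra_simps)
    also have "\<bar>\<dots>\<bar> \<le> \<bar>f z' - f z - f' z \<bullet> (z' - z)\<bar> * \<bar>g z\<bar> + \<bar>f z'\<bar> * \<bar>g z' - g z - g' z \<bullet> (z' - z)\<bar>
        + \<bar>f z' - f z\<bar> * \<bar>g' z \<bullet> (z' - z)\<bar>"
      unfolding abs_mult[symmetric] by linarith
    also have "\<dots> \<le> (C * ?n\<^sup>2) * D + C * (D * ?n\<^sup>2) + (C * ?n) * (D * ?n)"
    proof (intro add_mono mult_mono)
      have "\<bar>g' z \<bullet> (z' - z)\<bar> \<le> norm (g' z) * ?n" by (rule Cauchy_Schwarz_ineq2)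
      also have "\<dots> \<le> D * ?n" using D(3)[OF z(1)] by (intro mult_right_mono) auto
      finally show "\<bar>g' z \<bullet> (z' - z)\<bar> \<le> D * ?n" .
    qed (use C D z in auto)
    also have "\<dots> = 3 * (C * D) * ?n\<^sup>2" by (simp add: power2_eq_square algebra_simps)
    finally show "\<bar>f z' * g z' - f z * g z - (g z *\<^sub>R f' z + f z *\<^sub>R g' z) \<bullet> (z' - z)\<bar> \<le> 3 * (C * D) * ?n\<^sup>2" .
  qed (use assms in \<open>auto simp: taylor2_def intro!: continuous_intros\<close>)
qed

lemma taylor2_inverse:
  assumes "taylor2 K f f'" "compact K" "\<And>z. m \<le> f z" "m > 0"
  shows "taylor2 K (\<lambda>z. 1 / f z) (\<lambda>z. (- 1 / (f z)\<^sup>2) *\<^sub>R f' z)"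
proof -
  obtain C where C: "C > 0" "\<And>z. z \<in> K \<Longrightarrow> \<bar>f z\<bar> \<le> C" "\<And>z. z \<in> K \<Longrightarrow> norm (f' z) \<le> C"
    "\<And>z z'. z \<in> K \<Longrightarrow> z' \<in> K \<Longrightarrow> \<bar>f z' - f z\<bar> \<le> C * norm (z' - z)"
    "\<And>z z'. z \<in> K \<Longrightarrow> z' \<in> K \<Longrightarrow> \<bar>f z' - f z - f' z \<bullet> (z' - z)\<bar> \<le> C * (norm (z' - z))\<^sup>2"
    using taylor2_bounds[OF assms(1,2)] by blast
  have pos: "f z > 0" "f z \<noteq> 0" for z using assms(3)[of z] assms(4) by auto
  show ?thesis
  proof (rule taylor2I[where C="C\<^sup>2 / m^3 + C / m\<^sup>2"])
    fix z z' assume z: "z \<in> K" "z' \<in> K"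
    let ?n = "norm (z' - z)" and ?d = "f' z \<bullet> (z' - z)"
    have "1 / f z' - 1 / f z - ((- 1 / (f z)\<^sup>2) *\<^sub>R f' z) \<bullet> (z' - z)
      = (f z' - f z)\<^sup>2 / (f z' * (f z)\<^sup>2) - (f z' - f z - ?d) / (f z)\<^sup>2"
      using pos[of z] pos[of z'] by (simp add: field_simps power2_eq_square)
    also have "\<bar>\<dots>\<bar> \<le> (f z' - f z)\<^sup>2 / (f z' * (f z)\<^sup>2) + \<bar>f z' - f z - ?d\<bar> / (f z)\<^sup>2"
      using pos[of z] pos[of z'] by (intro abs_triangle_ineq4[THEN order_trans]) (simp add: abs_divide abs_mult)
    also have "\<dots> \<le> (C * ?n)\<^sup>2 / (m * m\<^sup>2) + C * ?n\<^sup>2 / m\<^sup>2"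
    proof (intro add_mono frac_le)
      show "(f z' - f z)\<^sup>2 \<le> (C * ?n)\<^sup>2" using C(4)[OF z] C(1) by (intro power2_le_iff_abs_le[THEN iffD2]) auto
      show "m * m\<^sup>2 \<le> f z' * (f z)\<^sup>2" "m\<^sup>2 \<le> (f z)\<^sup>2"
        using assms(3)[of z] assms(3)[of z'] assms(4) pos[of z'] by (auto intro!: mult_mono power_mono)
      show "0 < m * m\<^sup>2" "0 < m\<^sup>2" using assms(4) by auto
    qed (use C z in auto)
    also have "\<dots> = (C\<^sup>2 / m^3 + C / m\<^sup>2) * ?n\<^sup>2"
      by (simp add: field_simps power2_eq_square power3_eq_cube)
    finally show "\<bar>1 / f z' - 1 / f z - ((- 1 / (f z)\<^sup>2) *\<^sub>R f' z) \<bullet> (z' - z)\<bar>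
        \<le> (C\<^sup>2 / m^3 + C / m\<^sup>2) * ?n\<^sup>2" .
  qed (use assms pos in \<open>auto simp: taylor2_def intro!: continuous_intros\<close>)
qed

lemma taylor2_cong:
  assumes "taylor2 K f f'" "\<And>z. f z = g z" "\<And>z. f' z = g' z"
  shows "taylor2 K g g'"
proof -
  have "f = g" "f' = g'" using assms by auto
  with assms show ?thesis by simp
qed

text \<open>\<open>cutoff t\<close> agrees with the identity to first order at \<open>0\<close>, while its values everywhere, and its derivative
  away from \<open>0\<close>, vanish as \<open>t\<close> tends to \<open>0\<close>.\<close>
definition cutoff :: "real \<Rightarrow> real \<Rightarrow> real" where
  "cutoff t a = t\<^sup>2 * a / (t\<^sup>2 + a\<^sup>2)"

definition cutoff' :: "real \<Rightarrow> real \<Rightarrow> real" where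
  "cutoff' t a = t\<^sup>2 * (t\<^sup>2 - a\<^sup>2) / (t\<^sup>2 + a\<^sup>2)\<^sup>2"

lemma taylor2_cutoff:
  assumes "compact K" "t > 0"
  shows "taylor2 K (\<lambda>z. cutoff t (u \<bullet> z)) (\<lambda>z. cutoff' t (u \<bullet> z) *\<^sub>R u)"
proof -
  have u: "taylor2 K (\<lambda>z. u \<bullet> z) (\<lambda>z. u)" using taylor2_affine[of K u 0] by simp
  have den: "taylor2 K (\<lambda>z. t\<^sup>2 + (u \<bullet> z) * (u \<bullet> z)) (\<lambda>z. (2 * (u \<bullet> z)) *\<^sub>R u)"
    by (rule taylor2_cong[OF taylor2_add[OF taylor2_const[of K "t\<^sup>2"] taylor2_mult[OF u u assms(1)]]])
      (simp_all add: algebra_simps flip: scaleR_add_left)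
  have ge: "t\<^sup>2 \<le> t\<^sup>2 + (u \<bullet> z) * (u \<bullet> z)" for z by simp
  have t2: "t\<^sup>2 > 0" using assms(2) by simp
  show ?thesis
  proof (rule taylor2_cong[OF taylor2_mult[OF taylor2_cmult[OF u, of "t\<^sup>2"] taylor2_inverse[OF den assms(1) ge t2] assms(1)]])
    fix z
    have ne: "t\<^sup>2 + (u \<bullet> z) * (u \<bullet> z) > 0" using t2 by (smt (verit) zero_le_square)
    show "t\<^sup>2 * (u \<bullet> z) * (1 / (t\<^sup>2 + u \<bullet> z * (u \<bullet> z))) = cutoff t (u \<bullet> z)"
      by (simp add: cutoff_def power2_eq_square)
    have "(1 / (t\<^sup>2 + u \<bullet> z * (u \<bullet> z))) * t\<^sup>2 + t\<^sup>2 * (u \<bullet> z) * (- 1 / (t\<^sup>2 + u \<bullet> z * (u \<bullet> z))\<^sup>2 * (2 * (u \<bullet> z)))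
      = cutoff' t (u \<bullet> z)"
      using ne unfolding cutoff'_def power2_eq_square[of "u \<bullet> z"]
      by (simp add: divide_simps) (simp add: power2_eq_square algebra_simps)
    from arg_cong[OF this, of "\<lambda>k. k *\<^sub>R u"]
    show "(1 / (t\<^sup>2 + u \<bullet> z * (u \<bullet> z))) *\<^sub>R t\<^sup>2 *\<^sub>R u +
         (t\<^sup>2 * (u \<bullet> z)) *\<^sub>R (- 1 / (t\<^sup>2 + u \<bullet> z * (u \<bullet> z))\<^sup>2) *\<^sub>R (2 * (u \<bullet> z)) *\<^sub>R u =
         cutoff' t (u \<bullet> z) *\<^sub>R u"
      by (simp only: scaleR_add_left scaleR_scaleR mult.assoc)
  qed
qed

lemma cutoff_bounds:
  assumes "t > 0"
  shows "\<bar>cutoff t a\<bar> \<le> t" "\<bar>cutoff t a * a\<bar> \<le> t\<^sup>2" "a \<noteq> 0 \<Longrightarrow> \<bar>cutoff' t a\<bar> \<le> t\<^sup>2 / a\<^sup>2"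
    "cutoff' t 0 = 1" "cutoff t 0 = 0"
proof -
  have p: "t\<^sup>2 + a\<^sup>2 > 0" using assms by (simp add: add_pos_nonneg)
  have "2 * (t * \<bar>a\<bar>) \<le> t\<^sup>2 + a\<^sup>2"
    using zero_le_power2[of "t - \<bar>a\<bar>"] by (simp add: power2_eq_square algebra_simps)
  moreover have "0 \<le> t * \<bar>a\<bar>" using assms by simp
  ultimately have "t * \<bar>a\<bar> \<le> t\<^sup>2 + a\<^sup>2" by linarith
  then have "t * (t * \<bar>a\<bar>) \<le> t * (t\<^sup>2 + a\<^sup>2)" using assms by simp
  then show "\<bar>cutoff t a\<bar> \<le> t"
    using p unfolding cutoff_def by (simp add: abs_mult field_simps power2_eq_square)
  have "t\<^sup>2 * a\<^sup>2 \<le> t\<^sup>2 * (t\<^sup>2 + a\<^sup>2)" by (intro mult_left_mono) auto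
  then show "\<bar>cutoff t a * a\<bar> \<le> t\<^sup>2"
    using p unfolding cutoff_def by (simp add: abs_mult field_simps power2_eq_square)
  show "\<bar>cutoff' t a\<bar> \<le> t\<^sup>2 / a\<^sup>2" if "a \<noteq> 0"
  proof -
    have a2: "a\<^sup>2 > 0" using that by simp
    have "\<bar>t\<^sup>2 - a\<^sup>2\<bar> \<le> t\<^sup>2 + a\<^sup>2" by (smt (verit) zero_le_power2)
    then have "\<bar>cutoff' t a\<bar> \<le> t\<^sup>2 * (t\<^sup>2 + a\<^sup>2) / (t\<^sup>2 + a\<^sup>2)\<^sup>2"
      unfolding cutoff'_def abs_divide abs_mult using p by (simp add: divide_right_mono mult_left_mono)
    also have "\<dots> = t\<^sup>2 / (t\<^sup>2 + a\<^sup>2)" using p by (simp add: power2_eq_square)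
    also have "\<dots> \<le> t\<^sup>2 / a\<^sup>2" using a2 p by (intro divide_left_mono) auto
    finally show ?thesis .
  qed
  show "cutoff' t 0 = 1" using assms by (simp add: cutoff'_def power2_eq_square)
  show "cutoff t 0 = 0" by (simp add: cutoff_def)
qed

lemma taylor2_sq_dist:
  fixes K :: "('a::euclidean_space \<times> 'a) set"
  shows "taylor2 K (\<lambda>z. (norm (fst z - p))\<^sup>2) (\<lambda>z. (2 *\<^sub>R (fst z - p), 0))"
    "taylor2 K (\<lambda>z. (norm (snd z - p))\<^sup>2) (\<lambda>z. (0, 2 *\<^sub>R (snd z - p)))"
    "taylor2 K (\<lambda>z. (norm (fst z - snd z))\<^sup>2) (\<lambda>z. (2 *\<^sub>R (fst z - snd z), - 2 *\<^sub>R (fst z - snd z)))"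
proof -
  have sq: "(norm (u + v))\<^sup>2 - (norm u)\<^sup>2 - 2 * (u \<bullet> v) = (norm v)\<^sup>2" for u v :: 'a
    by (simp add: power2_norm_eq_inner algebra_simps inner_commute)
  have nf: "(norm (fst d))\<^sup>2 \<le> 1 * (norm d)\<^sup>2" "(norm (snd d))\<^sup>2 \<le> 1 * (norm d)\<^sup>2"
    for d :: "'a \<times> 'a"
    using norm_fst_le[of "fst d" "snd d"] norm_snd_le[of "snd d" "fst d"] by (simp_all add: power_mono)
  have nd: "(norm (fst d - snd d))\<^sup>2 \<le> 4 * (norm d)\<^sup>2" for d :: "'a \<times> 'a"
  proof -
    have "norm (fst d - snd d) \<le> 2 * norm d"
      using norm_triangle_ineq4[of "fst d" "snd d"] norm_fst_le[of "fst d" "snd d"] norm_snd_le[of "snd d" "fst d"]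
      by simp
    then have "(norm (fst d - snd d))\<^sup>2 \<le> (2 * norm d)\<^sup>2" by (rule power_mono) simp
    then show ?thesis by (simp add: power_mult_distrib)
  qed
  show "taylor2 K (\<lambda>z. (norm (fst z - p))\<^sup>2) (\<lambda>z. (2 *\<^sub>R (fst z - p), 0))"
  proof (rule taylor2I[where C=1])
    fix z z' :: "'a \<times> 'a"
    show "\<bar>(norm (fst z' - p))\<^sup>2 - (norm (fst z - p))\<^sup>2 - (2 *\<^sub>R (fst z - p), 0) \<bullet> (z' - z)\<bar> \<le> 1 * (norm (z' - z))\<^sup>2"
      using sq[of "fst z - p" "fst (z' - z)"] nf(1)[of "z' - z"] by (simp add: inner_prod_def)
  qed (auto intro!: continuous_intros)
  show "taylor2 K (\<lambda>z. (norm (snd z - p))\<^sup>2) (\<lambda>z. (0, 2 *\<^sub>R (snd z - p)))"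
  proof (rule taylor2I[where C=1])
    fix z z' :: "'a \<times> 'a"
    show "\<bar>(norm (snd z' - p))\<^sup>2 - (norm (snd z - p))\<^sup>2 - (0, 2 *\<^sub>R (snd z - p)) \<bullet> (z' - z)\<bar> \<le> 1 * (norm (z' - z))\<^sup>2"
      using sq[of "snd z - p" "snd (z' - z)"] nf(2)[of "z' - z"] by (simp add: inner_prod_def)
  qed (auto intro!: continuous_intros)
  show "taylor2 K (\<lambda>z. (norm (fst z - snd z))\<^sup>2) (\<lambda>z. (2 *\<^sub>R (fst z - snd z), - 2 *\<^sub>R (fst z - snd z)))"
  proof (rule taylor2I[where C=4])
    fix z z' :: "'a \<times> 'a"
    show "\<bar>(norm (fst z' - snd z'))\<^sup>2 - (norm (fst z - snd z))\<^sup>2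
        - (2 *\<^sub>R (fst z - snd z), - 2 *\<^sub>R (fst z - snd z)) \<bullet> (z' - z)\<bar> \<le> 4 * (norm (z' - z))\<^sup>2"
      using sq[of "fst z - snd z" "fst (z' - z) - snd (z' - z)"] nd[of "z' - z"]
      by (simp add: inner_prod_def algebra_simps)
  qed (auto intro!: continuous_intros)
qed

section \<open>The pursuit potential\<close>

text \<open>With w = x - y and m = (x + y)/2 - p, the first line equals - w.m. Each pair \<nu>,
  -\<nu> in \<open>S\<close> adds \<open>cutoff t (\<nu> \<bullet> w) * (\<nu> \<bullet> m)\<close>,
  which cancels the \<nu>-component of - w.m to first order where
  \<open>\<nu> \<bullet> w = 0\<close> and is small elsewhere. The halving is due to both signs
  being in \<open>S\<close>. The last term draws both points towards the interior point
  \<open>p\<close>, which makes its inward normal derivatives positive.\<close>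

definition chase :: "pt set \<Rightarrow> real \<Rightarrow> real \<Rightarrow> pt \<Rightarrow> pt \<times> pt \<Rightarrow> real" where
  "chase S t \<eta> p z = (norm (snd z - p))\<^sup>2 / 2 - (norm (fst z - p))\<^sup>2 / 2
     + (\<Sum>\<nu>\<in>S. cutoff t (\<nu> \<bullet> (fst z - snd z)) * (\<nu> \<bullet> ((1/2) *\<^sub>R (fst z + snd z) - p))) / 2
     - \<eta> * ((norm (fst z - p))\<^sup>2 + (norm (snd z - p))\<^sup>2)"

text \<open>The gradient of \<open>chase\<close> in the first point. In each summand, one part of
  the coefficient comes from differentiating through x - y, the other through the midpoint.\<close>

definition chase_fst :: "pt set \<Rightarrow> real \<Rightarrow> real \<Rightarrow> pt \<Rightarrow> pt \<times> pt \<Rightarrow> pt" where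
  "chase_fst S t \<eta> p z = - (1 + 2 * \<eta>) *\<^sub>R (fst z - p)
     + (\<Sum>\<nu>\<in>S. ((cutoff' t (\<nu> \<bullet> (fst z - snd z)) * (\<nu> \<bullet> ((1/2) *\<^sub>R (fst z + snd z) - p))) / 2
         + cutoff t (\<nu> \<bullet> (fst z - snd z)) / 4) *\<^sub>R \<nu>)"

definition chase_snd :: "pt set \<Rightarrow> real \<Rightarrow> real \<Rightarrow> pt \<Rightarrow> pt \<times> pt \<Rightarrow> pt" where
  "chase_snd S t \<eta> p z = (1 - 2 * \<eta>) *\<^sub>R (snd z - p)
     + (\<Sum>\<nu>\<in>S. (- (cutoff' t (\<nu> \<bullet> (fst z - snd z)) * (\<nu> \<bullet> ((1/2) *\<^sub>R (fst z + snd z) - p))) / 2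
         + cutoff t (\<nu> \<bullet> (fst z - snd z)) / 4) *\<^sub>R \<nu>)"

lemma taylor2_chase:
  assumes "compact K" "t > 0" "finite S"
  shows "taylor2 K (chase S t \<eta> p) (\<lambda>z. (chase_fst S t \<eta> p z, chase_snd S t \<eta> p z))"
proof -
  \<comment> \<open>Both the difference and the midpoint, tested against \<nu>, are written as
    affine functionals of the pair, so that the product and cutoff rules apply on the space of
    pairs.\<close>
  define u where "u \<nu> = (\<nu>, - \<nu>)" for \<nu> :: pt
  define v where "v \<nu> = ((1/2) *\<^sub>R \<nu>, (1/2) *\<^sub>R \<nu>)" for \<nu> :: pt
  have u: "u \<nu> \<bullet> z = \<nu> \<bullet> (fst z - snd z)" for \<nu> z
    by (simp add: u_def inner_prod_def inner_diff_right)
  have v: "v \<nu> \<bullet> z + (- (\<nu> \<bullet> p)) = \<nu> \<bullet> ((1/2) *\<^sub>R (fst z + snd z) - p)" for \<nu> z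
    by (simp add: v_def inner_prod_def inner_diff_right inner_add_right)
  have smooth: "taylor2 K (\<lambda>z. cutoff t (\<nu> \<bullet> (fst z - snd z)) * (\<nu> \<bullet> ((1/2) *\<^sub>R (fst z + snd z) - p)))
      (\<lambda>z. (\<nu> \<bullet> ((1/2) *\<^sub>R (fst z + snd z) - p)) *\<^sub>R cutoff' t (\<nu> \<bullet> (fst z - snd z)) *\<^sub>R u \<nu>
         + cutoff t (\<nu> \<bullet> (fst z - snd z)) *\<^sub>R v \<nu>)" for \<nu>
    using taylor2_mult[OF taylor2_cutoff[OF assms(1,2), of "u \<nu>"]
        taylor2_affine[of K "v \<nu>" "- (\<nu> \<bullet> p)"] assms(1)]
    unfolding u v .
  have sum_prod: "fst (\<Sum>\<nu>\<in>S. f \<nu>) = (\<Sum>\<nu>\<in>S. fst (f \<nu>))" "snd (\<Sum>\<nu>\<in>S. f \<nu>) = (\<Sum>\<nu>\<in>S. snd (f \<nu>))"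
    for f :: "pt \<Rightarrow> pt \<times> pt" by (simp_all add: fst_sum snd_sum)
  let ?w = "\<lambda>z::pt\<times>pt. fst z - snd z" and ?m = "\<lambda>z::pt\<times>pt. (1/2) *\<^sub>R (fst z + snd z) - p"
  have main: "taylor2 K (\<lambda>z. (- 1/2 - \<eta>) * (norm (fst z - p))\<^sup>2 + (1/2 - \<eta>) * (norm (snd z - p))\<^sup>2
        + 1/2 * (\<Sum>\<nu>\<in>S. cutoff t (\<nu> \<bullet> ?w z) * (\<nu> \<bullet> ?m z)))
      (\<lambda>z. (- 1/2 - \<eta>) *\<^sub>R (2 *\<^sub>R (fst z - p), 0) + (1/2 - \<eta>) *\<^sub>R (0, 2 *\<^sub>R (snd z - p))
        + (1/2) *\<^sub>R (\<Sum>\<nu>\<in>S. (\<nu> \<bullet> ?m z) *\<^sub>R cutoff' t (\<nu> \<bullet> ?w z) *\<^sub>R u \<nu> + cutoff t (\<nu> \<bullet> ?w z) *\<^sub>R v \<nu>))"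
    by (intro taylor2_add taylor2_cmult taylor2_sum smooth taylor2_sq_dist assms(3))
  show ?thesis
  proof (rule taylor2_cong[OF main])
    fix z :: "pt \<times> pt"
    show "(- 1/2 - \<eta>) * (norm (fst z - p))\<^sup>2 + (1/2 - \<eta>) * (norm (snd z - p))\<^sup>2
        + 1/2 * (\<Sum>\<nu>\<in>S. cutoff t (\<nu> \<bullet> ?w z) * (\<nu> \<bullet> ?m z)) = chase S t \<eta> p z"
      unfolding chase_def by (simp add: algebra_simps)
    have coeff: "(- 1/2 - \<eta>) * 2 = - (1 + 2 * \<eta>)" "(1/2 - \<eta>) * 2 = 1 - 2 * \<eta>" by simp_all
    have part: "(1/2) *\<^sub>R ((\<nu> \<bullet> ?m z) *\<^sub>R cutoff' t (\<nu> \<bullet> ?w z) *\<^sub>R u \<nu> + cutoff t (\<nu> \<bullet> ?w z) *\<^sub>R v \<nu>)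
      = (((cutoff' t (\<nu> \<bullet> ?w z) * (\<nu> \<bullet> ?m z)) / 2 + cutoff t (\<nu> \<bullet> ?w z) / 4) *\<^sub>R \<nu>,
         (- (cutoff' t (\<nu> \<bullet> ?w z) * (\<nu> \<bullet> ?m z)) / 2 + cutoff t (\<nu> \<bullet> ?w z) / 4) *\<^sub>R \<nu>)" for \<nu>
      by (simp add: u_def v_def scaleR_add_left scaleR_diff_left scaleR_diff_right scaleR_add_right mult.commute)
    show "(- 1/2 - \<eta>) *\<^sub>R (2 *\<^sub>R (fst z - p), 0) + (1/2 - \<eta>) *\<^sub>R (0, 2 *\<^sub>R (snd z - p))
        + (1/2) *\<^sub>R (\<Sum>\<nu>\<in>S. (\<nu> \<bullet> ?m z) *\<^sub>R cutoff' t (\<nu> \<bullet> ?w z) *\<^sub>R u \<nu> + cutoff t (\<nu> \<bullet> ?w z) *\<^sub>R v \<nu>)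
      = (chase_fst S t \<eta> p z, chase_snd S t \<eta> p z)"
      unfolding chase_fst_def chase_snd_def scaleR_sum_right part
      by (intro prod_eqI) (simp_all only: fst_add snd_add fst_scaleR snd_scaleR sum_prod fst_conv
        snd_conv scaleR_zero_right add_0 add_0_right scaleR_scaleR coeff)
  qed
qed

text \<open>On the compact set where \<open>g \<le> 0\<close> the function \<open>f\<close> has a
  positive minimum, which a small multiple of \<open>g\<close> cannot use up; elsewhere
  \<open>g > 0\<close> and \<open>f\<close> is nonnegative. All small \<open>d\<close> are allowed,
  so that several such conditions can share one \<open>d\<close>.\<close>

lemma compact_perturbation:
  fixes f g :: "'a::metric_space \<Rightarrow> real"
  assumes T: "compact T" and f: "continuous_on T f" and g: "continuous_on T g"
    and f0: "\<And>t. t \<in> T \<Longrightarrow> 0 \<le> f t" and g0: "\<And>t. t \<in> T \<Longrightarrow> f t = 0 \<Longrightarrow> 0 < g t"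
  shows "\<exists>d0>0. \<forall>d. 0 < d \<and> d \<le> d0 \<longrightarrow> (\<exists>c>0. \<forall>t\<in>T. c \<le> f t + d * g t)"
proof -
  define T' where "T' = T \<inter> g -` {..0}"
  have T': "compact T'" unfolding T'_def
    using continuous_closed_preimage[OF g compact_imp_closed[OF T], of "{..0}"] T
    by (metis closed_atMost compact_Int_closed inf.right_idem inf_commute inf_left_commute)
  obtain M where M: "M > 0" "\<And>t. t \<in> T \<Longrightarrow> \<bar>g t\<bar> \<le> M"
    using compact_imp_bounded[OF compact_continuous_image[OF g T]] unfolding bounded_pos by auto
  have "\<exists>a>0. \<forall>t\<in>T'. a \<le> f t"
  proof (cases "T' = {}")
    case False
    have "continuous_on T' f" using f by (rule continuous_on_subset) (auto simp: T'_def)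
    from continuous_attains_inf[OF T' False this] obtain t0 where t0: "t0 \<in> T'" "\<forall>t\<in>T'. f t0 \<le> f t"
      by blast
    have "f t0 > 0" using f0[of t0] g0[of t0] t0(1) by (force simp: T'_def)
    with t0 show ?thesis by blast
  qed (auto intro: exI[of _ 1])
  then obtain a where a: "a > 0" "\<And>t. t \<in> T' \<Longrightarrow> a \<le> f t" by blast
  show ?thesis
  proof (rule exI[of _ "a / (2 * M)"], intro conjI allI impI)
    show "0 < a / (2 * M)" using a M by simp
    fix d assume d: "0 < d \<and> d \<le> a / (2 * M)"
    have pos: "0 < f t + d * g t" if t: "t \<in> T" for t
    proof (cases "0 < g t")
      case True
      then show ?thesis using f0[OF t] d by (simp add: add_nonneg_pos)
    next
      case False
      then have "a \<le> f t" using a(2) t by (auto simp: T'_def)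
      moreover have "d * \<bar>g t\<bar> \<le> a / (2 * M) * M"
        using d M(2)[OF t] a M(1) by (intro mult_mono) auto
      then have "d * \<bar>g t\<bar> \<le> a / 2" using M(1) by simp
      moreover have "d * g t \<ge> - (d * \<bar>g t\<bar>)" using False by simp
      ultimately show ?thesis using a(1) by linarith
    qed
    show "\<exists>c>0. \<forall>t\<in>T. c \<le> f t + d * g t"
    proof (cases "T = {}")
      case False
      have "continuous_on T (\<lambda>t. f t + d * g t)" by (intro continuous_intros f g)
      from continuous_attains_inf[OF T False this] show ?thesis using pos by blast
    qed (auto intro: exI[of _ 1])
  qed
qed

text \<open>The sum of the two partial gradients is the derivative under a common translation. The
  arguments of the cutoffs are translation invariant, so the \<open>cutoff'\<close> parts drop out,
  and what remains of the correction is at most \<open>t\<^sup>2\<close> per direction however steep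
  the cutoff is.\<close>

lemma chase_translation:
  fixes t \<eta> R :: real
  assumes "finite S" "\<And>\<nu>. \<nu> \<in> S \<Longrightarrow> norm \<nu> = 1" "t > 0" "0 \<le> \<eta>"
    and "norm (x - p) \<le> R" "norm (y - p) \<le> R"
  shows "(x - y) \<bullet> (chase_fst S t \<eta> p (x, y) + chase_snd S t \<eta> p (x, y))
     \<le> - (norm (x - y))\<^sup>2 + 8 * \<eta> * R\<^sup>2 + card S * t\<^sup>2"
proof -
  let ?w = "x - y" and ?s = "(x - p) + (y - p)"
  have "chase_fst S t \<eta> p (x, y) + chase_snd S t \<eta> p (x, y)
     = - ?w - (2 * \<eta>) *\<^sub>R ?s + (\<Sum>\<nu>\<in>S. (cutoff t (\<nu> \<bullet> ?w) / 2) *\<^sub>R \<nu>)"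
  proof -
    define A where "A \<nu> = (cutoff' t (\<nu> \<bullet> ?w) * (\<nu> \<bullet> ((1/2) *\<^sub>R (x + y) - p))) / 2" for \<nu>
    define B where "B \<nu> = cutoff t (\<nu> \<bullet> ?w) / 4" for \<nu>
    have "(\<Sum>\<nu>\<in>S. (A \<nu> + B \<nu>) *\<^sub>R \<nu>) + (\<Sum>\<nu>\<in>S. (- A \<nu> + B \<nu>) *\<^sub>R \<nu>)
        = (\<Sum>\<nu>\<in>S. (cutoff t (\<nu> \<bullet> ?w) / 2) *\<^sub>R \<nu>)"
      unfolding sum.distrib[symmetric] scaleR_add_left[symmetric] by (simp add: B_def)
    moreover have "- (1 + 2 * \<eta>) *\<^sub>R (x - p) + (1 - 2 * \<eta>) *\<^sub>R (y - p) = - ?w - (2 * \<eta>) *\<^sub>R ?s"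
      by (simp add: algebra_simps)
    moreover have "chase_fst S t \<eta> p (x, y) + chase_snd S t \<eta> p (x, y)
      = (- (1 + 2 * \<eta>) *\<^sub>R (x - p) + (1 - 2 * \<eta>) *\<^sub>R (y - p))
       + ((\<Sum>\<nu>\<in>S. (A \<nu> + B \<nu>) *\<^sub>R \<nu>) + (\<Sum>\<nu>\<in>S. (- A \<nu> + B \<nu>) *\<^sub>R \<nu>))"
      unfolding chase_fst_def chase_snd_def fst_conv snd_conv A_def B_def minus_divide_left
      by (simp only: ac_simps)
    ultimately show ?thesis by simp
  qed
  then have "?w \<bullet> (chase_fst S t \<eta> p (x, y) + chase_snd S t \<eta> p (x, y))
     = - (norm ?w)\<^sup>2 - 2 * \<eta> * (?w \<bullet> ?s) + (\<Sum>\<nu>\<in>S. cutoff t (\<nu> \<bullet> ?w) * (\<nu> \<bullet> ?w) / 2)"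
    by (simp add: inner_add_right inner_diff_right inner_sum_right power2_norm_eq_inner
        inner_commute[of _ "x - y"])
      (simp add: algebra_simps inner_commute)?
  moreover have "\<bar>?w \<bullet> ?s\<bar> \<le> (2 * R) * (2 * R)"
  proof -
    have "norm ?w \<le> 2 * R" using norm_triangle_ineq4[of "x - p" "y - p"] assms(5,6) by simp
    moreover have "norm ?s \<le> 2 * R" using norm_triangle_ineq[of "x - p" "y - p"] assms(5,6) by simp
    ultimately show ?thesis
      by (intro order_trans[OF Cauchy_Schwarz_ineq2] mult_mono)
        (use order_trans[OF norm_ge_zero assms(5)] in auto)
  qed
  then have "(2 * \<eta>) * - (?w \<bullet> ?s) \<le> (2 * \<eta>) * ((2 * R) * (2 * R))"
    using assms(4) by (intro mult_left_mono) linarith+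
  moreover have "(\<Sum>\<nu>\<in>S. cutoff t (\<nu> \<bullet> ?w) * (\<nu> \<bullet> ?w) / 2) \<le> (\<Sum>\<nu>\<in>S. t\<^sup>2)"
  proof (rule sum_mono)
    fix \<nu> show "cutoff t (\<nu> \<bullet> ?w) * (\<nu> \<bullet> ?w) / 2 \<le> t\<^sup>2"
      using cutoff_bounds(2)[OF assms(3), of "\<nu> \<bullet> ?w"] zero_le_power2[of t] by linarith
  qed
  ultimately show ?thesis by (simp add: power2_eq_square algebra_simps)
qed

text \<open>On a pair of points of a common boundary segment with normal \<open>n\<close>, the summands
  \<open>\<nu> = \<plusminus>n\<close> cancel the bad normal derivative of \<open>(|y - p|\<^sup>2 - |x - p|\<^sup>2) / 2\<close>, so that only the
  favourable \<open>\<eta>\<close>-term survives.\<close>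
lemma chase_normal:
  fixes t \<eta> R :: real
  assumes S: "finite S" "\<And>\<nu>. \<nu> \<in> S \<Longrightarrow> norm \<nu> = 1" and n: "n \<in> S" "- n \<in> S"
    and t: "t > 0" "0 < \<sigma>" "0 < e" and R: "norm (x - p) \<le> R" "norm (y - p) \<le> R"
    and sep: "\<And>\<nu>. \<nu> \<in> S \<Longrightarrow> \<nu> \<noteq> n \<Longrightarrow> \<nu> \<noteq> - n \<Longrightarrow> \<sigma> \<le> 1 - (\<nu> \<bullet> n)\<^sup>2"
    and w: "(x - y) \<bullet> n = 0" "e \<le> norm (x - y)"
  shows "2 * \<eta> * ((p - x) \<bullet> n) - card S * (R * t\<^sup>2 / (2 * \<sigma> * e\<^sup>2) + t / 4) \<le> chase_fst S t \<eta> p (x, y) \<bullet> n"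
    and "2 * \<eta> * ((p - y) \<bullet> n) - card S * (R * t\<^sup>2 / (2 * \<sigma> * e\<^sup>2) + t / 4) \<le> chase_snd S t \<eta> p (x, y) \<bullet> n"
proof -
  let ?w = "x - y" and ?m = "(1/2) *\<^sub>R (x + y) - p"
  have n1: "norm n = 1" using S(2)[OF n(1)] .
  then have nn: "n \<bullet> n = 1" by (simp add: norm_eq_1)
  have wn: "n \<bullet> ?w = 0" using w(1) by (simp add: inner_commute)
  have xy: "x \<bullet> n = y \<bullet> n" using w(1) by (simp add: inner_diff_left)
  have mn: "?m \<bullet> n = (x - p) \<bullet> n" "?m \<bullet> n = (y - p) \<bullet> n"
    using xy by (simp_all add: inner_diff_left inner_add_left)
  have ne: "n \<noteq> - n"
  proof
    assume "n = - n"
    then have "n \<bullet> n = - (n \<bullet> n)" by (metis inner_minus_left)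
    with nn show False by simp
  qed
  define A where "A \<nu> = cutoff' t (\<nu> \<bullet> ?w) * (\<nu> \<bullet> ?m) / 2" for \<nu>
  define B where "B \<nu> = cutoff t (\<nu> \<bullet> ?w) / 4" for \<nu>
  define Q where "Q = R * t\<^sup>2 / (2 * \<sigma> * e\<^sup>2) + t / 4"
  have R0: "0 \<le> R" using R(1) norm_ge_zero order_trans by blast
  have Q0: "0 \<le> Q" unfolding Q_def using R0 t by simp
  have m: "norm ?m \<le> R"
  proof -
    have "?m = (1/2) *\<^sub>R ((x - p) + (y - p))"
      by (simp add: vec_eq_iff field_simps)
    then have "norm ?m = norm ((x - p) + (y - p)) / 2" by simp
    then show ?thesis using norm_triangle_ineq[of "x - p" "y - p"] R by linarith
  qed
  \<comment> \<open>A direction not parallel to \<open>n\<close> makes an angle with it whose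
    squared sine is at least \<open>\<sigma>\<close>. Hence \<open>\<nu> \<bullet> w\<close> stays
    away from 0, in the region where the derivative of the cutoff is of order
    \<open>t\<^sup>2\<close>.\<close>
  have AB: "\<bar>A \<nu>\<bar> + \<bar>B \<nu>\<bar> \<le> Q" if \<nu>: "\<nu> \<in> S" "\<nu> \<noteq> n" "\<nu> \<noteq> - n" for \<nu>
  proof -
    have "(\<nu> \<bullet> ?w)\<^sup>2 = (norm ?w)\<^sup>2 * (1 - (\<nu> \<bullet> n)\<^sup>2)"
      using planar_orthogonal[OF w(1) n1 S(2)[OF \<nu>(1)]] .
    moreover have "e\<^sup>2 * \<sigma> \<le> (norm ?w)\<^sup>2 * (1 - (\<nu> \<bullet> n)\<^sup>2)"
      using sep[OF \<nu>] w(2) t by (intro mult_mono power_mono) auto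
    ultimately have ge: "e\<^sup>2 * \<sigma> \<le> (\<nu> \<bullet> ?w)\<^sup>2" by simp
    have pos: "0 < e\<^sup>2 * \<sigma>" using t by simp
    with ge have "\<nu> \<bullet> ?w \<noteq> 0" by auto
    then have "\<bar>cutoff' t (\<nu> \<bullet> ?w)\<bar> \<le> t\<^sup>2 / (\<nu> \<bullet> ?w)\<^sup>2" using cutoff_bounds(3)[OF t(1)] by blast
    also have "\<dots> \<le> t\<^sup>2 / (e\<^sup>2 * \<sigma>)"
      by (rule divide_left_mono[OF ge _ mult_pos_pos[OF less_le_trans[OF pos ge] pos]]) simp
    finally have c': "\<bar>cutoff' t (\<nu> \<bullet> ?w)\<bar> \<le> t\<^sup>2 / (e\<^sup>2 * \<sigma>)" .
    have "\<bar>\<nu> \<bullet> ?m\<bar> \<le> norm \<nu> * norm ?m" by (rule Cauchy_Schwarz_ineq2)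
    also have "\<dots> \<le> R" using S(2)[OF \<nu>(1)] m by simp
    finally have "\<bar>cutoff' t (\<nu> \<bullet> ?w)\<bar> * \<bar>\<nu> \<bullet> ?m\<bar> \<le> t\<^sup>2 / (e\<^sup>2 * \<sigma>) * R"
      using c' pos by (intro mult_mono) auto
    then have "\<bar>A \<nu>\<bar> \<le> R * t\<^sup>2 / (2 * \<sigma> * e\<^sup>2)"
      unfolding A_def by (simp add: abs_mult mult.commute mult.left_commute)
    moreover have "\<bar>B \<nu>\<bar> \<le> t / 4" unfolding B_def using cutoff_bounds(1)[OF t(1), of "\<nu> \<bullet> ?w"] by simp
    ultimately show ?thesis unfolding Q_def by linarith
  qed
  have split: "(\<Sum>\<nu>\<in>S. f \<nu>) = f n + f (- n) + (\<Sum>\<nu>\<in>S - {n, - n}. f \<nu>)" for f :: "pt \<Rightarrow> real"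
    using sum.subset_diff[of "{n, - n}" S f] S(1) n ne by simp
  have rest: "\<bar>\<Sum>\<nu>\<in>S - {n, - n}. f \<nu> * (\<nu> \<bullet> n)\<bar> \<le> card S * Q"
    if f: "\<And>\<nu>. \<bar>f \<nu>\<bar> \<le> \<bar>A \<nu>\<bar> + \<bar>B \<nu>\<bar>" for f
  proof -
    have "\<bar>\<Sum>\<nu>\<in>S - {n, - n}. f \<nu> * (\<nu> \<bullet> n)\<bar> \<le> (\<Sum>\<nu>\<in>S - {n, - n}. Q)"
    proof (rule order_trans[OF sum_abs], rule sum_mono)
      fix \<nu> assume \<nu>: "\<nu> \<in> S - {n, - n}"
      have "\<bar>\<nu> \<bullet> n\<bar> \<le> 1" using Cauchy_Schwarz_ineq2[of \<nu> n] S(2)[of \<nu>] n1 \<nu> by simp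
      moreover have "\<bar>f \<nu>\<bar> \<le> Q" using AB[of \<nu>] f[of \<nu>] \<nu> by fastforce
      ultimately have "\<bar>f \<nu>\<bar> * \<bar>\<nu> \<bullet> n\<bar> \<le> Q * 1" using Q0 by (intro mult_mono) auto
      then show "\<bar>f \<nu> * (\<nu> \<bullet> n)\<bar> \<le> Q" by (simp add: abs_mult)
    qed
    also have "\<dots> = card (S - {n, - n}) * Q" by simp
    also have "\<dots> \<le> card S * Q" using S(1) Q0 by (intro mult_right_mono) (auto intro: card_mono)
    finally show ?thesis .
  qed
  \<comment> \<open>At \<open>n \<bullet> w = 0\<close> the cutoff is 0 and its derivative 1. The
    two directions \<open>n\<close> and \<open>- n\<close> together contribute the height of the
    midpoint over \<open>p\<close>, which is also the height of \<open>x\<close> and of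
    \<open>y\<close>.\<close>
  have an: "A n = (?m \<bullet> n) / 2" "A (- n) = - (?m \<bullet> n) / 2" "B n = 0" "B (- n) = 0"
    unfolding A_def B_def using wn cutoff_bounds(4,5)[OF t(1)]
    by (simp_all add: inner_commute)
  have "chase_fst S t \<eta> p (x, y) \<bullet> n = - (1 + 2 * \<eta>) * ((x - p) \<bullet> n) + (\<Sum>\<nu>\<in>S. (A \<nu> + B \<nu>) * (\<nu> \<bullet> n))"
    unfolding chase_fst_def A_def B_def by (simp add: inner_add_left inner_sum_left)
  also have "\<dots> = - (1 + 2 * \<eta>) * ((x - p) \<bullet> n) + ?m \<bullet> n + (\<Sum>\<nu>\<in>S - {n, - n}. (A \<nu> + B \<nu>) * (\<nu> \<bullet> n))"
    unfolding split an by (simp add: nn)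
  also have "\<dots> = 2 * \<eta> * ((p - x) \<bullet> n) + (\<Sum>\<nu>\<in>S - {n, - n}. (A \<nu> + B \<nu>) * (\<nu> \<bullet> n))"
    unfolding mn(1) by (simp add: inner_diff_left algebra_simps)
  finally show "2 * \<eta> * ((p - x) \<bullet> n) - card S * (R * t\<^sup>2 / (2 * \<sigma> * e\<^sup>2) + t / 4) \<le> chase_fst S t \<eta> p (x, y) \<bullet> n"
    using rest[of "\<lambda>\<nu>. A \<nu> + B \<nu>"] unfolding Q_def[symmetric]
    by (smt (verit))
  have "chase_snd S t \<eta> p (x, y) \<bullet> n = (1 - 2 * \<eta>) * ((y - p) \<bullet> n) + (\<Sum>\<nu>\<in>S. (- A \<nu> + B \<nu>) * (\<nu> \<bullet> n))"
    unfolding chase_snd_def A_def B_def by (simp add: inner_add_left inner_sum_left)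
  also have "\<dots> = (1 - 2 * \<eta>) * ((y - p) \<bullet> n) - ?m \<bullet> n + (\<Sum>\<nu>\<in>S - {n, - n}. (- A \<nu> + B \<nu>) * (\<nu> \<bullet> n))"
    unfolding split an by (simp add: nn)
  also have "\<dots> = 2 * \<eta> * ((p - y) \<bullet> n) + (\<Sum>\<nu>\<in>S - {n, - n}. (- A \<nu> + B \<nu>) * (\<nu> \<bullet> n))"
    unfolding mn(2) by (simp add: inner_diff_left algebra_simps)
  finally show "2 * \<eta> * ((p - y) \<bullet> n) - card S * (R * t\<^sup>2 / (2 * \<sigma> * e\<^sup>2) + t / 4) \<le> chase_snd S t \<eta> p (x, y) \<bullet> n"
    using rest[of "\<lambda>\<nu>. - A \<nu> + B \<nu>"] unfolding Q_def[symmetric]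
    by (smt (verit))
qed

text \<open>The point of a ball around \<open>p\<close> that lies furthest in direction
  \<open>- n\<close> still belongs to the closure and so satisfies the supporting
  inequality.\<close>

lemma normals_gap:
  assumes "open D" "p \<in> D"
  obtains r where "r > 0" "\<And>z n. (z, n) \<in> normals D \<Longrightarrow> r \<le> (p - z) \<bullet> n"
proof -
  obtain r where r: "r > 0" "cball p r \<subseteq> D" using assms open_contains_cball by blast
  show thesis
  proof (rule that[OF r(1)])
    fix z n assume zn: "(z, n) \<in> normals D"
    then have n: "norm n = 1" by (simp add: normals_def)
    have "p - r *\<^sub>R n \<in> cball p r" using r n by (simp add: dist_norm)
    then have "p - r *\<^sub>R n \<in> closure D" using r(2) closure_subset by blast
    with zn have "0 \<le> (p - r *\<^sub>R n - z) \<bullet> n" by (simp add: normals_def)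
    then show "r \<le> (p - z) \<bullet> n" using n by (simp add: inner_diff_left norm_eq_1)
  qed
qed

lemma finite_unit_vectors_gap:
  fixes S :: "pt set"
  assumes "finite S" "\<And>\<nu>. \<nu> \<in> S \<Longrightarrow> norm \<nu> = 1"
  obtains \<sigma> where "\<sigma> > 0"
    "\<And>n \<nu>. n \<in> S \<Longrightarrow> \<nu> \<in> S \<Longrightarrow> \<nu> \<noteq> n \<Longrightarrow> \<nu> \<noteq> - n \<Longrightarrow> \<sigma> \<le> 1 - (\<nu> \<bullet> n)\<^sup>2"
proof -
  let ?P = "{q \<in> S \<times> S. fst q \<noteq> snd q \<and> fst q \<noteq> - snd q}"
  let ?f = "\<lambda>q::pt\<times>pt. 1 - (fst q \<bullet> snd q)\<^sup>2"
  \<comment> \<open>The inserted 1 keeps the minimum meaningful when all vectors of \<open>S\<close>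
    are parallel or \<open>S\<close> is empty.\<close>
  have fin: "finite (insert 1 (?f ` ?P))" using assms(1) by simp
  have pos: "0 < ?f q" if q: "q \<in> ?P" for q
  proof -
    have "norm (fst q) = 1" "norm (snd q) = 1" using assms(2) q by auto
    then have "(norm (fst q - snd q))\<^sup>2 = 2 - 2 * (fst q \<bullet> snd q)"
      "(norm (fst q + snd q))\<^sup>2 = 2 + 2 * (fst q \<bullet> snd q)"
      by (simp_all add: power2_norm_eq_inner algebra_simps inner_commute norm_eq_1)
    moreover have "0 < (norm (fst q - snd q))\<^sup>2" "0 < (norm (fst q + snd q))\<^sup>2"
      using q by (auto simp: add_eq_0_iff2)
    ultimately have "\<bar>fst q \<bullet> snd q\<bar> < 1" by linarith
    then show ?thesis by (simp add: abs_square_less_1)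
  qed
  show thesis
  proof (rule that)
    show "0 < Min (insert 1 (?f ` ?P))" using pos fin by (subst Min_gr_iff) auto
    fix n \<nu> assume "n \<in> S" "\<nu> \<in> S" "\<nu> \<noteq> n" "\<nu> \<noteq> - n"
    then have "(\<nu>, n) \<in> ?P" by auto
    then have "?f (\<nu>, n) \<in> insert 1 (?f ` ?P)" by blast
    from Min_le[OF fin this] show "Min (insert 1 (?f ` ?P)) \<le> 1 - (\<nu> \<bullet> n)\<^sup>2" by simp
  qed
qed

text \<open>The parameter \<open>\<eta>\<close> is fixed first: it costs a quarter of
  \<open>e\<^sup>2\<close> in the translation derivative and yields the normal gain
  \<open>2 * \<eta> * r\<close>. Only then is \<open>t\<close> chosen, so that the corrections cost
  another quarter of \<open>e\<^sup>2\<close> and at most half of that normal gain.\<close>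

lemma chase_parameters:
  assumes D: "open D" "D \<noteq> {}" "convex D" "bounded D" and e: "e > 0"
  obtains S t \<eta> p where "finite S" "t > 0"
    "\<And>x y. x \<in> closure D \<Longrightarrow> y \<in> closure D \<Longrightarrow> e \<le> norm (x - y) \<Longrightarrow>
       (x - y) \<bullet> (chase_fst S t \<eta> p (x, y) + chase_snd S t \<eta> p (x, y)) \<le> - (e\<^sup>2 / 2)"
    "\<And>x y n. (x, n) \<in> normals D \<Longrightarrow> y \<in> closure D \<Longrightarrow> e \<le> norm (x - y) \<Longrightarrow> (x - y) \<bullet> n = 0 \<Longrightarrow>
       0 < chase_fst S t \<eta> p (x, y) \<bullet> n"
    "\<And>x y n. (y, n) \<in> normals D \<Longrightarrow> x \<in> closure D \<Longrightarrow> e \<le> norm (x - y) \<Longrightarrow> (x - y) \<bullet> n = 0 \<Longrightarrow>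
       0 < chase_snd S t \<eta> p (x, y) \<bullet> n"
proof -
  obtain p where p: "p \<in> D" using D by blast
  obtain r where r: "r > 0" "\<And>z n. (z, n) \<in> normals D \<Longrightarrow> r \<le> (p - z) \<bullet> n"
    using normals_gap[OF D(1) p] by blast
  have "bounded ((\<lambda>z. z - p) ` closure D)"
    using D(4) by (intro bounded_translation_minus bounded_closure)
  then obtain R where R: "R > 0" "\<And>z. z \<in> closure D \<Longrightarrow> norm (z - p) \<le> R"
    unfolding bounded_pos by auto
  define N where "N = flat_normals D e"
  \<comment> \<open>Symmetrised, because the cancellation in \<open>chase_normal\<close> needs both
    \<open>n\<close> and \<open>- n\<close>.\<close>
  define S where "S = N \<union> uminus ` N"
  have fin: "finite S" unfolding S_def N_def using finite_flat_normals[OF D(4,3) e] by simp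
  have one: "norm \<nu> = 1" if "\<nu> \<in> S" for \<nu>
    using that unfolding S_def N_def flat_normals_def normals_def by auto
  have sym: "- \<nu> \<in> S" if "\<nu> \<in> S" for \<nu> using that unfolding S_def by auto
  obtain \<sigma> where \<sigma>: "\<sigma> > 0"
    "\<And>n \<nu>. n \<in> S \<Longrightarrow> \<nu> \<in> S \<Longrightarrow> \<nu> \<noteq> n \<Longrightarrow> \<nu> \<noteq> - n \<Longrightarrow> \<sigma> \<le> 1 - (\<nu> \<bullet> n)\<^sup>2"
    using finite_unit_vectors_gap[OF fin one] by blast
  define \<eta> where "\<eta> = e\<^sup>2 / (32 * R\<^sup>2)"
  have \<eta>: "\<eta> > 0" "8 * \<eta> * R\<^sup>2 = e\<^sup>2 / 4" using e R(1) unfolding \<eta>_def by auto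
  define Q where "Q = R / (2 * \<sigma> * e\<^sup>2) + 1 / 4"
  have Q: "Q > 0" unfolding Q_def using R(1) \<sigma>(1) e by (intro add_nonneg_pos) auto
  \<comment> \<open>The added 1 permits division by \<open>k\<close> when the boundary has no long
    segment and \<open>S\<close> is empty.\<close>
  define k where "k = real (card S) + 1"
  have k: "k > 0" unfolding k_def by simp
  define t where "t = min 1 (min (e\<^sup>2 / (4 * k)) (\<eta> * r / (k * Q)))"
  have t: "t > 0" "t \<le> 1" "t \<le> e\<^sup>2 / (4 * k)" "t \<le> \<eta> * r / (k * Q)"
    unfolding t_def using e k \<eta>(1) r(1) Q by auto
  have t2: "t\<^sup>2 \<le> t" using t by (simp add: power2_eq_square mult_left_le)
  have "card S * t\<^sup>2 \<le> k * t" using t2 unfolding k_def by (intro mult_mono) auto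
  also have "\<dots> \<le> e\<^sup>2 / 4" using t(3) k by (simp add: field_simps)
  finally have small1: "card S * t\<^sup>2 \<le> e\<^sup>2 / 4" .
  have "R * t\<^sup>2 / (2 * \<sigma> * e\<^sup>2) + t / 4 \<le> R * t / (2 * \<sigma> * e\<^sup>2) + t / 4"
    using t2 R(1) \<sigma>(1) e by (intro add_right_mono divide_right_mono mult_left_mono) auto
  also have "\<dots> = Q * t" unfolding Q_def by (simp add: algebra_simps add_divide_distrib)
  finally have "card S * (R * t\<^sup>2 / (2 * \<sigma> * e\<^sup>2) + t / 4) \<le> k * (Q * t)"
    using Q t R(1) \<sigma>(1) e unfolding k_def by (intro mult_mono) auto
  also have "\<dots> \<le> \<eta> * r" using t(4) k Q by (simp add: field_simps)
  finally have small2: "card S * (R * t\<^sup>2 / (2 * \<sigma> * e\<^sup>2) + t / 4) \<le> \<eta> * r" .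
  show thesis
  proof (rule that[OF fin t(1)])
    fix x y assume xy: "x \<in> closure D" "y \<in> closure D" "e \<le> norm (x - y)"
    have "e\<^sup>2 \<le> (norm (x - y))\<^sup>2" using xy(3) e by (intro power_mono) auto
    then show "(x - y) \<bullet> (chase_fst S t \<eta> p (x, y) + chase_snd S t \<eta> p (x, y)) \<le> - (e\<^sup>2 / 2)"
      using chase_translation[OF fin one t(1) less_imp_le[OF \<eta>(1)] R(2)[OF xy(1)] R(2)[OF xy(2)]]
        small1 \<eta>(2) by linarith
  next
    fix x y n assume xn: "(x, n) \<in> normals D" and y: "y \<in> closure D"
      and xy: "e \<le> norm (x - y)" "(x - y) \<bullet> n = 0"
    have x: "x \<in> closure D" using xn by (simp add: normals_def)
    have "e \<le> norm (y - x)" "(y - x) \<bullet> n = 0"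
      using xy by (simp_all add: norm_minus_commute inner_diff_left)
    then have "n \<in> N" unfolding N_def flat_normals_def using x xn y by blast
    then have n: "n \<in> S" by (simp add: S_def)
    have "\<eta> * r \<le> \<eta> * ((p - x) \<bullet> n)" using r(2)[OF xn] \<eta> by simp
    moreover have "0 < \<eta> * r" using \<eta> r by simp
    ultimately show "0 < chase_fst S t \<eta> p (x, y) \<bullet> n"
      using chase_normal(1)[OF fin one n sym[OF n] t(1) \<sigma>(1) e R(2)[OF x] R(2)[OF y] \<sigma>(2)[OF n] xy(2,1), of \<eta>]
        small2 by linarith
  next
    fix x y n assume yn: "(y, n) \<in> normals D" and x: "x \<in> closure D"
      and xy: "e \<le> norm (x - y)" "(x - y) \<bullet> n = 0"
    have y: "y \<in> closure D" using yn by (simp add: normals_def)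
    have "n \<in> N" unfolding N_def flat_normals_def using yn y x xy by blast
    then have n: "n \<in> S" by (simp add: S_def)
    have "\<eta> * r \<le> \<eta> * ((p - y) \<bullet> n)" using r(2)[OF yn] \<eta> by simp
    moreover have "0 < \<eta> * r" using \<eta> r by simp
    ultimately show "0 < chase_snd S t \<eta> p (x, y) \<bullet> n"
      using chase_normal(2)[OF fin one n sym[OF n] t(1) \<sigma>(1) e R(2)[OF x] R(2)[OF y] \<sigma>(2)[OF n] xy(2,1), of \<eta>]
        small2 by linarith
  qed
qed

text \<open>The main term has normal derivative \<open>(y - x) \<bullet> n\<close>, which is
  nonnegative and vanishes exactly on the configurations where \<open>chase\<close> has a positive
  one. \<open>compact_perturbation\<close> then gives a uniform positive bound for their
  combination.\<close>

lemma pursuit_potential: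
  assumes D: "open D" "D \<noteq> {}" "convex D" "bounded D" and e: "e > 0"
  obtains W W' c where "c > 0" "taylor2 (closure D \<times> closure D) W W'"
    "\<And>x y. x \<in> closure D \<Longrightarrow> y \<in> closure D \<Longrightarrow> e \<le> norm (x - y) \<Longrightarrow>
       (norm (snd (W' (x, y))))\<^sup>2 + c \<le> (norm (fst (W' (x, y))))\<^sup>2"
    "\<And>x y n. (x, n) \<in> normals D \<Longrightarrow> y \<in> closure D \<Longrightarrow> e \<le> norm (x - y) \<Longrightarrow>
       c \<le> fst (W' (x, y)) \<bullet> n"
    "\<And>x y n. (y, n) \<in> normals D \<Longrightarrow> x \<in> closure D \<Longrightarrow> e \<le> norm (x - y) \<Longrightarrow>
       c \<le> snd (W' (x, y)) \<bullet> n"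
proof -
  let ?K = "closure D \<times> closure D"
  obtain S t \<eta> p where fin: "finite S" and t: "t > 0"
    and tr: "\<And>x y. x \<in> closure D \<Longrightarrow> y \<in> closure D \<Longrightarrow> e \<le> norm (x - y) \<Longrightarrow>
       (x - y) \<bullet> (chase_fst S t \<eta> p (x, y) + chase_snd S t \<eta> p (x, y)) \<le> - (e\<^sup>2 / 2)"
    and n1: "\<And>x y n. (x, n) \<in> normals D \<Longrightarrow> y \<in> closure D \<Longrightarrow> e \<le> norm (x - y) \<Longrightarrow> (x - y) \<bullet> n = 0 \<Longrightarrow>
       0 < chase_fst S t \<eta> p (x, y) \<bullet> n"
    and n2: "\<And>x y n. (y, n) \<in> normals D \<Longrightarrow> x \<in> closure D \<Longrightarrow> e \<le> norm (x - y) \<Longrightarrow> (x - y) \<bullet> n = 0 \<Longrightarrow>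
       0 < chase_snd S t \<eta> p (x, y) \<bullet> n"
    using chase_parameters[OF D e] by blast
  define gx where "gx = chase_fst S t \<eta> p"
  define gy where "gy = chase_snd S t \<eta> p"
  have K: "compact ?K" using D(4) by (simp add: compact_Times)
  have g: "taylor2 ?K (chase S t \<eta> p) (\<lambda>z. (gx z, gy z))"
    unfolding gx_def gy_def by (rule taylor2_chase[OF K t fin])
  then have "continuous_on UNIV (\<lambda>z. (gx z, gy z))" by (simp add: taylor2_def)
  then have gc: "continuous_on UNIV gx" "continuous_on UNIV gy"
    using continuous_on_fst[of UNIV "\<lambda>z. (gx z, gy z)"] continuous_on_snd[of UNIV "\<lambda>z. (gx z, gy z)"]
    by simp_all
  obtain G where G: "G > 0" "\<And>z. z \<in> ?K \<Longrightarrow> norm (gx z, gy z) \<le> G"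
    using taylor2_bounds[OF g K] by metis
  define T where "T = {((x::pt, y::pt), z::pt, n::pt). x \<in> closure D \<and> y \<in> closure D \<and> e \<le> norm (x - y) \<and> (z, n) \<in> normals D}"
  have T: "compact T"
  proof -
    have "T = (?K \<times> normals D) \<inter> {q. e \<le> norm (fst (fst q) - snd (fst q))}"
      unfolding T_def by auto
    moreover have "closed {q::(pt\<times>pt)\<times>(pt\<times>pt). e \<le> norm (fst (fst q) - snd (fst q))}"
      by (intro closed_Collect_le continuous_intros)
    ultimately show ?thesis using K compact_normals[OF D(4)] by (simp add: compact_Int_closed compact_Times)
  qed
  \<comment> \<open>In \<open>T1\<close> the first point is the one carrying the normal, in
    \<open>T2\<close> the second.\<close>
  define T1 where "T1 = T \<inter> {q. fst (fst q) = fst (snd q)}"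
  define T2 where "T2 = T \<inter> {q. snd (fst q) = fst (snd q)}"
  have T12: "compact T1" "compact T2"
    unfolding T1_def T2_def
    by (intro compact_Int_closed T closed_Collect_eq continuous_intros)+
  have "\<exists>d0>0. \<forall>d. 0 < d \<and> d \<le> d0 \<longrightarrow> (\<exists>c>0. \<forall>q\<in>T1. c \<le>
      (snd (fst q) - fst (fst q)) \<bullet> snd (snd q) + d * (gx (fst q) \<bullet> snd (snd q)))"
  proof (rule compact_perturbation[OF T12(1)])
    show "continuous_on T1 (\<lambda>q. gx (fst q) \<bullet> snd (snd q))"
      by (intro continuous_intros continuous_on_compose2[OF gc(1)]) auto
    show "0 \<le> (snd (fst q) - fst (fst q)) \<bullet> snd (snd q)" if "q \<in> T1" for q
      using that unfolding T1_def T_def normals_def by auto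
    show "0 < gx (fst q) \<bullet> snd (snd q)" if "q \<in> T1" "(snd (fst q) - fst (fst q)) \<bullet> snd (snd q) = 0" for q
      using that n1[of "fst (fst q)" "snd (snd q)" "snd (fst q)"]
      unfolding T1_def T_def gx_def by (auto simp: inner_diff_left)
  qed (intro continuous_intros)
  then obtain d1 where d1: "d1 > 0" "\<And>d. 0 < d \<Longrightarrow> d \<le> d1 \<Longrightarrow> \<exists>c>0. \<forall>q\<in>T1. c \<le>
      (snd (fst q) - fst (fst q)) \<bullet> snd (snd q) + d * (gx (fst q) \<bullet> snd (snd q))" by blast
  have "\<exists>d0>0. \<forall>d. 0 < d \<and> d \<le> d0 \<longrightarrow> (\<exists>c>0. \<forall>q\<in>T2. c \<le>
      (fst (fst q) - snd (fst q)) \<bullet> snd (snd q) + d * (gy (fst q) \<bullet> snd (snd q)))"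
  proof (rule compact_perturbation[OF T12(2)])
    show "continuous_on T2 (\<lambda>q. gy (fst q) \<bullet> snd (snd q))"
      by (intro continuous_intros continuous_on_compose2[OF gc(2)]) auto
    show "0 \<le> (fst (fst q) - snd (fst q)) \<bullet> snd (snd q)" if "q \<in> T2" for q
      using that unfolding T2_def T_def normals_def by auto
    show "0 < gy (fst q) \<bullet> snd (snd q)" if "q \<in> T2" "(fst (fst q) - snd (fst q)) \<bullet> snd (snd q) = 0" for q
      using that n2[of "snd (fst q)" "snd (snd q)" "fst (fst q)"]
      unfolding T2_def T_def gy_def by (auto simp: inner_diff_left)
  qed (intro continuous_intros)
  then obtain d2 where d2: "d2 > 0" "\<And>d. 0 < d \<Longrightarrow> d \<le> d2 \<Longrightarrow> \<exists>c>0. \<forall>q\<in>T2. c \<le>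
      (fst (fst q) - snd (fst q)) \<bullet> snd (snd q) + d * (gy (fst q) \<bullet> snd (snd q))" by blast
  \<comment> \<open>The last bound limits the second-order loss
    \<open>d\<^sup>2 |g\<^sub>y|\<^sup>2\<close> to \<open>d * e\<^sup>2 / 2\<close>, half of the
    first-order gain \<open>d * e\<^sup>2\<close> in the difference of the squared
    gradients.\<close>
  define d where "d = min (min d1 d2) (e\<^sup>2 / (2 * G\<^sup>2))"
  have d: "0 < d" "d \<le> d1" "d \<le> d2" "d \<le> e\<^sup>2 / (2 * G\<^sup>2)"
    unfolding d_def using d1(1) d2(1) e G(1) by auto
  have dG: "d * G\<^sup>2 \<le> e\<^sup>2 / 2" using d(4) G(1) by (simp add: field_simps)
  obtain c1 where c1: "c1 > 0" "\<And>q. q \<in> T1 \<Longrightarrow> c1 \<le>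
      (snd (fst q) - fst (fst q)) \<bullet> snd (snd q) + d * (gx (fst q) \<bullet> snd (snd q))"
    using d1(2)[OF d(1,2)] by blast
  obtain c2 where c2: "c2 > 0" "\<And>q. q \<in> T2 \<Longrightarrow> c2 \<le>
      (fst (fst q) - snd (fst q)) \<bullet> snd (snd q) + d * (gy (fst q) \<bullet> snd (snd q))"
    using d2(2)[OF d(1,3)] by blast
  define c where "c = min (min c1 c2) (d * (e\<^sup>2 / 2))"
  have c: "c > 0" "c \<le> c1" "c \<le> c2" "c \<le> d * (e\<^sup>2 / 2)"
    unfolding c_def using c1(1) c2(1) d(1) e by auto
  define W where "W z = (- 1/2) * (norm (fst z - snd z))\<^sup>2 + d * chase S t \<eta> p z" for z
  define W' where "W' z = (- 1/2) *\<^sub>R (2 *\<^sub>R (fst z - snd z), - 2 *\<^sub>R (fst z - snd z)) + d *\<^sub>R (gx z, gy z)" for z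
  have W: "taylor2 ?K W W'"
    unfolding W_def W'_def by (intro taylor2_add taylor2_cmult taylor2_sq_dist g)
  have fW: "fst (W' (x, y)) = (y - x) + d *\<^sub>R gx (x, y)"
    and sW: "snd (W' (x, y)) = (x - y) + d *\<^sub>R gy (x, y)" for x y
    unfolding W'_def by simp_all
  show thesis
  proof (rule that[OF c(1) W])
    fix x y assume xy: "x \<in> closure D" "y \<in> closure D" "e \<le> norm (x - y)"
    have "norm (gy (x, y)) \<le> G"
      using G(2)[of "(x, y)"] norm_snd_le[of "gy (x, y)" "gx (x, y)"] xy by simp
    then have "(norm (gy (x, y)))\<^sup>2 \<le> G\<^sup>2" by (intro power_mono) auto
    then have "d * (d * (norm (gy (x, y)))\<^sup>2) \<le> d * (d * G\<^sup>2)" using d(1) by simp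
    also have "\<dots> \<le> d * (e\<^sup>2 / 2)" using dG d(1) by simp
    finally have *: "d * (d * (norm (gy (x, y)))\<^sup>2) \<le> d * (e\<^sup>2 / 2)" .
    have "d * ((x - y) \<bullet> (gx (x, y) + gy (x, y))) \<le> d * (- (e\<^sup>2 / 2))"
      using tr[OF xy] d(1) unfolding gx_def gy_def by (intro mult_left_mono) auto
    moreover have "(norm (fst (W' (x, y))))\<^sup>2 = (norm (x - y))\<^sup>2 - 2 * (d * ((x - y) \<bullet> gx (x, y))) + d * (d * (norm (gx (x, y)))\<^sup>2)"
      unfolding fW by (simp add: power2_norm_eq_inner algebra_simps inner_commute)
    moreover have "(norm (snd (W' (x, y))))\<^sup>2 = (norm (x - y))\<^sup>2 + 2 * (d * ((x - y) \<bullet> gy (x, y))) + d * (d * (norm (gy (x, y)))\<^sup>2)"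
      unfolding sW by (simp add: power2_norm_eq_inner algebra_simps inner_commute)
    moreover have "0 \<le> d * (d * (norm (gx (x, y)))\<^sup>2)" using d(1) by simp
    ultimately show "(norm (snd (W' (x, y))))\<^sup>2 + c \<le> (norm (fst (W' (x, y))))\<^sup>2"
      using * c(4) by (simp add: inner_add_right distrib_left)
  next
    fix x y n assume a: "(x, n) \<in> normals D" "y \<in> closure D" "e \<le> norm (x - y)"
    then have "((x, y), x, n) \<in> T1" unfolding T1_def T_def normals_def by auto
    from c1(2)[OF this] show "c \<le> fst (W' (x, y)) \<bullet> n"
      using c(2) unfolding fW by (simp add: inner_add_left)
  next
    fix x y n assume a: "(y, n) \<in> normals D" "x \<in> closure D" "e \<le> norm (x - y)"
    then have "((x, y), y, n) \<in> T2" unfolding T2_def T_def normals_def by auto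
    from c2(2)[OF this] show "c \<le> snd (W' (x, y)) \<bullet> n"
      using c(3) unfolding sW by (simp add: inner_add_left)
  qed
qed

section \<open>The deterministic Skorokhod problem\<close>

context
  fixes D :: "pt set" and \<nu> :: "pt \<Rightarrow> pt" and x0 :: pt and b x :: "real \<Rightarrow> pt" and l :: "real \<Rightarrow> real"
  assumes sk: "skorokhod D \<nu> x0 b x l"
begin

lemma skorokhod_monoI: "0 \<le> s \<Longrightarrow> s \<le> t \<Longrightarrow> l s \<le> l t"
  using sk by (auto simp: skorokhod_def monotone_on_def)

lemma skorokhod_local_time_zero: "l 0 = 0"
  using sk by (simp add: skorokhod_def)

lemma skorokhod_emeasure_Icc:
  assumes "a \<le> c"
  shows "emeasure (interval_measure (\<lambda>s. l (max 0 s))) {a..c} = l (max 0 c) - l (max 0 a)"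
proof (rule emeasure_interval_measure_Icc[OF assms])
  have "continuous_on {0..} l" using sk by (simp add: skorokhod_def)
  then show "continuous_on UNIV (\<lambda>s. l (max 0 s))"
    by (rule continuous_on_compose2) (auto intro!: continuous_intros)
qed (auto intro!: skorokhod_monoI)

text \<open>The integral over the closed interval \<open>{0..0}\<close> vanishes because a
  continuous \<open>l\<close> gives the point 0 no mass.\<close>

lemma skorokhod_start: "x 0 = x0 + b 0"
proof -
  let ?L = "interval_measure (\<lambda>s. l (max 0 s))"
  have null: "{0::real} \<in> null_sets ?L"
    using skorokhod_emeasure_Icc[of 0 0] by (simp add: null_sets_def)
  have "(LINT s:{0..0}|?L. \<nu> (x s)) = (LINT s|?L. 0)"
    unfolding set_lebesgue_integral_def
  proof (rule integral_cong_AE)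
    have "set_integrable ?L {0..0} (\<lambda>s. \<nu> (x s))" using sk by (auto simp: skorokhod_def)
    then show "(\<lambda>s. indicat_real {0..0} s *\<^sub>R \<nu> (x s)) \<in> borel_measurable ?L"
      unfolding set_integrable_def by (rule borel_measurable_integrable)
    show "AE s in ?L. indicat_real {0..0} s *\<^sub>R \<nu> (x s) = 0"
      using AE_not_in[OF null] by eventually_elim (auto simp: indicator_def)
  qed simp
  moreover have "x 0 = x0 + b 0 + (LINT s:{0..0}|?L. \<nu> (x s))"
    using sk unfolding skorokhod_def by (metis order_refl)
  ultimately show ?thesis by simp
qed

text \<open>The increment of \<open>x - b\<close> is the integral of \<open>\<nu> (x u)\<close>
  against a measure carried by the boundary times, so a bound on \<open>v \<bullet> \<nu>\<close> at
  those times suffices. Apart from the initial value, all later path estimates see the Stieltjes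
  integral only through this inequality.\<close>

lemma skorokhod_push_le:
  assumes st: "0 \<le> s" "s \<le> t"
    and v: "\<And>u. s < u \<Longrightarrow> u \<le> t \<Longrightarrow> x u \<in> frontier D \<Longrightarrow> v \<bullet> \<nu> (x u) \<le> c"
  shows "v \<bullet> ((x t - b t) - (x s - b s)) \<le> c * (l t - l s)"
proof -
  let ?L = "interval_measure (\<lambda>s. l (max 0 s))"
  define E where "E = {u. 0 \<le> u \<and> x u \<notin> frontier D}"
  have int: "set_integrable ?L {0..u} (\<lambda>s. \<nu> (x s))" if "0 \<le> u" for u
    using sk that by (auto simp: skorokhod_def)
  have eq: "x u = x0 + b u + (LINT s:{0..u}|?L. \<nu> (x s))" if "0 \<le> u" for u
    using sk that by (auto simp: skorokhod_def)
  have cx: "continuous_on {0..} x" using sk by (simp add: skorokhod_def)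
  have "openin (top_of_set {0..}) ({0..} \<inter> x -` (- frontier D))"
    by (rule continuous_openin_preimage_gen[OF cx]) (simp add: open_Compl)
  then obtain T where "open T" "{0..} \<inter> x -` (- frontier D) = {0..} \<inter> T"
    unfolding openin_open by blast
  moreover have "E = {0..} \<inter> x -` (- frontier D)" unfolding E_def by auto
  ultimately have "E \<in> sets ?L" by simp
  then have null: "E \<in> null_sets ?L"
    using sk unfolding skorokhod_def E_def by (auto simp: null_sets_def)
  have i1: "set_integrable ?L {s<..t} (\<lambda>s. \<nu> (x s))"
    by (rule set_integrable_subset[OF int[of t]]) (use st in auto)
  have "(LINT s:{0..t}|?L. \<nu> (x s)) = (LINT s:{0..s} \<union> {s<..t}|?L. \<nu> (x s))"
    using st by (intro arg_cong2[where f="\<lambda>A f. set_lebesgue_integral ?L A f"]) auto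
  also have "\<dots> = (LINT s:{0..s}|?L. \<nu> (x s)) + (LINT s:{s<..t}|?L. \<nu> (x s))"
    by (rule set_integral_Un[OF _ int i1]) (use st in auto)
  finally have "(x t - b t) - (x s - b s) = (LINT s:{s<..t}|?L. \<nu> (x s))"
    using eq[of s] eq[of t] st by (simp add: algebra_simps)
  then have "v \<bullet> ((x t - b t) - (x s - b s)) = (LINT u|?L. v \<bullet> (indicator {s<..t} u *\<^sub>R \<nu> (x u)))"
    unfolding set_lebesgue_integral_def using i1 unfolding set_integrable_def
    by (simp del: inner_scaleR_right)
  also have "\<dots> \<le> (LINT u|?L. c * indicator {s<..t} u)"
  proof (rule integral_mono_AE)
    show "integrable ?L (\<lambda>u. v \<bullet> (indicator {s<..t} u *\<^sub>R \<nu> (x u)))"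
      using i1 unfolding set_integrable_def by (simp del: inner_scaleR_right)
    have "emeasure ?L {s<..t} \<le> emeasure ?L {s..t}" by (intro emeasure_mono) auto
    also have "\<dots> < \<infinity>" using skorokhod_emeasure_Icc[OF st(2)] by simp
    finally show "integrable ?L (\<lambda>u. c * indicator {s<..t} u)"
      by (intro integrable_mult_right integrable_real_indicator) auto
    show "AE u in ?L. v \<bullet> (indicator {s<..t} u *\<^sub>R \<nu> (x u)) \<le> c * indicator {s<..t} u"
      using AE_not_in[OF null]
    proof eventually_elim
      case (elim u)
      then show ?case using v[of u] st by (auto simp: indicator_def E_def)
    qed
  qed
  also have "\<dots> = c * measure ?L {s<..t}" by simp
  also have "measure ?L {s<..t} = l (max 0 t) - l (max 0 s)"
  proof (rule measure_interval_measure_Ioc[OF st(2)])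
    have "continuous_on {0..} l" using sk by (simp add: skorokhod_def)
    then have "continuous_on UNIV (\<lambda>s. l (max 0 s))"
      by (rule continuous_on_compose2) (auto intro!: continuous_intros)
    then show "continuous (at_right a) (\<lambda>s. l (max 0 s))" for a
      by (simp add: continuous_on_eq_continuous_at continuous_at_imp_continuous_at_within)
  qed (auto intro!: skorokhod_monoI)
  finally show ?thesis using st by simp
qed

text \<open>Test \<open>skorokhod_push_le\<close> with the accumulated displacement itself and
  cancel one factor of its norm.\<close>

lemma skorokhod_push_norm:
  assumes "\<And>z. z \<in> frontier D \<Longrightarrow> norm (\<nu> z) = 1" "0 \<le> t"
  shows "norm (x t - x0 - b t) \<le> l t"
proof (cases "x t - x0 - b t = 0")
  case False
  let ?r = "x t - x0 - b t"
  have "?r \<bullet> ((x t - b t) - (x 0 - b 0)) \<le> norm ?r * (l t - l 0)"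
  proof (rule skorokhod_push_le)
    fix u assume "x u \<in> frontier D"
    then show "?r \<bullet> \<nu> (x u) \<le> norm ?r" using norm_cauchy_schwarz[of ?r "\<nu> (x u)"] assms(1) by simp
  qed (use assms in auto)
  then have "norm ?r * norm ?r \<le> norm ?r * l t"
    by (simp add: skorokhod_start skorokhod_local_time_zero power2_eq_square[symmetric] power2_norm_eq_inner algebra_simps)
  then show ?thesis using False by simp
qed (use skorokhod_monoI[of 0 t] skorokhod_local_time_zero assms in auto)

text \<open>This is the chain rule for the square of v + r with r = x - x0 - b, a path of finite
  variation. On a fine partition the increment of the square is exactly
  \<open>(2 *\<^sub>R v + r s + r t) \<bullet> (r t - r s)\<close>, without a second-order
  remainder, and uniform continuity lets \<open>r s\<close> and \<open>r t\<close> be replaced by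
  the value at the boundary time.\<close>

lemma skorokhod_energy:
  assumes one: "\<And>z. z \<in> frontier D \<Longrightarrow> norm (\<nu> z) = 1" and cb: "continuous_on {0..} b" and T: "0 \<le> T"
    and v: "\<And>u. 0 \<le> u \<Longrightarrow> u \<le> T \<Longrightarrow> x u \<in> frontier D \<Longrightarrow> (v + (x u - x0 - b u)) \<bullet> \<nu> (x u) \<le> c"
  shows "(norm (v + (x T - x0 - b T)))\<^sup>2 \<le> (norm v)\<^sup>2 + 2 * c * l T"
proof (cases "T = 0")
  case True
  then show ?thesis by (simp add: skorokhod_start skorokhod_local_time_zero)
next
  case False
  then have T0: "T > 0" using T by simp
  define r where "r u = x u - x0 - b u" for u
  have r0: "r 0 = 0" by (simp add: r_def skorokhod_start)
  have cx: "continuous_on {0..} x" using sk by (simp add: skorokhod_def)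
  have "continuous_on {0..T} r"
    unfolding r_def by (intro continuous_intros continuous_on_subset[OF cx] continuous_on_subset[OF cb]) auto
  then have uc: "uniformly_continuous_on {0..T} r" by (simp add: compact_uniformly_continuous)
  have lT: "0 \<le> l T" using skorokhod_monoI[of 0 T] T skorokhod_local_time_zero by simp
  have bound: "(norm (v + r T))\<^sup>2 \<le> (norm v)\<^sup>2 + (2 * c + 2 * e) * l T" if e: "e > 0" for e
  proof -
    obtain d where d: "d > 0" "\<And>u u'. u \<in> {0..T} \<Longrightarrow> u' \<in> {0..T} \<Longrightarrow> dist u u' < d \<Longrightarrow> dist (r u) (r u') < e"
      using uc e unfolding uniformly_continuous_on_def by (metis dist_commute)
    obtain n :: nat where n: "T / d < real n" using reals_Archimedean2 by blast
    have n0: "real n > 0" using n T0 d(1) by (smt (verit) divide_pos_pos)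
    have nd: "T / n < d" using n n0 d(1) by (simp add: field_simps)
    define q where "q k = T * real k / real n" for k
    have q: "0 \<le> q k" "q (Suc k) = q k + T / n" for k
      unfolding q_def using T n0 by (auto simp: field_simps)
    have qT: "q k \<le> T" if "k \<le> n" for k
      unfolding q_def using that T n0 by (simp add: field_simps mult_left_mono)
    have "(norm (v + r (q k)))\<^sup>2 \<le> (norm v)\<^sup>2 + (2 * c + 2 * e) * l (q k)" if "k \<le> n" for k
      using that
    proof (induction k)
      case 0
      then show ?case by (simp add: q_def r0 skorokhod_local_time_zero)
    next
      case (Suc k)
      let ?s = "q k" and ?t = "q (Suc k)"
      have st: "0 \<le> ?s" "?s \<le> ?t" "?t \<le> T" "?t - ?s < d"
        using q(1)[of k] q(2)[of k] qT[OF Suc.prems] T n0 nd by auto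
      have "(2 *\<^sub>R v + r ?s + r ?t) \<bullet> ((x ?t - b ?t) - (x ?s - b ?s)) \<le> (2 * c + 2 * e) * (l ?t - l ?s)"
      proof (rule skorokhod_push_le[OF st(1,2)])
        fix u assume u: "?s < u" "u \<le> ?t" "x u \<in> frontier D"
        have "dist (r ?s) (r u) < e" "dist (r ?t) (r u) < e"
          by (rule d(2); use u st in \<open>auto simp: dist_real_def\<close>)+
        then have "norm (r ?s - r u) < e" "norm (r ?t - r u) < e" by (simp_all add: dist_norm)
        moreover have "(r ?s - r u) \<bullet> \<nu> (x u) \<le> norm (r ?s - r u)" "(r ?t - r u) \<bullet> \<nu> (x u) \<le> norm (r ?t - r u)"
          using norm_cauchy_schwarz[of _ "\<nu> (x u)"] one[OF u(3)] by (metis mult.right_neutral)+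
        moreover have "(v + r u) \<bullet> \<nu> (x u) \<le> c" unfolding r_def using v u st by auto
        ultimately have "2 * ((v + r u) \<bullet> \<nu> (x u)) + (r ?s - r u) \<bullet> \<nu> (x u) + (r ?t - r u) \<bullet> \<nu> (x u) \<le> 2 * c + 2 * e"
          by linarith
        then show "(2 *\<^sub>R v + r ?s + r ?t) \<bullet> \<nu> (x u) \<le> 2 * c + 2 * e"
          by (simp add: inner_add_left inner_diff_left)
      qed
      moreover have "(x ?t - b ?t) - (x ?s - b ?s) = r ?t - r ?s" by (simp add: r_def)
      moreover have "(norm (v + r ?t))\<^sup>2 - (norm (v + r ?s))\<^sup>2 = (2 *\<^sub>R v + r ?s + r ?t) \<bullet> (r ?t - r ?s)"
        by (simp add: power2_norm_eq_inner algebra_simps inner_commute)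
      ultimately have "(norm (v + r ?t))\<^sup>2 - (norm (v + r ?s))\<^sup>2 \<le> (2 * c + 2 * e) * (l ?t - l ?s)"
        by simp
      with Suc show ?case by (simp only: right_diff_distrib) linarith
    qed
    from this[of n] show ?thesis using n0 by (simp add: q_def)
  qed
  have "(norm (v + r T))\<^sup>2 \<le> (norm v)\<^sup>2 + 2 * c * l T"
  proof (rule field_le_epsilon)
    fix e :: real assume e: "e > 0"
    have "2 * (e / (2 * (l T + 1))) * l T \<le> e" using e lT by (simp add: field_simps)
    moreover have "e / (2 * (l T + 1)) > 0" using e lT by simp
    ultimately show "(norm (v + r T))\<^sup>2 \<le> (norm v)\<^sup>2 + 2 * c * l T + e"
      using bound[of "e / (2 * (l T + 1))"] by (simp add: algebra_simps)
  qed
  then show ?thesis by (simp add: r_def)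
qed

text \<open>Small noise allows only a small displacement, whatever \<open>T\<close> is. The energy
  around the interior point \<open>p\<close> falls by at least \<open>r\<close> per unit of local
  time, hence \<open>l T \<le> R\<^sup>2 / r\<close>. The energy around \<open>x0\<close> can grow
  only through the noise, because by convexity the push never points away from \<open>x0\<close>; so
  it is at most \<open>2 * \<theta> * l T\<close>.\<close>

lemma skorokhod_oscillation:
  assumes \<nu>: "inward_unit_normal D \<nu>" and cb: "continuous_on {0..} b" and T: "0 \<le> T"
    and x0: "x0 \<in> closure D" and gap: "r > 0" "\<And>z. z \<in> frontier D \<Longrightarrow> r \<le> (p - z) \<bullet> \<nu> z"
    and R: "norm (x0 - p) \<le> R"
    and b: "\<And>u. 0 \<le> u \<Longrightarrow> u \<le> T \<Longrightarrow> norm (b u) \<le> \<theta>" "\<theta> \<le> r / 2"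
  shows "norm (x T - x0) \<le> \<theta> + sqrt (2 * \<theta> * (R\<^sup>2 / r))"
proof -
  have one: "norm (\<nu> z) = 1" if "z \<in> frontier D" for z
    using \<nu> that by (simp add: inward_unit_normal_def)
  have inw: "0 \<le> (x0 - z) \<bullet> \<nu> z" if "z \<in> frontier D" for z
    using inward_unit_normal_normals[OF \<nu> that] x0 by (simp add: normals_def)
  have \<theta>0: "0 \<le> \<theta>" using b(1)[of 0] T norm_ge_zero order_trans by blast
  have bn: "\<bar>b u \<bullet> \<nu> z\<bar> \<le> \<theta>" if "0 \<le> u" "u \<le> T" "z \<in> frontier D" for u z
    using Cauchy_Schwarz_ineq2[of "b u" "\<nu> z"] b(1)[OF that(1,2)] one[OF that(3)] by simp
  have "(norm ((x0 - p) + (x T - x0 - b T)))\<^sup>2 \<le> (norm (x0 - p))\<^sup>2 + 2 * (- r / 2) * l T"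
  proof (rule skorokhod_energy[OF one cb T])
    fix u assume u: "0 \<le> u" "u \<le> T" "x u \<in> frontier D"
    have "((x0 - p) + (x u - x0 - b u)) \<bullet> \<nu> (x u) = - ((p - x u) \<bullet> \<nu> (x u)) - b u \<bullet> \<nu> (x u)"
      by (simp add: algebra_simps)
    then show "((x0 - p) + (x u - x0 - b u)) \<bullet> \<nu> (x u) \<le> - r / 2"
      using gap(2)[OF u(3)] bn[OF u] b(2) by linarith
  qed
  then have "0 \<le> (norm (x0 - p))\<^sup>2 - r * l T" using zero_le_power2[of "norm ((x0 - p) + (x T - x0 - b T))"]
    by linarith
  moreover have "(norm (x0 - p))\<^sup>2 \<le> R\<^sup>2" using R by (intro power_mono) auto
  ultimately have "l T \<le> R\<^sup>2 / r" using gap(1) by (simp add: field_simps)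
  then have lT: "2 * \<theta> * l T \<le> 2 * \<theta> * (R\<^sup>2 / r)" using \<theta>0 by (intro mult_left_mono) auto
  have "(norm (0 + (x T - x0 - b T)))\<^sup>2 \<le> (norm (0::pt))\<^sup>2 + 2 * \<theta> * l T"
  proof (rule skorokhod_energy[OF one cb T])
    fix u assume u: "0 \<le> u" "u \<le> T" "x u \<in> frontier D"
    have "(0 + (x u - x0 - b u)) \<bullet> \<nu> (x u) = - ((x0 - x u) \<bullet> \<nu> (x u)) - b u \<bullet> \<nu> (x u)"
      by (simp add: algebra_simps)
    then show "(0 + (x u - x0 - b u)) \<bullet> \<nu> (x u) \<le> \<theta>"
      using inw[OF u(3)] bn[OF u] by linarith
  qed
  with lT have "norm (x T - x0 - b T) \<le> sqrt (2 * \<theta> * (R\<^sup>2 / r))"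
    by (intro real_le_rsqrt) simp
  moreover have "norm (x T - x0) \<le> norm (x T - x0 - b T) + norm (b T)"
    using norm_triangle_ineq[of "x T - x0 - b T" "b T"] by simp
  ultimately show ?thesis using b(1)[of T] T by simp
qed

end

section \<open>Planar Brownian motion\<close>

lemma norm_sq_planar: "(norm v)\<^sup>2 = (v $ 1)\<^sup>2 + (v $ 2)\<^sup>2" for v :: pt
  unfolding power2_norm_eq_inner by (simp add: inner_vec_def sum_2 power2_eq_square)

context
  fixes M :: "'a measure" and B :: "real \<Rightarrow> 'a \<Rightarrow> pt"
  assumes bm: "std_planar_bm M B"
begin

lemma bm_prob_space: "prob_space M"
  using bm by (simp add: std_planar_bm_def)

lemma bm_measurable: "0 \<le> t \<Longrightarrow> B t \<in> borel_measurable M"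
  using bm by (simp add: std_planar_bm_def)

text \<open>The definition of Brownian motion speaks of infinite increasing sequences of times, so a
  single increment has to be embedded in one.\<close>

lemma bm_times:
  assumes "0 \<le> s" "s < t"
  obtains \<tau> :: "nat \<Rightarrow> real" where "strict_mono \<tau>" "0 \<le> \<tau> 0" "\<tau> 0 = s" "\<tau> (Suc 0) = t"
proof -
  define \<tau> where "\<tau> k = (if k = 0 then s else t + real k - 1)" for k :: nat
  show thesis
    by (rule that[of \<tau>]) (use assms in \<open>auto simp: \<tau>_def strict_mono_Suc_iff\<close>)
qed

lemma bm_increment_distributed:
  assumes "0 \<le> s" "s < t"
  shows "distributed M lborel (\<lambda>\<omega>. (B t \<omega> - B s \<omega>) $ i) (normal_density 0 (sqrt (t - s)))"
proof -
  obtain \<tau> :: "nat \<Rightarrow> real" where \<tau>: "strict_mono \<tau>" "0 \<le> \<tau> 0" "\<tau> 0 = s" "\<tau> (Suc 0) = t"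
    using bm_times[OF assms] .
  have "\<forall>k i. distributed M lborel (\<lambda>\<omega>. (B (\<tau> (Suc k)) \<omega> - B (\<tau> k) \<omega>) $ i)
      (\<lambda>x. ennreal (normal_density 0 (sqrt (\<tau> (Suc k) - \<tau> k)) x))"
    using bm \<tau>(1,2) unfolding std_planar_bm_def by blast
  from this[rule_format, of 0 i] show ?thesis unfolding \<tau>(3,4) .
qed

lemma bm_increment_moments:
  assumes st: "0 \<le> s" "s < t"
  shows "has_bochner_integral M (\<lambda>\<omega>. (B t \<omega> - B s \<omega>) $ i) 0"
    and "has_bochner_integral M (\<lambda>\<omega>. ((B t \<omega> - B s \<omega>) $ i)\<^sup>2) (t - s)"
    and "has_bochner_integral M (\<lambda>\<omega>. ((B t \<omega> - B s \<omega>) $ i) ^ 4) (3 * (t - s)\<^sup>2)"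
proof -
  let ?X = "\<lambda>\<omega>. (B t \<omega> - B s \<omega>) $ i" and ?\<sigma> = "sqrt (t - s)"
  have \<sigma>: "0 < ?\<sigma>" "?\<sigma>\<^sup>2 = t - s" using st by auto
  have transfer: "has_bochner_integral M (\<lambda>\<omega>. ?X \<omega> ^ k) c"
    if "has_bochner_integral lborel (\<lambda>x. normal_density 0 ?\<sigma> x * x ^ k) c" for k c
  proof -
    have "integrable lborel (\<lambda>x. normal_density 0 ?\<sigma> x * x ^ k)"
      and eq: "(\<integral>x. normal_density 0 ?\<sigma> x * x ^ k \<partial>lborel) = c"
      using that by (auto simp: has_bochner_integral_iff)
    then have "integrable M (\<lambda>\<omega>. ?X \<omega> ^ k)"
      using distributed_integrable[OF bm_increment_distributed[OF st, of i], of "\<lambda>x. x ^ k"] by simp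
    moreover have "(\<integral>\<omega>. ?X \<omega> ^ k \<partial>M) = c"
      using distributed_integral[OF bm_increment_distributed[OF st, of i], of "\<lambda>x. x ^ k"] eq by simp
    ultimately show ?thesis by (simp add: has_bochner_integral_iff)
  qed
  show "has_bochner_integral M ?X 0"
    using transfer[of 1 0] normal_moment_odd[OF \<sigma>(1), of 0 0] by simp
  have "fact (2 * 1) / ((2 / ?\<sigma>\<^sup>2) ^ 1 * fact 1) = t - s"
    unfolding \<sigma>(2) using st by simp
  from normal_moment_even[OF \<sigma>(1), of 0 1, unfolded this]
  show "has_bochner_integral M (\<lambda>\<omega>. (?X \<omega>)\<^sup>2) (t - s)"
    by (intro transfer) simp
  have "fact 4 / ((2 / ?\<sigma>\<^sup>2)\<^sup>2 * fact 2) = 3 * (t - s)\<^sup>2"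
    unfolding \<sigma>(2) using st by (simp add: fact_numeral power2_eq_square)
  then show "has_bochner_integral M (\<lambda>\<omega>. ?X \<omega> ^ 4) (3 * (t - s)\<^sup>2)"
    using transfer[of 4] normal_moment_even[OF \<sigma>(1), of 0 2] by simp
qed

lemma bm_increment_uncorrelated:
  assumes st: "0 \<le> s" "s < t"
  shows "has_bochner_integral M (\<lambda>\<omega>. (B t \<omega> - B s \<omega>) $ 1 * (B t \<omega> - B s \<omega>) $ 2) 0"
proof -
  interpret prob_space M by (rule bm_prob_space)
  obtain \<tau> :: "nat \<Rightarrow> real" where \<tau>: "strict_mono \<tau>" "0 \<le> \<tau> 0" "\<tau> 0 = s" "\<tau> (Suc 0) = t"
    using bm_times[OF st] .
  let ?X = "\<lambda>(k, i) \<omega>. (B (\<tau> (Suc k)) \<omega> - B (\<tau> k) \<omega>) $ i"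
  let ?I = "{(0::nat, 1::2), (0, 2)}"
  have "indep_vars (\<lambda>_. borel) ?X ({..<1} \<times> UNIV)"
    using bm \<tau>(1,2) unfolding std_planar_bm_def by blast
  then have ind: "indep_vars (\<lambda>_. borel) ?X ?I" by (rule indep_vars_subset) auto
  have int: "integrable M (?X i)" if "i \<in> ?I" for i
    using that bm_increment_moments(1)[OF st] by (auto simp: \<tau> has_bochner_integral_iff)
  have "integrable M (\<lambda>\<omega>. \<Prod>i\<in>?I. ?X i \<omega>)"
    by (rule indep_vars_integrable[OF _ ind int]) auto
  moreover have "(\<integral>\<omega>. (\<Prod>i\<in>?I. ?X i \<omega>) \<partial>M) = (\<Prod>i\<in>?I. \<integral>\<omega>. ?X i \<omega> \<partial>M)"
    by (rule indep_vars_lebesgue_integral[OF _ ind int]) auto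
  moreover have "(\<Prod>i\<in>?I. \<integral>\<omega>. ?X i \<omega> \<partial>M) = 0"
    using bm_increment_moments(1)[OF st] by (simp add: \<tau> has_bochner_integral_iff)
  moreover have "(\<Prod>i\<in>?I. ?X i \<omega>) = (B t \<omega> - B s \<omega>) $ 1 * (B t \<omega> - B s \<omega>) $ 2" for \<omega>
    by (simp add: \<tau>)
  ultimately show ?thesis by (simp add: has_bochner_integral_iff)
qed

lemma bm_increment_inner:
  assumes st: "0 \<le> s" "s < t"
  shows "has_bochner_integral M (\<lambda>\<omega>. a \<bullet> (B t \<omega> - B s \<omega>)) 0"
    and "has_bochner_integral M (\<lambda>\<omega>. (a \<bullet> (B t \<omega> - B s \<omega>))\<^sup>2) ((norm a)\<^sup>2 * (t - s))"
    and "has_bochner_integral M (\<lambda>\<omega>. (norm (B t \<omega> - B s \<omega>))\<^sup>2) (2 * (t - s))"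
proof -
  let ?X = "\<lambda>i \<omega>. (B t \<omega> - B s \<omega>) $ i"
  note m1 = bm_increment_moments(1)[OF st] and m2 = bm_increment_moments(2)[OF st]
  have inner: "a \<bullet> v = a $ 1 * v $ 1 + a $ 2 * v $ 2" for v :: pt
    by (simp add: inner_vec_def sum_2)
  have "has_bochner_integral M (\<lambda>\<omega>. a $ 1 * ?X 1 \<omega> + a $ 2 * ?X 2 \<omega>) (a $ 1 * 0 + a $ 2 * 0)"
    by (intro has_bochner_integral_add has_bochner_integral_mult_right m1)
  then show "has_bochner_integral M (\<lambda>\<omega>. a \<bullet> (B t \<omega> - B s \<omega>)) 0"
    unfolding inner by simp
  have "has_bochner_integral M (\<lambda>\<omega>. (a $ 1)\<^sup>2 * (?X 1 \<omega>)\<^sup>2 + (a $ 2)\<^sup>2 * (?X 2 \<omega>)\<^sup>2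
      + (2 * a $ 1 * a $ 2) * (?X 1 \<omega> * ?X 2 \<omega>))
      ((a $ 1)\<^sup>2 * (t - s) + (a $ 2)\<^sup>2 * (t - s) + (2 * a $ 1 * a $ 2) * 0)"
    by (intro has_bochner_integral_add has_bochner_integral_mult_right m2 bm_increment_uncorrelated[OF st])
  moreover have "(a $ 1)\<^sup>2 * (t - s) + (a $ 2)\<^sup>2 * (t - s) + (2 * a $ 1 * a $ 2) * 0 = (norm a)\<^sup>2 * (t - s)"
    unfolding norm_sq_planar by (simp add: algebra_simps)
  moreover have "(a \<bullet> v)\<^sup>2 = (a $ 1)\<^sup>2 * (v $ 1)\<^sup>2 + (a $ 2)\<^sup>2 * (v $ 2)\<^sup>2
      + (2 * a $ 1 * a $ 2) * (v $ 1 * v $ 2)" for v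
    unfolding inner by (simp add: power2_sum power_mult_distrib)
  ultimately show "has_bochner_integral M (\<lambda>\<omega>. (a \<bullet> (B t \<omega> - B s \<omega>))\<^sup>2) ((norm a)\<^sup>2 * (t - s))"
    by (simp only:)
  have "has_bochner_integral M (\<lambda>\<omega>. (?X 1 \<omega>)\<^sup>2 + (?X 2 \<omega>)\<^sup>2) ((t - s) + (t - s))"
    by (intro has_bochner_integral_add m2)
  then show "has_bochner_integral M (\<lambda>\<omega>. (norm (B t \<omega> - B s \<omega>))\<^sup>2) (2 * (t - s))"
    unfolding norm_sq_planar by simp
qed

lemma bm_increment_fourth_moment:
  assumes st: "0 \<le> s" "s < t"
  shows "integrable M (\<lambda>\<omega>. norm (B t \<omega> - B s \<omega>) ^ 4)"
    and "(\<integral>\<omega>. norm (B t \<omega> - B s \<omega>) ^ 4 \<partial>M) \<le> 12 * (t - s)\<^sup>2"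
proof -
  let ?X = "\<lambda>i \<omega>. (B t \<omega> - B s \<omega>) $ i"
  let ?g = "\<lambda>\<omega>. 2 * (?X 1 \<omega> ^ 4 + ?X 2 \<omega> ^ 4)"
  have g: "has_bochner_integral M ?g (2 * (3 * (t - s)\<^sup>2 + 3 * (t - s)\<^sup>2))"
    by (intro has_bochner_integral_add has_bochner_integral_mult_right bm_increment_moments(3)[OF st])
  have meas: "(\<lambda>\<omega>. norm (B t \<omega> - B s \<omega>) ^ 4) \<in> borel_measurable M"
    using bm_measurable[of t] bm_measurable[of s] st by simp
  have le: "norm (B t \<omega> - B s \<omega>) ^ 4 \<le> ?g \<omega>" for \<omega>
  proof -
    let ?v = "B t \<omega> - B s \<omega>"
    have "norm ?v ^ 4 = ((norm ?v)\<^sup>2)\<^sup>2" by simp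
    also have "\<dots> = ((?v $ 1)\<^sup>2 + (?v $ 2)\<^sup>2)\<^sup>2"
      unfolding norm_sq_planar by simp
    also have "\<dots> \<le> 2 * (((?v $ 1)\<^sup>2)\<^sup>2 + ((?v $ 2)\<^sup>2)\<^sup>2)"
      using sum_squares_bound[of "(?v $ 1)\<^sup>2" "(?v $ 2)\<^sup>2"] by (simp add: power2_sum)
    finally show ?thesis by simp
  qed
  show int: "integrable M (\<lambda>\<omega>. norm (B t \<omega> - B s \<omega>) ^ 4)"
    by (rule Bochner_Integration.integrable_bound[of M ?g]) (use g meas le in \<open>auto simp: has_bochner_integral_iff intro: order_trans[OF _ abs_ge_self]\<close>)
  have "(\<integral>\<omega>. norm (B t \<omega> - B s \<omega>) ^ 4 \<partial>M) \<le> (\<integral>\<omega>. ?g \<omega> \<partial>M)"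
    using int g le by (intro integral_mono) (auto simp: has_bochner_integral_iff)
  then show "(\<integral>\<omega>. norm (B t \<omega> - B s \<omega>) ^ 4 \<partial>M) \<le> 12 * (t - s)\<^sup>2"
    using g by (simp add: has_bochner_integral_iff)
qed

text \<open>The fourth moment yields a quadratic dependence on the time difference. That is
  negligible against the length of a step, and it remains summable over the dyadic levels after
  multiplication by the number of increments.\<close>

lemma bm_increment_tail:
  assumes st: "0 \<le> s" "s < t" and c: "c > 0"
  shows "measure M {\<omega> \<in> space M. c \<le> norm (B t \<omega> - B s \<omega>)} \<le> 12 * (t - s)\<^sup>2 / c ^ 4"
proof -
  have "{\<omega> \<in> space M. c \<le> norm (B t \<omega> - B s \<omega>)} = {\<omega> \<in> space M. c ^ 4 \<le> norm (B t \<omega> - B s \<omega>) ^ 4}"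
    using c by (auto simp: power_mono_iff)
  also have "measure M \<dots> \<le> (\<integral>\<omega>. norm (B t \<omega> - B s \<omega>) ^ 4 \<partial>M) / c ^ 4"
    by (rule integral_Markov_inequality_measure[where A="{}"])
      (use bm_increment_fourth_moment(1)[OF st] c in auto)
  also have "\<dots> \<le> 12 * (t - s)\<^sup>2 / c ^ 4"
    using bm_increment_fourth_moment(2)[OF st] c by (intro divide_right_mono) auto
  finally show ?thesis .
qed

text \<open>Dyadic chaining: the oscillation allowed at level \<open>j\<close> is \<open>(9/10)\<^sup>j \<theta> / 10\<close>, which sums
  to \<open>\<theta>\<close> while \<open>2 (9/10)\<^sup>4 > 1\<close> makes the union bound over the \<open>2\<^sup>j\<close> increments summable.\<close>
lemma bm_sup_tail:
  assumes h: "h > 0" and \<theta>: "\<theta> > 0"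
  obtains H where "H \<in> sets M" "measure M H \<le> 600000 * h\<^sup>2 / \<theta> ^ 4"
    "AE \<omega> in M. \<omega> \<notin> H \<longrightarrow> (\<forall>s. 0 \<le> s \<and> s \<le> h \<longrightarrow> norm (B s \<omega>) \<le> \<theta>)"
proof -
  interpret prob_space M by (rule bm_prob_space)
  define q :: real where "q = 9/10"
  define lev where "lev j = (1 - q) * q ^ j * \<theta>" for j :: nat
  have lev0: "lev j > 0" for j using \<theta> by (simp add: lev_def q_def)
  define d where "d j k = real k * h / 2 ^ j" for j k :: nat
  define H where "H j k = {\<omega> \<in> space M. lev j \<le> norm (B (d j (Suc k)) \<omega> - B (d j k) \<omega>)}" for j k
  define G where "G j = (\<Union>k<2 ^ j. H j k)" for j :: nat
  have d: "0 \<le> d j k" "d j k < d j (Suc k)" "d j (Suc k) - d j k = h / 2 ^ j" for j k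
    using h by (auto simp: d_def field_simps)
  have Hs: "H j k \<in> sets M" for j k
  proof -
    have "B (d j (Suc k)) \<in> borel_measurable M" "B (d j k) \<in> borel_measurable M"
      using bm_measurable d(1) by auto
    then show ?thesis unfolding H_def by measurable
  qed
  then have Gs: "G j \<in> sets M" for j unfolding G_def by auto
  \<comment> \<open>At level \<open>j\<close> the union bound gives 2^j (h / 2^j)^2 / q^(4j) up to
    constants, a geometric sequence with ratio 1 / (2 q^4) < 1.\<close>
  define C where "C = 12 * h\<^sup>2 / ((1 - q) * \<theta>) ^ 4"
  have mG: "measure M (G j) \<le> C * (1 / (2 * q ^ 4)) ^ j" for j
  proof -
    have "measure M (G j) \<le> (\<Sum>k<2 ^ j. measure M (H j k))"
      unfolding G_def using Hs by (intro finite_measure_subadditive_finite) auto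
    also have "\<dots> \<le> (\<Sum>k<(2::nat) ^ j. 12 * (h / 2 ^ j)\<^sup>2 / lev j ^ 4)"
    proof (rule sum_mono)
      fix k show "measure M (H j k) \<le> 12 * (h / 2 ^ j)\<^sup>2 / lev j ^ 4"
        unfolding H_def using bm_increment_tail[OF d(1)[of j k] d(2)[of j k] lev0[of j]] by (simp only: d(3))
    qed
    also have "\<dots> = 2 ^ j * (12 * (h / 2 ^ j)\<^sup>2 / lev j ^ 4)" by simp
    also have "\<dots> = C * (1 / (2 * q ^ 4)) ^ j"
    proof -
      have "lev j ^ 4 = ((1 - q) * \<theta>) ^ 4 * (q ^ 4) ^ j"
        by (simp add: lev_def power_mult_distrib mult.commute flip: power_mult)
      moreover have "(1 / (2 * q ^ 4)) ^ j = 1 / (2 ^ j * (q ^ 4) ^ j)"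
        by (simp add: power_one_over power_mult_distrib)
      ultimately show ?thesis unfolding C_def by (simp add: power2_eq_square)
    qed
    finally show ?thesis .
  qed
  have r: "norm (1 / (2 * q ^ 4)) < 1" by (simp add: q_def field_simps)
  have sC: "summable (\<lambda>j. C * (1 / (2 * q ^ 4)) ^ j)"
    by (intro summable_mult summable_geometric r)
  have sG: "summable (\<lambda>j. measure M (G j))"
    by (rule summable_comparison_test[OF _ sC]) (use mG in auto)
  have "measure M (\<Union>j. G j) \<le> (\<Sum>j. measure M (G j))"
    using Gs sG by (intro finite_measure_subadditive_countably) auto
  also have "\<dots> \<le> (\<Sum>j. C * (1 / (2 * q ^ 4)) ^ j)" by (rule suminf_le[OF mG sG sC])
  also have "\<dots> = C * (1 / (1 - 1 / (2 * q ^ 4)))"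
    using suminf_mult[OF summable_geometric[OF r], of C] suminf_geometric[OF r] by simp
  \<comment> \<open>Here 12 / (1/10)^4 = 120000, and the sum of the geometric series is below
    5.\<close>
  also have "\<dots> \<le> 600000 * h\<^sup>2 / \<theta> ^ 4"
    unfolding C_def q_def using h \<theta> by (simp add: field_simps power2_eq_square)
  finally have m: "measure M (\<Union>j. G j) \<le> 600000 * h\<^sup>2 / \<theta> ^ 4" .
  have AE0: "AE \<omega> in M. B 0 \<omega> = 0 \<and> continuous_on {0..} (\<lambda>t. B t \<omega>)"
    using bm by (simp add: std_planar_bm_def)
  show thesis
  proof (rule that[OF _ m])
    show "(\<Union>j. G j) \<in> sets M" using Gs by auto
    show "AE \<omega> in M. \<omega> \<notin> (\<Union>j. G j) \<longrightarrow> (\<forall>s. 0 \<le> s \<and> s \<le> h \<longrightarrow> norm (B s \<omega>) \<le> \<theta>)"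
      using AE0 AE_space
    proof eventually_elim
      case (elim \<omega>)
      show ?case
      proof (intro impI allI)
        fix s assume nG: "\<omega> \<notin> (\<Union>j. G j)" and s: "0 \<le> s \<and> s \<le> h"
        have inc: "norm (B (d j (Suc k)) \<omega> - B (d j k) \<omega>) \<le> lev j" if "k < 2 ^ j" for j k
          using nG elim(2) that unfolding G_def H_def by fastforce
        \<comment> \<open>The factor \<open>1 - q ^ Suc j\<close> is the sum of the allowances of
          the levels up to \<open>j\<close>: an even point belongs to the previous level and an odd
          one is a single increment away from it.\<close>
        have dy: "norm (B (d j k) \<omega>) \<le> (1 - q ^ Suc j) * \<theta>" if "k \<le> 2 ^ j" for j k
          using that
        proof (induction j arbitrary: k)
          case 0
          then consider "k = 0" | "k = Suc 0" by (cases k) auto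
          then show ?case
          proof cases
            case 1
            then show ?thesis using elim(1) \<theta> by (simp add: d_def q_def)
          next
            case 2
            have "d 0 0 = 0" by (simp add: d_def)
            then show ?thesis using inc[of 0 0] elim(1) 2 by (simp add: lev_def)
          qed
        next
          case (Suc j)
          have half: "d (Suc j) (2 * m) = d j m" for m by (simp add: d_def)
          have step: "(1 - q ^ Suc j) * \<theta> + lev (Suc j) = (1 - q ^ Suc (Suc j)) * \<theta>"
            by (simp add: lev_def algebra_simps)
          consider m where "k = 2 * m" | m where "k = Suc (2 * m)"
            by (metis evenE oddE Suc_eq_plus1)
          then show ?case
          proof cases
            case 1
            have "norm (B (d j m) \<omega>) \<le> (1 - q ^ Suc j) * \<theta>" using Suc 1 by simp
            then show ?thesis using step lev0[of "Suc j"] 1 half[of m] by simp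
          next
            case 2
            have "norm (B (d j m) \<omega>) \<le> (1 - q ^ Suc j) * \<theta>" using Suc 2 by simp
            moreover have "norm (B (d (Suc j) k) \<omega> - B (d j m) \<omega>) \<le> lev (Suc j)"
              using inc[of "2 * m" "Suc j"] Suc.prems 2 half[of m] by simp
            moreover have "norm (B (d (Suc j) k) \<omega>) \<le> norm (B (d j m) \<omega>) + norm (B (d (Suc j) k) \<omega> - B (d j m) \<omega>)"
              by (metis norm_triangle_sub)
            ultimately show ?thesis using step by linarith
          qed
        qed
        have dy': "norm (B (d j k) \<omega>) \<le> \<theta>" if "k \<le> 2 ^ j" for j k
        proof -
          have "(1 - q ^ Suc j) * \<theta> \<le> 1 * \<theta>" using \<theta> by (intro mult_right_mono) (auto simp: q_def)
          then show ?thesis using dy[OF that] by simp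
        qed
        \<comment> \<open>The dyadic point of level \<open>j\<close> just below \<open>s\<close>;
          the bound passes to \<open>s\<close> by continuity of the path.\<close>
        define k where "k j = nat \<lfloor>s * 2 ^ j / h\<rfloor>" for j :: nat
        have rk: "real (k j) = of_int \<lfloor>s * 2 ^ j / h\<rfloor>" for j
          unfolding k_def using s h by (intro of_nat_nat) simp
        have kb: "s * 2 ^ j / h - 1 \<le> real (k j)" "real (k j) \<le> s * 2 ^ j / h" for j
          unfolding rk by linarith+
        have lo: "s - h / 2 ^ j \<le> d j (k j)" "d j (k j) \<le> s" for j
        proof -
          have "s * 2 ^ j \<le> h + h * real (k j)" "h * real (k j) \<le> s * 2 ^ j"
            using kb[of j] h by (simp_all add: field_simps)
          then have "s * 2 ^ j / 2 ^ j \<le> (h + h * real (k j)) / 2 ^ j"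
            "h * real (k j) / 2 ^ j \<le> s * 2 ^ j / 2 ^ j"
            by (intro divide_right_mono; simp)+
          then show "s - h / 2 ^ j \<le> d j (k j)" "d j (k j) \<le> s"
            by (simp_all add: d_def add_divide_distrib mult.commute)
        qed
        have "real (k j) \<le> 2 ^ j" for j
        proof -
          have "s * 2 ^ j / h \<le> 2 ^ j" using s h by (simp add: field_simps)
          then show ?thesis using kb(2)[of j] by linarith
        qed
        then have k2: "k j \<le> 2 ^ j" for j by (metis of_nat_le_iff of_nat_numeral of_nat_power)
        have "(\<lambda>j. s - h * (1 / 2) ^ j) \<longlonglongrightarrow> s - h * 0"
          by (intro tendsto_intros LIMSEQ_power_zero) simp
        then have "(\<lambda>j. s - h / 2 ^ j) \<longlonglongrightarrow> s" by (simp add: power_divide)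
        then have lim: "(\<lambda>j. d j (k j)) \<longlonglongrightarrow> s"
          by (rule tendsto_sandwich[of _ _ _ "\<lambda>_. s", rotated 2]) (use lo in auto)
        have "(\<lambda>j. B (d j (k j)) \<omega>) \<longlonglongrightarrow> B s \<omega>"
          by (rule continuous_on_tendsto_compose[OF _ lim, of "{0..}" "\<lambda>t. B t \<omega>"])
            (use elim(1) s d(1) in auto)
        then have "(\<lambda>j. norm (B (d j (k j)) \<omega>)) \<longlonglongrightarrow> norm (B s \<omega>)" by (rule tendsto_norm)
        then show "norm (B s \<omega>) \<le> \<theta>"
          by (rule LIMSEQ_le_const2) (use dy' k2 in auto)
      qed
    qed
  qed
qed

end

section \<open>One short step of reflected Brownian motion\<close>

text \<open>The share of one process in a lower bound for the relative increment of exp (K W): the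
  first-order term, the signed part of the square left once the cross term is removed, the quadratic
  Taylor error and the price of the cubic terms. As a polynomial in the increment, it has a Brownian
  mean controlled by moments.\<close>

definition step_form :: "pt \<Rightarrow> pt \<Rightarrow> real \<Rightarrow> real \<Rightarrow> real \<Rightarrow> pt \<Rightarrow> real" where
  "step_form p a s k L \<xi> = p \<bullet> \<xi> + s * (a \<bullet> \<xi>)\<^sup>2 - k * (norm \<xi>)\<^sup>2 - L * norm \<xi> ^ 4"

lemma inner_sq_le:
  fixes a \<xi> :: pt
  assumes "norm a \<le> L"
  shows "\<bar>a \<bullet> \<xi>\<bar> \<le> L * norm \<xi>" "(a \<bullet> \<xi>)\<^sup>2 \<le> L\<^sup>2 * (norm \<xi>)\<^sup>2"
proof -
  show 1: "\<bar>a \<bullet> \<xi>\<bar> \<le> L * norm \<xi>"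
    using Cauchy_Schwarz_ineq2[of a \<xi>] assms by (meson mult_right_mono norm_ge_zero order_trans)
  then have "\<bar>a \<bullet> \<xi>\<bar>\<^sup>2 \<le> (L * norm \<xi>)\<^sup>2" by (rule power_mono) simp
  then show "(a \<bullet> \<xi>)\<^sup>2 \<le> L\<^sup>2 * (norm \<xi>)\<^sup>2" by (simp add: power_mult_distrib)
qed

text \<open>As long as the path stays near its start, the first-order gain from the reflection term
  outweighs everything else it contributes.\<close>
lemma step_form_reflection:
  assumes sk: "skorokhod D \<nu> x b X l" and \<nu>: "inward_unit_normal D \<nu>" and h: "0 \<le> h"
    and L: "norm p \<le> L" "norm a \<le> L" "\<bar>s\<bar> \<le> L" "0 \<le> k" "k \<le> L"
    and near: "\<And>u. 0 \<le> u \<Longrightarrow> u \<le> h \<Longrightarrow> norm (X u - x) \<le> d" "norm (b h) \<le> d" "d \<le> 1"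
    and push: "\<And>z. z \<in> frontier D \<Longrightarrow> norm (z - x) \<le> d \<Longrightarrow> c \<le> p \<bullet> \<nu> z"
    and small: "d * (2 * L ^ 3 + 6 * L) \<le> c"
  shows "step_form p a s k L (b h) \<le> step_form p a s k L (X h - x)"
proof -
  define \<rho> where "\<rho> = X h - x - b h"
  let ?\<xi> = "X h - x" and ?b = "b h" and ?l = "l h"
  have one: "norm (\<nu> z) = 1" if "z \<in> frontier D" for z
    using \<nu> that by (simp add: inward_unit_normal_def)
  have L0: "0 \<le> L" using L(4,5) by simp
  have d0: "0 \<le> d" using near(2) norm_ge_zero order_trans by blast
  have \<rho>: "norm \<rho> \<le> ?l" unfolding \<rho>_def by (rule skorokhod_push_norm[OF sk one h])
  then have l0: "0 \<le> ?l" using norm_ge_zero order_trans by blast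
  have nx: "norm ?\<xi> \<le> d" using near(1)[of h] h by simp
  have dl: "0 \<le> d * ?l" using d0 l0 by simp
  \<comment> \<open>The first-order gain: pairing with \<open>p\<close> the push gains at least
    \<open>c\<close> per unit of local time.\<close>
  have "(- p) \<bullet> ((X h - b h) - (X 0 - b 0)) \<le> (- c) * (l h - l 0)"
  proof (rule skorokhod_push_le[OF sk])
    fix u assume "0 < u" "u \<le> h" "X u \<in> frontier D"
    then show "(- p) \<bullet> \<nu> (X u) \<le> - c" using push[of "X u"] near(1)[of u] by simp
  qed (use h in auto)
  then have p\<rho>: "c * ?l \<le> p \<bullet> \<rho>"
    by (simp add: skorokhod_start[OF sk] skorokhod_local_time_zero[OF sk] \<rho>_def inner_diff_right)
  have sum: "norm (?\<xi> + ?b) \<le> 2 * d" using norm_triangle_ineq[of ?\<xi> ?b] nx near(2) by simp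
  have \<xi>: "?\<xi> = ?b + \<rho>" by (simp add: \<rho>_def)
  \<comment> \<open>Each of the other three terms changes by a multiple of \<open>d * l h\<close>,
    since a difference of squares contains the push once and the small sum of both increments once.
    The multiples \<open>2 * L ^ 3\<close>, \<open>2 * L\<close> and \<open>4 * L\<close> add up to
    the constant of \<open>small\<close>.\<close>
  have "s * (a \<bullet> ?\<xi>)\<^sup>2 - s * (a \<bullet> ?b)\<^sup>2 = s * ((a \<bullet> \<rho>) * (a \<bullet> (?\<xi> + ?b)))"
    unfolding \<xi> inner_add_right by algebra
  moreover have "\<bar>s * ((a \<bullet> \<rho>) * (a \<bullet> (?\<xi> + ?b)))\<bar> \<le> L * ((L * ?l) * (L * (2 * d)))"
    unfolding abs_mult
  proof (intro mult_mono)
    show "\<bar>a \<bullet> \<rho>\<bar> \<le> L * ?l"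
      using inner_sq_le(1)[OF L(2), of \<rho>] mult_left_mono[OF \<rho> L0] by linarith
    show "\<bar>a \<bullet> (?\<xi> + ?b)\<bar> \<le> L * (2 * d)"
      using inner_sq_le(1)[OF L(2), of "?\<xi> + ?b"] mult_left_mono[OF sum L0] by linarith
  qed (use L L0 l0 d0 in auto)
  moreover have "L * ((L * ?l) * (L * (2 * d))) = (d * ?l) * (2 * L ^ 3)"
    by (simp add: power3_eq_cube)
  ultimately have A: "s * (a \<bullet> ?b)\<^sup>2 - (d * ?l) * (2 * L ^ 3) \<le> s * (a \<bullet> ?\<xi>)\<^sup>2" by linarith
  have "(norm ?\<xi>)\<^sup>2 - (norm ?b)\<^sup>2 = \<rho> \<bullet> (?\<xi> + ?b)"
    unfolding \<xi> power2_norm_eq_inner inner_add_left inner_add_right inner_commute[of "b h" \<rho>]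
    by simp
  also have "\<dots> \<le> norm \<rho> * norm (?\<xi> + ?b)" by (rule norm_cauchy_schwarz)
  also have "\<dots> \<le> ?l * (2 * d)" using \<rho> sum by (intro mult_mono) (auto intro: l0)
  finally have sq: "(norm ?\<xi>)\<^sup>2 \<le> (norm ?b)\<^sup>2 + 2 * (d * ?l)" by (simp add: mult.commute mult.left_commute)
  then have "k * (norm ?\<xi>)\<^sup>2 \<le> k * ((norm ?b)\<^sup>2 + 2 * (d * ?l))" using L(4) by (rule mult_left_mono)
  moreover have "k * (d * ?l) \<le> L * (d * ?l)" using L(5) dl by (rule mult_right_mono)
  ultimately have K: "k * (norm ?\<xi>)\<^sup>2 \<le> k * (norm ?b)\<^sup>2 + (d * ?l) * (2 * L)"
    by (simp add: algebra_simps)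
  have sq4: "norm v ^ 4 = (norm v)\<^sup>2 * (norm v)\<^sup>2" for v :: pt
    by (simp add: power2_eq_square power4_eq_xxxx)
  have "(norm ?\<xi>)\<^sup>2 * (norm ?\<xi>)\<^sup>2 - (norm ?b)\<^sup>2 * (norm ?b)\<^sup>2 = ((norm ?\<xi>)\<^sup>2 - (norm ?b)\<^sup>2) * ((norm ?\<xi>)\<^sup>2 + (norm ?b)\<^sup>2)"
    by (simp add: algebra_simps)
  also have "\<dots> \<le> (2 * (d * ?l)) * ((norm ?\<xi>)\<^sup>2 + (norm ?b)\<^sup>2)"
    using sq by (intro mult_right_mono) auto
  also have "\<dots> \<le> (2 * (d * ?l)) * 2"
  proof (intro mult_left_mono)
    have "(norm ?\<xi>)\<^sup>2 \<le> 1" "(norm ?b)\<^sup>2 \<le> 1"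
      using nx near(2,3) by (auto intro!: power_le_one)
    then show "(norm ?\<xi>)\<^sup>2 + (norm ?b)\<^sup>2 \<le> 2" by simp
  qed (use dl in auto)
  finally have "L * (norm ?\<xi> ^ 4 - norm ?b ^ 4) \<le> L * (4 * (d * ?l))"
    unfolding sq4 by (intro mult_left_mono L0) simp
  then have Q: "L * norm ?\<xi> ^ 4 \<le> L * norm ?b ^ 4 + (d * ?l) * (4 * L)" by (simp add: algebra_simps)
  have "d * (2 * L ^ 3 + 6 * L) * ?l \<le> c * ?l" using small l0 by (rule mult_right_mono)
  then have "(d * ?l) * (2 * L ^ 3) + (d * ?l) * (2 * L) + (d * ?l) * (4 * L) \<le> p \<bullet> \<rho>"
    using p\<rho> by (simp add: algebra_simps)
  moreover have "p \<bullet> ?\<xi> = p \<bullet> ?b + p \<bullet> \<rho>" unfolding \<xi> by (simp add: inner_add_right)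
  ultimately show ?thesis unfolding step_form_def using A K Q by linarith
qed

text \<open>Crude bounds without any smallness of the increment, for integrability and for the
  exceptional event on which the Brownian path is large.\<close>

lemma step_form_abs_le:
  assumes L: "norm p \<le> L" "norm a \<le> L" "\<bar>s\<bar> \<le> L" "0 \<le> k" "k \<le> L"
  shows "step_form p a s k L \<xi> \<le> (L + L ^ 3) * (1 + norm \<xi> ^ 4)"
    and "- (2 * L + L ^ 3) * (1 + norm \<xi> ^ 4) \<le> step_form p a s k L \<xi>"
proof -
  let ?n = "norm \<xi>"
  have L0: "0 \<le> L" using L(4,5) by simp
  have n2: "?n\<^sup>2 \<le> 1 + ?n ^ 4" "?n \<le> 1 + ?n ^ 4"
  proof -
    have "0 \<le> (?n\<^sup>2 - 1 / 2)\<^sup>2" "0 \<le> (?n - 1 / 2)\<^sup>2" by simp_all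
    then have *: "?n\<^sup>2 \<le> ?n ^ 4 + 1 / 4" "?n \<le> ?n\<^sup>2 + 1 / 4"
      by (simp_all add: power2_eq_square power4_eq_xxxx algebra_simps)
    then show "?n\<^sup>2 \<le> 1 + ?n ^ 4" "?n \<le> 1 + ?n ^ 4" by linarith+
  qed
  have p: "\<bar>p \<bullet> \<xi>\<bar> \<le> L * (1 + ?n ^ 4)"
    using inner_sq_le(1)[OF L(1), of \<xi>] mult_left_mono[OF n2(2) L0] by linarith
  have "\<bar>s * (a \<bullet> \<xi>)\<^sup>2\<bar> \<le> L * (L\<^sup>2 * ?n\<^sup>2)"
    unfolding abs_mult using L(3) inner_sq_le(2)[OF L(2), of \<xi>] L0 by (intro mult_mono) auto
  also have "\<dots> \<le> L * (L\<^sup>2 * (1 + ?n ^ 4))" using n2(1) L0 by (intro mult_left_mono) auto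
  also have "\<dots> = L ^ 3 * (1 + ?n ^ 4)" by (simp add: power2_eq_square power3_eq_cube)
  finally have s: "\<bar>s * (a \<bullet> \<xi>)\<^sup>2\<bar> \<le> L ^ 3 * (1 + ?n ^ 4)" .
  have k: "0 \<le> k * ?n\<^sup>2" "0 \<le> L * ?n ^ 4" using L(4) L0 by auto
  show "step_form p a s k L \<xi> \<le> (L + L ^ 3) * (1 + ?n ^ 4)"
    unfolding step_form_def distrib_right[of L] using p s k by linarith
  have "k * ?n\<^sup>2 \<le> L * ?n\<^sup>2" using L(5) by (intro mult_right_mono) auto
  moreover have "L * (?n + ?n\<^sup>2 + ?n ^ 4) \<le> L * (2 * (1 + ?n ^ 4))"
  proof (rule mult_left_mono[OF _ L0])
    have lin: "u + v + w \<le> 2 * (1 + w)" if "2 * v \<le> w + 1" "2 * u \<le> v + 1" "0 \<le> w" for u v w :: real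
    proof -
      have "v \<le> (w + 1) / 2" "u \<le> (v + 1) / 2" using that by auto
      then show ?thesis using that(3) by argo
    qed
    have "0 \<le> (?n\<^sup>2 - 1)\<^sup>2" "0 \<le> (?n - 1)\<^sup>2" by simp_all
    then have "2 * ?n\<^sup>2 \<le> ?n ^ 4 + 1" "2 * ?n \<le> ?n\<^sup>2 + 1"
      by (simp_all add: power2_eq_square power4_eq_xxxx algebra_simps)
    then show "?n + ?n\<^sup>2 + ?n ^ 4 \<le> 2 * (1 + ?n ^ 4)" by (rule lin) simp
  qed
  moreover have "\<bar>p \<bullet> \<xi>\<bar> \<le> L * ?n" by (rule inner_sq_le(1)[OF L(1)])
  ultimately show "- (2 * L + L ^ 3) * (1 + ?n ^ 4) \<le> step_form p a s k L \<xi>"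
    unfolding step_form_def using s by (simp add: distrib_right distrib_left left_diff_distrib)
qed

lemma step_form_measurable [measurable]: "step_form p a s k L \<in> borel_measurable borel"
  unfolding step_form_def[abs_def]
  by (intro borel_measurable_continuous_onI continuous_intros)

lemma bm_step_form:
  assumes bm: "std_planar_bm M B" and h: "0 < h"
    and L: "norm p \<le> L" "norm a \<le> L" "\<bar>s\<bar> \<le> L" "0 \<le> k" "k \<le> L"
  shows "integrable M (\<lambda>\<omega>. step_form p a s k L (B h \<omega> - B 0 \<omega>))"
    and "(s * (norm a)\<^sup>2 - 2 * k) * h - 12 * L * h\<^sup>2 \<le> (\<integral>\<omega>. step_form p a s k L (B h \<omega> - B 0 \<omega>) \<partial>M)"
proof -
  let ?b = "\<lambda>\<omega>. B h \<omega> - B 0 \<omega>"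
  have h0: "(0::real) \<le> 0" "0 < h" using h by auto
  note m = bm_increment_inner[OF bm h0] and q = bm_increment_fourth_moment[OF bm h0]
  have q': "has_bochner_integral M (\<lambda>\<omega>. norm (?b \<omega>) ^ 4) (\<integral>\<omega>. norm (?b \<omega>) ^ 4 \<partial>M)"
    using q(1) by (simp add: has_bochner_integral_iff)
  have "has_bochner_integral M (\<lambda>\<omega>. step_form p a s k L (?b \<omega>))
     (0 + s * ((norm a)\<^sup>2 * (h - 0)) - k * (2 * (h - 0)) - L * (\<integral>\<omega>. norm (?b \<omega>) ^ 4 \<partial>M))"
    unfolding step_form_def
    by (intro has_bochner_integral_add has_bochner_integral_diff has_bochner_integral_mult_right m q')
  then have i: "integrable M (\<lambda>\<omega>. step_form p a s k L (?b \<omega>))"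
    and e: "(\<integral>\<omega>. step_form p a s k L (?b \<omega>) \<partial>M) = (s * (norm a)\<^sup>2 - 2 * k) * h - L * (\<integral>\<omega>. norm (?b \<omega>) ^ 4 \<partial>M)"
    by (auto simp: has_bochner_integral_iff algebra_simps)
  show "integrable M (\<lambda>\<omega>. step_form p a s k L (?b \<omega>))" by (rule i)
  have "L * (\<integral>\<omega>. norm (?b \<omega>) ^ 4 \<partial>M) \<le> L * (12 * h\<^sup>2)"
    using q(2) L by (intro mult_left_mono) auto
  then show "(s * (norm a)\<^sup>2 - 2 * k) * h - 12 * L * h\<^sup>2 \<le> (\<integral>\<omega>. step_form p a s k L (?b \<omega>) \<partial>M)"
    unfolding e by simp
qed

text \<open>Up to the summand - 1, the bound is the Brownian mean. That summand absorbs all errors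
  of order \<open>h\<^sup>2\<close>: the fourth moment, and the exceptional event, where the
  Brownian form may exceed the reflected one by at most \<open>C2 * (1 + norm b ^ 4)\<close>. The
  length \<open>h0\<close> is independent of the starting point and of the coefficients, so one step
  length serves at all times.\<close>

lemma rbm_step_form:
  fixes D :: "pt set" and \<nu> :: "pt \<Rightarrow> pt" and L c d :: real
  assumes D: "open D" "D \<noteq> {}" "bounded D" and \<nu>: "inward_unit_normal D \<nu>"
    and L: "0 \<le> L" and c: "0 < c" and d: "0 < d"
  obtains h0 :: real where "0 < h0"
    "\<And>(M :: 'a measure) X x h (p :: pt) (a :: pt) (s :: real) (k :: real). rbm M D \<nu> x X \<Longrightarrow> x \<in> closure D \<Longrightarrow> 0 < h \<Longrightarrow> h \<le> h0 \<Longrightarrow>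
       norm p \<le> L \<Longrightarrow> norm a \<le> L \<Longrightarrow> \<bar>s\<bar> \<le> L \<Longrightarrow> 0 \<le> k \<Longrightarrow> k \<le> L \<Longrightarrow>
       (\<And>z. z \<in> frontier D \<Longrightarrow> norm (z - x) \<le> d \<Longrightarrow> c \<le> p \<bullet> \<nu> z) \<Longrightarrow>
       (s * (norm a)\<^sup>2 - 2 * k - 1) * h \<le> (\<integral>\<omega>. step_form p a s k L (X h \<omega> - x) \<partial>M)"
proof -
  obtain o' where o: "o' \<in> D" using D by blast
  obtain r where r: "r > 0" "\<And>z n. (z, n) \<in> normals D \<Longrightarrow> r \<le> (o' - z) \<bullet> n"
    using normals_gap[OF D(1) o] by blast
  have gap: "r \<le> (o' - z) \<bullet> \<nu> z" if "z \<in> frontier D" for z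
    using r(2) inward_unit_normal_normals[OF \<nu> that] by blast
  have "bounded ((\<lambda>z. z - o') ` closure D)"
    using D(3) by (intro bounded_translation_minus bounded_closure)
  then obtain R where R: "R > 0" "\<And>z. z \<in> closure D \<Longrightarrow> norm (z - o') \<le> R"
    unfolding bounded_pos by auto
  \<comment> \<open>Within \<open>d1\<close> the push hypothesis applies, fourth powers are
    dominated by squares, and the error constant of \<open>step_form_reflection\<close> is beaten.
    The added 1 covers \<open>L = 0\<close>.\<close>
  define d1 where "d1 = min d (min 1 (c / (2 * L ^ 3 + 6 * L + 1)))"
  have L3: "0 \<le> L ^ 3" using L by simp
  have d1: "0 < d1" "d1 \<le> d" "d1 \<le> 1" "d1 * (2 * L ^ 3 + 6 * L) \<le> c"
  proof -
    have pos: "0 < 2 * L ^ 3 + 6 * L + 1" using L L3 by linarith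
    show "0 < d1" "d1 \<le> d" "d1 \<le> 1" unfolding d1_def using d c pos by auto
    have "d1 * (2 * L ^ 3 + 6 * L) \<le> c / (2 * L ^ 3 + 6 * L + 1) * (2 * L ^ 3 + 6 * L + 1)"
      using \<open>0 < d1\<close> L L3 c pos by (intro mult_mono) (auto simp: d1_def)
    then show "d1 * (2 * L ^ 3 + 6 * L) \<le> c" using pos by simp
  qed
  \<comment> \<open>Each of the two summands of the oscillation bound becomes at most
    \<open>d1 / 2\<close>.\<close>
  define \<theta> where "\<theta> = min (d1 / 2) (min (r / 2) (d1\<^sup>2 * r / (8 * R\<^sup>2)))"
  have \<theta>: "0 < \<theta>" "\<theta> \<le> d1" "\<theta> \<le> r / 2" unfolding \<theta>_def using d1(1) r(1) R(1) by auto
  have osc: "\<theta> + sqrt (2 * \<theta> * (R\<^sup>2 / r)) \<le> d1"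
  proof -
    have "\<theta> \<le> d1\<^sup>2 * r / (8 * R\<^sup>2)" by (simp add: \<theta>_def)
    then have "2 * \<theta> * (R\<^sup>2 / r) \<le> 2 * (d1\<^sup>2 * r / (8 * R\<^sup>2)) * (R\<^sup>2 / r)"
      using R(1) r(1) by (intro mult_right_mono mult_left_mono) auto
    also have "\<dots> = (d1 / 2)\<^sup>2" using R(1) r(1) by (simp add: field_simps power2_eq_square)
    finally have "sqrt (2 * \<theta> * (R\<^sup>2 / r)) \<le> d1 / 2" using d1(1) by (intro real_le_lsqrt) auto
    moreover have "\<theta> \<le> d1 / 2" by (simp add: \<theta>_def)
    ultimately show ?thesis by linarith
  qed
  define C1 where "C1 = (2 * L + L ^ 3) * (1 + (2 * R) ^ 4)"
  have C1: "0 \<le> C1" unfolding C1_def using L L3 R(1) by (intro mult_nonneg_nonneg) auto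
  define C2 where "C2 = C1 + L + L ^ 3"
  have C2: "0 \<le> C2" unfolding C2_def using C1 L L3 by linarith
  \<comment> \<open>The total coefficient of \<open>h\<^sup>2\<close>; a step of length at most
    \<open>1 / (C3 + 1)\<close> turns \<open>C3 * h\<^sup>2\<close> into at most
    \<open>h\<close>.\<close>
  define C3 where "C3 = 12 * L + C2 * (600000 / \<theta> ^ 4 + 12)"
  have C3: "0 \<le> C3" unfolding C3_def using C2 L \<theta>(1) by (intro add_nonneg_nonneg mult_nonneg_nonneg) auto
  show thesis
  proof (rule that[of "1 / (C3 + 1)"])
    show "0 < 1 / (C3 + 1)" using C3 by simp
    fix M :: "'a measure" and X x h and p a :: pt and s k :: real
    assume X: "rbm M D \<nu> x X" and x: "x \<in> closure D" and h: "0 < h" "h \<le> 1 / (C3 + 1)"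
      and par: "norm p \<le> L" "norm a \<le> L" "\<bar>s\<bar> \<le> L" "0 \<le> k" "k \<le> L"
      and push: "\<And>z. z \<in> frontier D \<Longrightarrow> norm (z - x) \<le> d \<Longrightarrow> c \<le> p \<bullet> \<nu> z"
    interpret prob_space M using X by (simp add: rbm_def)
    obtain B N where bm: "std_planar_bm M B"
      and sk: "AE \<omega> in M. skorokhod D \<nu> x (\<lambda>t. B t \<omega>) (\<lambda>t. X t \<omega>) (\<lambda>t. N t \<omega>)"
      using X unfolding rbm_def by blast
    obtain H where H: "H \<in> sets M" "measure M H \<le> 600000 * h\<^sup>2 / \<theta> ^ 4"
      "AE \<omega> in M. \<omega> \<notin> H \<longrightarrow> (\<forall>u. 0 \<le> u \<and> u \<le> h \<longrightarrow> norm (B u \<omega>) \<le> \<theta>)"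
      using bm_sup_tail[OF bm h(1) \<theta>(1)] by blast
    let ?F = "step_form p a s k L"
    let ?b = "\<lambda>\<omega>. B h \<omega> - B 0 \<omega>"
    have Xm: "X h \<in> borel_measurable M" using X h(1) by (simp add: rbm_def)
    have AE0: "AE \<omega> in M. B 0 \<omega> = 0 \<and> continuous_on {0..} (\<lambda>t. B t \<omega>)"
      using bm by (simp add: std_planar_bm_def)
    have h0: "(0::real) \<le> 0" "0 < h" using h by auto
    have bnd: "AE \<omega> in M. norm (X h \<omega> - x) \<le> 2 * R"
      using sk
    proof eventually_elim
      case (elim \<omega>)
      then have "\<forall>t\<ge>0. X t \<omega> \<in> closure D" unfolding skorokhod_def by blast
      then have "X h \<omega> \<in> closure D" using h by simp
      then show ?case
        using R(2)[of "X h \<omega>"] R(2)[OF x] norm_triangle_ineq4[of "X h \<omega> - o'" "x - o'"] by simp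
    qed
    have low: "- C1 \<le> ?F v" if "norm v \<le> 2 * R" for v
    proof -
      have "norm v ^ 4 \<le> (2 * R) ^ 4" using that by (intro power_mono) auto
      then have "(2 * L + L ^ 3) * (1 + norm v ^ 4) \<le> C1"
        unfolding C1_def using L L3 by (intro mult_left_mono) auto
      then show ?thesis using step_form_abs_le(2)[OF par, of v] by (simp only: mult_minus_left)
    qed
    have up: "?F v \<le> C1" if "norm v \<le> 2 * R" for v
    proof -
      have "norm v ^ 4 \<le> (2 * R) ^ 4" using that by (intro power_mono) auto
      then have "(L + L ^ 3) * (1 + norm v ^ 4) \<le> (2 * L + L ^ 3) * (1 + (2 * R) ^ 4)"
        using L L3 by (intro mult_mono) auto
      then show ?thesis using step_form_abs_le(1)[OF par, of v] unfolding C1_def by linarith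
    qed
    have intX: "integrable M (\<lambda>\<omega>. ?F (X h \<omega> - x))"
    proof (rule integrable_const_bound[where B=C1])
      show "AE \<omega> in M. norm (?F (X h \<omega> - x)) \<le> C1"
        using bnd by eventually_elim (use low up in \<open>auto simp: abs_le_iff intro: minus_le_iff[THEN iffD1]\<close>)
      show "(\<lambda>\<omega>. ?F (X h \<omega> - x)) \<in> borel_measurable M" using Xm by measurable
    qed
    note intB = bm_step_form[OF bm h(1) par]
    note q = bm_increment_fourth_moment[OF bm h0]
    have iH: "integrable M (indicator H :: 'a \<Rightarrow> real)"
      using H(1) by (intro integrable_real_indicator) (auto simp: less_top[symmetric])
    note iHq = Bochner_Integration.integrable_add[OF iH q(1)]
    note intG = Bochner_Integration.integrable_diff[OF intB(1) integrable_mult_right[OF iHq, of C2]]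
    have key: "AE \<omega> in M. ?F (?b \<omega>) - C2 * (indicator H \<omega> + norm (?b \<omega>) ^ 4) \<le> ?F (X h \<omega> - x)"
      using sk bnd H(3) AE0
    proof eventually_elim
      case (elim \<omega>)
      have b4: "0 \<le> norm (?b \<omega>) ^ 4" by simp
      show ?case
      proof (cases "\<omega> \<in> H")
        case True
        have "(L + L ^ 3) * (1 + norm (?b \<omega>) ^ 4) + C1 \<le> (L + L ^ 3) * (1 + norm (?b \<omega>) ^ 4) + C1 * (1 + norm (?b \<omega>) ^ 4)"
          using C1 b4 by (simp add: distrib_left)
        also have "\<dots> = C2 * (1 + norm (?b \<omega>) ^ 4)" unfolding C2_def by (simp add: algebra_simps)
        finally show ?thesis
          using step_form_abs_le(1)[OF par, of "?b \<omega>"] low[OF elim(2)] True by simp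
      next
        case False
        then have bu: "norm (B u \<omega>) \<le> \<theta>" if "0 \<le> u" "u \<le> h" for u using elim(3) that by blast
        have "?F (B h \<omega>) \<le> ?F (X h \<omega> - x)"
        proof (rule step_form_reflection[OF elim(1) \<nu> _ par])
          fix u assume u: "0 \<le> u" "u \<le> h"
          have "norm (X u \<omega> - x) \<le> \<theta> + sqrt (2 * \<theta> * (R\<^sup>2 / r))"
            by (rule skorokhod_oscillation[OF elim(1) \<nu> _ u(1) x r(1) gap R(2)[OF x] _ \<theta>(3)])
              (use elim(4) bu u in auto)
          then show "norm (X u \<omega> - x) \<le> d1" using osc by linarith
        next
          show "norm (B h \<omega>) \<le> d1" using bu[of h] h \<theta>(2) by simp
          show "c \<le> p \<bullet> \<nu> z" if "z \<in> frontier D" "norm (z - x) \<le> d1" for z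
            using push[of z] that d1(2) by simp
        qed (use h d1 in auto)
        moreover have "0 \<le> C2 * norm (?b \<omega>) ^ 4" using C2 b4 by simp
        ultimately show ?thesis using False elim(4) by simp
      qed
    qed
    have "(s * (norm a)\<^sup>2 - 2 * k) * h - C3 * h\<^sup>2
       = ((s * (norm a)\<^sup>2 - 2 * k) * h - 12 * L * h\<^sup>2) - C2 * (600000 * h\<^sup>2 / \<theta> ^ 4 + 12 * (h - 0)\<^sup>2)"
      unfolding C3_def by (simp add: algebra_simps)
    also have "\<dots> \<le> (\<integral>\<omega>. ?F (?b \<omega>) \<partial>M) - C2 * (measure M H + (\<integral>\<omega>. norm (?b \<omega>) ^ 4 \<partial>M))"
      using intB(2) H(2) q(2) C2 by (intro diff_mono mult_left_mono add_mono) auto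
    also have "\<dots> = (\<integral>\<omega>. ?F (?b \<omega>) - C2 * (indicator H \<omega> + norm (?b \<omega>) ^ 4) \<partial>M)"
      unfolding Bochner_Integration.integral_diff[OF intB(1) integrable_mult_right[OF iHq, of C2]]
        integral_mult_right_zero Bochner_Integration.integral_add[OF iH q(1)]
      using H(1) sets.sets_into_space[OF H(1)] by (simp add: Int_absorb2)
    also have "\<dots> \<le> (\<integral>\<omega>. ?F (X h \<omega> - x) \<partial>M)" by (rule integral_mono_AE[OF intG intX key])
    finally have "(s * (norm a)\<^sup>2 - 2 * k) * h - C3 * h\<^sup>2 \<le> (\<integral>\<omega>. ?F (X h \<omega> - x) \<partial>M)" .
    moreover have "C3 * h\<^sup>2 \<le> h"
    proof -
      have "(C3 + 1) * h \<le> 1" using h(2) C3 by (simp add: field_simps)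
      then have "C3 * h \<le> 1" using h(1) by (simp add: distrib_right)
      then have "C3 * h * h \<le> 1 * h" using h(1) by (intro mult_right_mono) auto
      then show ?thesis by (simp add: power2_eq_square)
    qed
    ultimately show "(s * (norm a)\<^sup>2 - 2 * k - 1) * h \<le> (\<integral>\<omega>. ?F (X h \<omega> - x) \<partial>M)"
      by (simp add: left_diff_distrib)
  qed
qed

section \<open>Conditional expectations through a kernel\<close>

text \<open>A finite cover by balls made disjoint. The last clause says that each point of
  \<open>K\<close> lies in exactly one of the first \<open>n\<close> cells, in the form needed to
  evaluate step functions.\<close>

lemma compact_borel_partition:
  fixes K :: "'a::metric_space set"
  assumes "compact K" "0 < e"
  obtains n :: nat and A :: "nat \<Rightarrow> 'a set" and r :: "nat \<Rightarrow> 'a" where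
    "\<And>j. A j \<in> sets borel" "\<And>j. j < n \<Longrightarrow> r j \<in> K" "\<And>j x. x \<in> A j \<Longrightarrow> dist (r j) x < e"
    "\<And>(f :: nat \<Rightarrow> real) x. x \<in> K \<Longrightarrow> \<exists>i<n. x \<in> A i \<and> (\<Sum>j<n. indicator (A j) x * f j) = f i"
proof -
  obtain C where C: "C \<subseteq> K" "finite C" "K \<subseteq> (\<Union>c\<in>C. ball c e)"
    by (rule compactE_image[OF assms(1), of K "\<lambda>c. ball c e"]) (use assms(2) in auto)
  obtain r and n :: nat where "C = r ` {i. i < n}"
    using C(2) finite_conv_nat_seg_image by (metis (mono_tags))
  then have r: "C = r ` {0..<n}" by auto
  define A where "A = disjointed (\<lambda>j. ball (r j) e)"
  show thesis
  proof (rule that[of A n r])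
    show "A j \<in> sets borel" for j unfolding A_def disjointed_def by auto
    show "r j \<in> K" if "j < n" for j using r C(1) that by auto
    show "dist (r j) x < e" if "x \<in> A j" for j x
      using that disjointed_subset[of "\<lambda>j. ball (r j) e" j] unfolding A_def by auto
    fix f :: "nat \<Rightarrow> real" and x assume "x \<in> K"
    then have "x \<in> (\<Union>c\<in>C. ball c e)" using C(3) by blast
    then have "x \<in> (\<Union>i\<in>{0..<n}. ball (r i) e)" unfolding r by simp
    then have "x \<in> (\<Union>i\<in>{0..<n}. A i)" unfolding A_def by (simp only: finite_UN_disjointed_eq)
    then obtain i where i: "i < n" "x \<in> A i" by auto
    have "x \<notin> A j" if "j \<noteq> i" for j
      using disjoint_family_disjointed[of "\<lambda>j. ball (r j) e"] i(2) that
      unfolding A_def disjoint_family_on_def by blast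
    then have "(\<Sum>j<n. indicator (A j) x * f j) = (\<Sum>j<n. if j = i then f i else 0)"
      using i(2) by (intro sum.cong) auto
    then show "\<exists>i<n. x \<in> A i \<and> (\<Sum>j<n. indicator (A j) x * f j) = f i"
      using i by auto
  qed
qed

text \<open>The kernel \<open>Q\<close> is not assumed to be measurable in its first argument: it is only compared with
  conditional probabilities of fixed events, through a fine finite partition of \<open>K'\<close>.\<close>
lemma kernel_integral_nonneg:
  fixes M F :: "'a measure" and Z :: "'a \<Rightarrow> 'z::euclidean_space" and X :: "'a \<Rightarrow> 'b::euclidean_space"
    and \<Psi> :: "'z \<times> 'b \<Rightarrow> real"
  assumes M: "prob_space M" and F: "subalgebra M F"
    and Z: "Z \<in> borel_measurable F" and X: "X \<in> borel_measurable M"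
    and K: "compact K" "compact K'"
    and XK: "AE \<omega> in M. X \<omega> \<in> K'"
    and g: "g \<in> borel_measurable F" "\<And>\<omega>. 0 \<le> g \<omega>" "\<And>\<omega>. g \<omega> \<le> \<Gamma>"
    and gZ: "AE \<omega> in M. g \<omega> \<noteq> 0 \<longrightarrow> Z \<omega> \<in> K"
    and Q: "\<And>z. z \<in> K \<Longrightarrow> prob_space (Q z)" "\<And>z. z \<in> K \<Longrightarrow> sets (Q z) = sets borel"
      "\<And>z. z \<in> K \<Longrightarrow> AE x in Q z. x \<in> K'"
    and cond: "\<And>A. A \<in> sets borel \<Longrightarrow> AE \<omega> in M. Z \<omega> \<in> K \<longrightarrow>
       real_cond_exp M F (\<lambda>\<omega>. indicator A (X \<omega>)) \<omega> = measure (Q (Z \<omega>)) A"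
    and \<Psi>: "continuous_on UNIV \<Psi>"
    and pos: "\<And>z. z \<in> K \<Longrightarrow> 0 \<le> (\<integral>x. \<Psi> (z, x) \<partial>Q z)"
  shows "integrable M (\<lambda>\<omega>. g \<omega> * \<Psi> (Z \<omega>, X \<omega>))"
    and "0 \<le> (\<integral>\<omega>. g \<omega> * \<Psi> (Z \<omega>, X \<omega>) \<partial>M)"
proof -
  interpret prob_space M by (rule M)
  interpret finite_measure_subalgebra M F by unfold_locales (rule F)
  have \<Psi>m [measurable]: "\<Psi> \<in> borel_measurable borel" using \<Psi> by (rule borel_measurable_continuous_onI)
  note [measurable] = X g(1) Z measurable_from_subalg[OF F Z] measurable_from_subalg[OF F g(1)]
  have KK: "compact (K \<times> K')" using K by (rule compact_Times)
  have \<Psi>K: "continuous_on (K \<times> K') \<Psi>" using \<Psi> by (rule continuous_on_subset) simp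
  obtain m where m: "0 < m" "\<And>z x. z \<in> K \<Longrightarrow> x \<in> K' \<Longrightarrow> \<bar>\<Psi> (z, x)\<bar> \<le> m"
    using compact_imp_bounded[OF compact_continuous_image[OF \<Psi>K KK]] unfolding bounded_pos by force
  have \<Gamma>: "0 \<le> \<Gamma>" using g(2,3) order_trans by blast
  have intP: "integrable M (\<lambda>\<omega>. g \<omega> * \<Psi> (Z \<omega>, X \<omega>))"
  proof (rule integrable_const_bound[where B="\<Gamma> * m"])
    show "AE \<omega> in M. norm (g \<omega> * \<Psi> (Z \<omega>, X \<omega>)) \<le> \<Gamma> * m"
      using gZ XK
    proof eventually_elim
      case (elim \<omega>)
      show ?case
      proof (cases "g \<omega> = 0")
        case False
        then have "\<bar>\<Psi> (Z \<omega>, X \<omega>)\<bar> \<le> m" using m(2) elim by blast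
        then show ?thesis unfolding real_norm_def abs_mult using g \<Gamma> by (intro mult_mono) auto
      qed (use \<Gamma> m in simp)
    qed
  qed measurable
  \<comment> \<open>One \<open>\<kappa> * \<Gamma>\<close> is lost when the step function is
    compared with \<open>\<Psi>\<close> under the kernel, the other when it is compared with
    \<open>\<Psi>\<close> under \<open>M\<close>.\<close>
  have approx: "- (2 * \<kappa> * \<Gamma>) \<le> (\<integral>\<omega>. g \<omega> * \<Psi> (Z \<omega>, X \<omega>) \<partial>M)" if \<kappa>: "0 < \<kappa>" for \<kappa>
  proof -
    have "uniformly_continuous_on (K \<times> K') \<Psi>" using \<Psi>K KK by (rule compact_uniformly_continuous)
    then obtain \<delta> where \<delta>: "0 < \<delta>"
      "\<And>p q. p \<in> K \<times> K' \<Longrightarrow> q \<in> K \<times> K' \<Longrightarrow> dist q p < \<delta> \<Longrightarrow> dist (\<Psi> q) (\<Psi> p) < \<kappa>"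
      using \<kappa> unfolding uniformly_continuous_on_def by metis
    obtain A and n :: nat and r where A: "\<And>j. A j \<in> sets borel" "\<And>j. j < n \<Longrightarrow> r j \<in> K'"
      "\<And>j x. x \<in> A j \<Longrightarrow> dist (r j) x < \<delta>"
      "\<And>(f :: nat \<Rightarrow> real) x. x \<in> K' \<Longrightarrow> \<exists>i<n. x \<in> A i \<and> (\<Sum>j<n. indicator (A j) x * f j) = f i"
      by (rule compact_borel_partition[OF K(2) \<delta>(1)]) (rule that)
    note [measurable] = A(1)
    have near: "\<bar>\<Psi> (z, x) - (\<Sum>j<n. indicator (A j) x * \<Psi> (z, r j))\<bar> \<le> \<kappa>" if zx: "z \<in> K" "x \<in> K'" for z x
    proof -
      obtain i where i: "i < n" "x \<in> A i" "(\<Sum>j<n. indicator (A j) x * \<Psi> (z, r j)) = \<Psi> (z, r i)"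
        using A(4)[OF zx(2), of "\<lambda>j. \<Psi> (z, r j)"] by auto
      have "dist (z, r i) (z, x) < \<delta>" using A(3)[OF i(2)] by (simp add: dist_Pair_Pair)
      then have "dist (\<Psi> (z, r i)) (\<Psi> (z, x)) < \<kappa>" using \<delta>(2) zx A(2)[OF i(1)] by blast
      then show ?thesis unfolding i(3) dist_real_def by linarith
    qed
    \<comment> \<open>Replacing the second argument by a representative separates the variables:
      \<open>f j\<close> is measurable for \<open>F\<close>, and \<open>X\<close> enters only
      through the indicator of the fixed event \<open>A j\<close>, to which \<open>cond\<close>
      applies.\<close>
    define f where "f j \<omega> = g \<omega> * \<Psi> (Z \<omega>, r j)" for j \<omega>
    have fF: "f j \<in> borel_measurable F" for j unfolding f_def by measurable
    have fM [measurable]: "f j \<in> borel_measurable M" for j using measurable_from_subalg[OF F fF] .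
    define I where "I j \<omega> = (indicator (A j) (X \<omega>) :: real)" for j \<omega>
    have IM [measurable]: "I j \<in> borel_measurable M" for j unfolding I_def by measurable
    have fI: "integrable M (\<lambda>\<omega>. f j \<omega> * I j \<omega>)" if j: "j < n" for j
    proof (rule integrable_const_bound[where B="\<Gamma> * m"])
      show "AE \<omega> in M. norm (f j \<omega> * I j \<omega>) \<le> \<Gamma> * m"
        using gZ
      proof eventually_elim
        case (elim \<omega>)
        show ?case
        proof (cases "g \<omega> = 0")
          case True
          then show ?thesis using \<Gamma> m(1) by (simp add: f_def)
        next
          case False
          with elim have "\<bar>\<Psi> (Z \<omega>, r j)\<bar> \<le> m" using m(2) A(2)[OF j] by blast
          then have "\<bar>f j \<omega>\<bar> \<le> \<Gamma> * m"
            unfolding f_def abs_mult using g \<Gamma> by (intro mult_mono) auto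
          then show ?thesis using \<Gamma> m(1) by (auto simp: I_def abs_mult indicator_def)
        qed
      qed
    qed measurable
    note ce = real_cond_exp_intg[OF fI fF IM]
    have intT: "integrable M (\<lambda>\<omega>. \<Sum>j<n. f j \<omega> * real_cond_exp M F (I j) \<omega>)"
      by (intro Bochner_Integration.integrable_sum ce(1)) auto
    have intS: "integrable M (\<lambda>\<omega>. \<Sum>j<n. f j \<omega> * I j \<omega>)"
      by (intro Bochner_Integration.integrable_sum fI) auto
    have "AE \<omega> in M. \<forall>j. Z \<omega> \<in> K \<longrightarrow> real_cond_exp M F (I j) \<omega> = measure (Q (Z \<omega>)) (A j)"
      using cond[OF A(1)] unfolding I_def by (subst AE_all_countable) auto
    then have "AE \<omega> in M. - (\<kappa> * \<Gamma>) \<le> (\<Sum>j<n. f j \<omega> * real_cond_exp M F (I j) \<omega>)"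
      using gZ
    proof eventually_elim
      case (elim \<omega>)
      show ?case
      proof (cases "g \<omega> = 0")
        case True
        then show ?thesis using \<kappa> \<Gamma> by (simp add: f_def)
      next
        case False
        then have z: "Z \<omega> \<in> K" using elim by blast
        let ?z = "Z \<omega>" and ?Q = "Q (Z \<omega>)"
        interpret Q: prob_space ?Q by (rule Q(1)[OF z])
        note [measurable_cong] = Q(2)[OF z]
        have i1: "integrable ?Q (\<lambda>x. \<Sum>j<n. indicator (A j) x * \<Psi> (?z, r j))"
          using A(1) Q(2)[OF z]
          by (intro Bochner_Integration.integrable_sum integrable_mult_left integrable_real_indicator)
            (auto simp: less_top[symmetric])
        have i2: "integrable ?Q (\<lambda>x. \<Psi> (?z, x))"
        proof (rule Q.integrable_const_bound[where B=m])
          show "AE x in ?Q. norm (\<Psi> (?z, x)) \<le> m"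
            using Q(3)[OF z] by eventually_elim (use m(2) z in auto)
        qed measurable
        have "- \<kappa> \<le> (\<integral>x. \<Psi> (?z, x) \<partial>?Q) - \<kappa>" using pos[OF z] by simp
        also have "\<dots> = (\<integral>x. \<Psi> (?z, x) - \<kappa> \<partial>?Q)"
          using i2 by (simp add: Q.prob_space)
        also have "\<dots> \<le> (\<integral>x. (\<Sum>j<n. indicator (A j) x * \<Psi> (?z, r j)) \<partial>?Q)"
        proof (rule integral_mono_AE)
          show "AE x in ?Q. \<Psi> (?z, x) - \<kappa> \<le> (\<Sum>j<n. indicator (A j) x * \<Psi> (?z, r j))"
            using Q(3)[OF z]
          proof eventually_elim
            case (elim x)
            show ?case using near[OF z elim] by linarith
          qed
        qed (use i1 i2 in auto)
        also have "\<dots> = (\<Sum>j<n. measure ?Q (A j) * \<Psi> (?z, r j))"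
          using A(1) Q(2)[OF z] sets.sets_into_space[of _ ?Q]
          by (subst Bochner_Integration.integral_sum)
            (auto intro!: integrable_mult_left integrable_real_indicator sum.cong
              simp: less_top[symmetric] Int_absorb2)
        finally have "g \<omega> * - \<kappa> \<le> g \<omega> * (\<Sum>j<n. measure ?Q (A j) * \<Psi> (?z, r j))"
          using g(2) by (rule mult_left_mono)
        also have "\<dots> = (\<Sum>j<n. f j \<omega> * real_cond_exp M F (I j) \<omega>)"
          unfolding sum_distrib_left f_def using elim z by (intro sum.cong) auto
        finally have "- (\<kappa> * g \<omega>) \<le> (\<Sum>j<n. f j \<omega> * real_cond_exp M F (I j) \<omega>)"
          by (simp add: mult.commute)
        moreover have "\<kappa> * g \<omega> \<le> \<kappa> * \<Gamma>" using g(3) \<kappa> by simp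
        ultimately show ?thesis by linarith
      qed
    qed
    then have "(\<integral>\<omega>. - (\<kappa> * \<Gamma>) \<partial>M) \<le> (\<integral>\<omega>. (\<Sum>j<n. f j \<omega> * real_cond_exp M F (I j) \<omega>) \<partial>M)"
      by (intro integral_mono_AE intT) auto
    also have "\<dots> = (\<Sum>j<n. \<integral>\<omega>. f j \<omega> * real_cond_exp M F (I j) \<omega> \<partial>M)"
      by (rule Bochner_Integration.integral_sum) (use ce(1) in auto)
    also have "\<dots> = (\<Sum>j<n. \<integral>\<omega>. f j \<omega> * I j \<omega> \<partial>M)"
      by (rule sum.cong) (use ce(2) in auto)
    also have "\<dots> = (\<integral>\<omega>. (\<Sum>j<n. f j \<omega> * I j \<omega>) \<partial>M)"
      by (rule Bochner_Integration.integral_sum[symmetric]) (use fI in auto)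
    finally have S: "- (\<kappa> * \<Gamma>) \<le> (\<integral>\<omega>. (\<Sum>j<n. f j \<omega> * I j \<omega>) \<partial>M)" by (simp add: prob_space)
    have "(\<integral>\<omega>. (\<Sum>j<n. f j \<omega> * I j \<omega>) \<partial>M) \<le> (\<integral>\<omega>. g \<omega> * \<Psi> (Z \<omega>, X \<omega>) + \<kappa> * \<Gamma> \<partial>M)"
    proof (rule integral_mono_AE[OF intS])
      show "AE \<omega> in M. (\<Sum>j<n. f j \<omega> * I j \<omega>) \<le> g \<omega> * \<Psi> (Z \<omega>, X \<omega>) + \<kappa> * \<Gamma>"
        using gZ XK
      proof eventually_elim
        case (elim \<omega>)
        have eq: "(\<Sum>j<n. f j \<omega> * I j \<omega>) = g \<omega> * (\<Sum>j<n. indicator (A j) (X \<omega>) * \<Psi> (Z \<omega>, r j))"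
          unfolding sum_distrib_left f_def I_def by (intro sum.cong) auto
        show ?case
        proof (cases "g \<omega> = 0")
          case False
          then have "(\<Sum>j<n. indicator (A j) (X \<omega>) * \<Psi> (Z \<omega>, r j)) \<le> \<Psi> (Z \<omega>, X \<omega>) + \<kappa>"
            using near[of "Z \<omega>" "X \<omega>"] elim by linarith
          then have "(\<Sum>j<n. f j \<omega> * I j \<omega>) \<le> g \<omega> * (\<Psi> (Z \<omega>, X \<omega>) + \<kappa>)"
            unfolding eq using g(2) by (rule mult_left_mono)
          moreover have "g \<omega> * \<kappa> \<le> \<kappa> * \<Gamma>" using g(3) \<kappa> by (simp add: mult.commute)
          ultimately show ?thesis unfolding distrib_left by linarith
        qed (use \<kappa> \<Gamma> eq in simp)
      qed
    qed (use intP in auto)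
    also have "\<dots> = (\<integral>\<omega>. g \<omega> * \<Psi> (Z \<omega>, X \<omega>) \<partial>M) + \<kappa> * \<Gamma>"
      using intP by (simp add: prob_space)
    finally show ?thesis using S by linarith
  qed
  have "0 \<le> (\<integral>\<omega>. g \<omega> * \<Psi> (Z \<omega>, X \<omega>) \<partial>M) + e" if e: "0 < e" for e
  proof -
    have "0 < e / (2 * (\<Gamma> + 1))" using e \<Gamma> by simp
    moreover have "2 * (e / (2 * (\<Gamma> + 1))) * \<Gamma> \<le> e" using e \<Gamma> by (simp add: field_simps)
    ultimately show ?thesis using approx[of "e / (2 * (\<Gamma> + 1))"] by linarith
  qed
  then show "0 \<le> (\<integral>\<omega>. g \<omega> * \<Psi> (Z \<omega>, X \<omega>) \<partial>M)" using field_le_epsilon by blast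
  show "integrable M (\<lambda>\<omega>. g \<omega> * \<Psi> (Z \<omega>, X \<omega>))" by (rule intP)
qed

section \<open>Two coupled processes\<close>

text \<open>The remainder of even order four is nonnegative for both signs of \<open>t\<close>.
  Stopping after the square would give no lower bound for negative \<open>t\<close>.\<close>

lemma exp_ge_cubic: "1 + t + t\<^sup>2 / 2 + t ^ 3 / 6 \<le> exp (t :: real)"
proof -
  obtain u where "exp t = (\<Sum>m<4. t ^ m / fact m) + exp u / fact 4 * t ^ 4"
    using Maclaurin_exp_le[of t 4] by blast
  moreover have "0 \<le> exp u / fact 4 * t ^ 4" by simp
  moreover have "(\<Sum>m<4. t ^ m / fact m) = 1 + t + t\<^sup>2 / 2 + t ^ 3 / 6"
    by (simp add: lessThan_nat_numeral fact_numeral lessThan_Suc numeral_eq_Suc fact_Suc)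
  ultimately show ?thesis by linarith
qed

text \<open>The difference of the two sides is
  \<open>((1 - \<mu>) * \<alpha> + \<beta>)\<^sup>2 / (1 - \<mu>)\<close>.\<close>

lemma sq_sum_ge:
  fixes \<alpha> \<beta> \<mu> :: real
  assumes "0 < \<mu>" "\<mu> < 1"
  shows "\<mu> * \<alpha>\<^sup>2 - \<mu> / (1 - \<mu>) * \<beta>\<^sup>2 \<le> (\<alpha> + \<beta>)\<^sup>2"
proof -
  have "0 \<le> ((1 - \<mu>) * \<alpha> + \<beta>)\<^sup>2 / (1 - \<mu>)" using assms by simp
  also have "\<dots> = (1 - \<mu>) * \<alpha>\<^sup>2 + 2 * (\<alpha> * \<beta>) + \<beta>\<^sup>2 / (1 - \<mu>)"
    using assms by (simp add: power2_eq_square field_simps)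
  also have "\<beta>\<^sup>2 / (1 - \<mu>) = \<beta>\<^sup>2 + \<mu> / (1 - \<mu>) * \<beta>\<^sup>2"
    using assms by (simp add: field_simps)
  finally show ?thesis by (simp add: power2_sum algebra_simps)
qed

text \<open>A lower bound for the increment of the exponential that is a sum of a function of the
  first displacement and a function of the second. Replacing the increment of \<open>W\<close> by
  its linear part costs \<open>K * C * n\<^sup>2\<close> in first order; the errors of the square
  and the cube amount to \<open>G * n ^ 3\<close>.\<close>

lemma exp_taylor2_step:
  fixes W :: "pt \<times> pt \<Rightarrow> real" and z z' :: "pt \<times> pt"
  assumes C: "norm (W' z) \<le> C" "\<bar>W z' - W z\<bar> \<le> C * norm (z' - z)"
      "\<bar>W z' - W z - W' z \<bullet> (z' - z)\<bar> \<le> C * (norm (z' - z))\<^sup>2"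
    and K: "0 \<le> K" and \<mu>: "0 < \<mu>" "\<mu> < 1"
    and L: "(K\<^sup>2 * C\<^sup>2 + K ^ 3 * C ^ 3)\<^sup>2 \<le> L"
  shows "step_form (K *\<^sub>R fst (W' z)) (fst (W' z)) (K\<^sup>2 / 2 * \<mu>) (K * C + 1) L (fst z' - fst z)
      + step_form (K *\<^sub>R snd (W' z)) (snd (W' z)) (- (K\<^sup>2 / 2 * (\<mu> / (1 - \<mu>)))) (K * C + 1) L (snd z' - snd z)
    \<le> exp (K * (W z' - W z)) - 1"
proof -
  let ?a = "fst (W' z)" and ?b = "snd (W' z)" and ?\<xi> = "fst z' - fst z" and ?\<zeta> = "snd z' - snd z"
  define n where "n = norm (z' - z)"
  define v where "v = ?a \<bullet> ?\<xi> + ?b \<bullet> ?\<zeta>"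
  define T where "T = W z' - W z"
  define G where "G = K\<^sup>2 * C\<^sup>2 + K ^ 3 * C ^ 3"
  have C0: "0 \<le> C" using C(1) norm_ge_zero order_trans by blast
  have n0: "0 \<le> n" by (simp add: n_def)
  have n2: "n\<^sup>2 = (norm ?\<xi>)\<^sup>2 + (norm ?\<zeta>)\<^sup>2" by (simp add: n_def norm_prod_def)
  have v: "W' z \<bullet> (z' - z) = v" by (simp add: v_def inner_prod_def)
  have "\<bar>v\<bar> \<le> norm (W' z) * n" unfolding v[symmetric] n_def by (rule Cauchy_Schwarz_ineq2)
  also have "\<dots> \<le> C * n" using C(1) n0 by (rule mult_right_mono)
  finally have vn: "\<bar>v\<bar> \<le> C * n" .
  have e: "\<bar>T - v\<bar> \<le> C * n\<^sup>2" using C(3) unfolding v T_def n_def .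
  have Tn: "\<bar>T\<bar> \<le> C * n" using C(2) unfolding T_def n_def .
  have "v\<^sup>2 - T\<^sup>2 = (v + T) * (v - T)" by (simp add: power2_eq_square algebra_simps)
  also have "\<dots> \<le> \<bar>v + T\<bar> * \<bar>v - T\<bar>" by (metis abs_ge_self abs_mult)
  also have "\<dots> \<le> (2 * (C * n)) * (C * n\<^sup>2)"
    using vn Tn e by (intro mult_mono) auto
  also have "\<dots> = 2 * C\<^sup>2 * n ^ 3" by (simp add: power2_eq_square power3_eq_cube)
  finally have "K\<^sup>2 * (v\<^sup>2 - T\<^sup>2) \<le> K\<^sup>2 * (2 * C\<^sup>2 * n ^ 3)" by (intro mult_left_mono) auto
  then have sq: "K\<^sup>2 * v\<^sup>2 / 2 - K\<^sup>2 * C\<^sup>2 * n ^ 3 \<le> (K * T)\<^sup>2 / 2"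
    by (simp add: power_mult_distrib algebra_simps)
  have "K * (v - C * n\<^sup>2) \<le> K * T" using e K by (intro mult_left_mono) auto
  then have lin: "K * v - K * C * n\<^sup>2 \<le> K * T" by (simp add: algebra_simps)
  have "\<bar>(K * T) ^ 3\<bar> \<le> (K * (C * n)) ^ 3"
    unfolding power_abs abs_mult using Tn K by (intro power_mono mult_left_mono) (auto intro: mult_left_mono)
  then have "- (K ^ 3 * C ^ 3 * n ^ 3) \<le> (K * T) ^ 3" by (simp add: power_mult_distrib abs_le_iff algebra_simps)
  moreover have "0 \<le> K ^ 3 * C ^ 3 * n ^ 3" using K C0 n0 by simp
  ultimately have cube: "- (K ^ 3 * C ^ 3 * n ^ 3) \<le> (K * T) ^ 3 / 6" by linarith
  \<comment> \<open>A cube of the joint norm does not separate into the two displacements, so it is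
    split into a square and a fourth power. The square is the \<open>+ 1\<close> in
    \<open>K * C + 1\<close>, the fourth power goes into \<open>L\<close>.\<close>
  have "0 \<le> (n - G / 2 * n\<^sup>2)\<^sup>2" by simp
  also have "\<dots> = n\<^sup>2 - G * n ^ 3 + G\<^sup>2 / 4 * (n\<^sup>2)\<^sup>2"
    by (simp add: power2_eq_square power3_eq_cube algebra_simps)
  finally have G3: "G * n ^ 3 \<le> n\<^sup>2 + G\<^sup>2 / 4 * (n\<^sup>2)\<^sup>2" by simp
  have "(n\<^sup>2)\<^sup>2 \<le> 2 * (norm ?\<xi> ^ 4 + norm ?\<zeta> ^ 4)"
    using sum_squares_bound[of "(norm ?\<xi>)\<^sup>2" "(norm ?\<zeta>)\<^sup>2"] unfolding n2 by (simp add: power2_sum)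
  then have "G\<^sup>2 / 4 * (n\<^sup>2)\<^sup>2 \<le> G\<^sup>2 / 4 * (2 * (norm ?\<xi> ^ 4 + norm ?\<zeta> ^ 4))"
    by (intro mult_left_mono) auto
  also have "\<dots> = G\<^sup>2 / 2 * (norm ?\<xi> ^ 4 + norm ?\<zeta> ^ 4)" by simp
  also have "\<dots> \<le> L * (norm ?\<xi> ^ 4 + norm ?\<zeta> ^ 4)"
  proof (intro mult_right_mono)
    show "G\<^sup>2 / 2 \<le> L" using L zero_le_power2[of G] unfolding G_def by linarith
  qed simp
  finally have G4: "G * n ^ 3 \<le> n\<^sup>2 + L * (norm ?\<xi> ^ 4 + norm ?\<zeta> ^ 4)" using G3 by linarith
  have "K\<^sup>2 / 2 * (\<mu> * (?a \<bullet> ?\<xi>)\<^sup>2 - \<mu> / (1 - \<mu>) * (?b \<bullet> ?\<zeta>)\<^sup>2) \<le> K\<^sup>2 / 2 * v\<^sup>2"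
    unfolding v_def by (intro mult_left_mono sq_sum_ge[OF \<mu>]) auto
  moreover have "K\<^sup>2 * C\<^sup>2 * n ^ 3 + K ^ 3 * C ^ 3 * n ^ 3 = G * n ^ 3" by (simp add: G_def algebra_simps)
  moreover have "step_form (K *\<^sub>R ?a) ?a (K\<^sup>2 / 2 * \<mu>) (K * C + 1) L ?\<xi>
      + step_form (K *\<^sub>R ?b) ?b (- (K\<^sup>2 / 2 * (\<mu> / (1 - \<mu>)))) (K * C + 1) L ?\<zeta>
    = K * v + K\<^sup>2 / 2 * (\<mu> * (?a \<bullet> ?\<xi>)\<^sup>2 - \<mu> / (1 - \<mu>) * (?b \<bullet> ?\<zeta>)\<^sup>2) - (K * C * n\<^sup>2 + n\<^sup>2)
      - L * (norm ?\<xi> ^ 4 + norm ?\<zeta> ^ 4)"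
    unfolding step_form_def v_def n2 inner_scaleR_left by (simp only: ring_distribs) simp
  ultimately show ?thesis
    using exp_ge_cubic[of "K * T"] sq lin cube G4 unfolding T_def by linarith
qed

section \<open>Measurability for the joint filtration\<close>

lemma joint_filt_generators:
  "{X u -` A \<inter> space M | u A. 0 \<le> u \<and> u \<le> s \<and> A \<in> sets borel} \<union>
   {Y u -` A \<inter> space M | u A. 0 \<le> u \<and> u \<le> s \<and> A \<in> sets borel} \<subseteq> Pow (space M)"
  by auto

lemma space_joint_filt [simp]: "space (joint_filt M X Y s) = space M"
  unfolding joint_filt_def by (rule space_measure_of[OF joint_filt_generators])

lemma subalgebra_joint_filt:
  assumes "\<And>u. 0 \<le> u \<Longrightarrow> X u \<in> borel_measurable M" "\<And>u. 0 \<le> u \<Longrightarrow> Y u \<in> borel_measurable M"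
  shows "subalgebra M (joint_filt M X Y s)"
proof -
  have "sets (joint_filt M X Y s) \<subseteq> sets M"
    unfolding joint_filt_def sets_measure_of[OF joint_filt_generators]
    using assms by (intro sets.sigma_sets_subset) (auto intro: measurable_sets)
  then show ?thesis by (simp add: subalgebra_def)
qed

lemma joint_filt_measurable:
  assumes "0 \<le> u" "u \<le> s"
  shows "X u \<in> borel_measurable (joint_filt M X Y s)" "Y u \<in> borel_measurable (joint_filt M X Y s)"
proof -
  have "X u -` A \<inter> space M \<in> sets (joint_filt M X Y s)" "Y u -` A \<inter> space M \<in> sets (joint_filt M X Y s)"
    if "A \<in> sets borel" for A
    unfolding joint_filt_def sets_measure_of[OF joint_filt_generators]
    using assms that by (intro sigma_sets.Basic; blast)+
  then show "X u \<in> borel_measurable (joint_filt M X Y s)" "Y u \<in> borel_measurable (joint_filt M X Y s)"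
    by (auto intro: measurableI)
qed

lemma rbm_in_closure:
  assumes "rbm M D \<nu> x X" "0 \<le> t"
  shows "AE \<omega> in M. X t \<omega> \<in> closure D"
proof -
  obtain B L where "AE \<omega> in M. skorokhod D \<nu> x (\<lambda>t. B t \<omega>) (\<lambda>t. X t \<omega>) (\<lambda>t. L t \<omega>)"
    using assms(1) unfolding rbm_def by blast
  then show ?thesis
  proof eventually_elim
    case (elim \<omega>)
    then have "\<forall>t\<ge>0. X t \<omega> \<in> closure D" unfolding skorokhod_def by blast
    then show ?case using assms(2) by blast
  qed
qed

section \<open>Gain of the potential over one time step\<close>

text \<open>The interface between the geometry and the coupling. \<open>F\<close> and
  \<open>G\<close> are the step forms of the two processes minus their guaranteed means
  \<open>v1\<close> and \<open>v2\<close>, so their means are nonnegative, and the surplus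
  \<open>v1 + v2 \<ge> h\<close> is a gain that does not depend on how the processes are
  coupled.\<close>

lemma pursuit_gain_form:
  fixes D :: "pt set" and \<nu> :: "pt \<Rightarrow> pt" and \<epsilon> :: real
  assumes D: "open D" "D \<noteq> {}" "convex D" "bounded D" and \<nu>: "inward_unit_normal D \<nu>" and \<epsilon>: "0 < \<epsilon>"
  obtains h :: real and \<Phi> :: "pt \<times> pt \<Rightarrow> real" and F G :: "(pt \<times> pt) \<times> pt \<Rightarrow> real" where
    "0 < h" "continuous_on UNIV \<Phi>" "\<And>z. 0 < \<Phi> z" "continuous_on UNIV F" "continuous_on UNIV G"
    "\<And>z z'. z \<in> closure D \<times> closure D \<Longrightarrow> z' \<in> closure D \<times> closure D \<Longrightarrow> \<epsilon> \<le> norm (fst z - snd z) \<Longrightarrow>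
       \<Phi> z * (F (z, fst z') + G (z, snd z') + h) \<le> \<Phi> z' - \<Phi> z"
    "\<And>(M :: 'a measure) X x y. rbm M D \<nu> x X \<Longrightarrow> x \<in> closure D \<Longrightarrow> y \<in> closure D \<Longrightarrow> \<epsilon> \<le> norm (x - y) \<Longrightarrow>
       0 \<le> (\<integral>\<omega>. F ((x, y), X h \<omega>) \<partial>M)"
    "\<And>(M :: 'a measure) Y x y. rbm M D \<nu> y Y \<Longrightarrow> x \<in> closure D \<Longrightarrow> y \<in> closure D \<Longrightarrow> \<epsilon> \<le> norm (x - y) \<Longrightarrow>
       0 \<le> (\<integral>\<omega>. G ((x, y), Y h \<omega>) \<partial>M)"
proof -
  let ?K = "closure D \<times> closure D"
  \<comment> \<open>The potential is built for half the distance, because a boundary point near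
    \<open>x\<close> may be closer to \<open>y\<close> than \<open>x\<close> is.\<close>
  have \<epsilon>2: "0 < \<epsilon> / 2" using \<epsilon> by simp
  have cK: "compact ?K" using D(4) by (simp add: compact_Times)
  obtain W W' c where c: "c > 0" and W: "taylor2 ?K W W'"
    and gap: "\<And>x y. x \<in> closure D \<Longrightarrow> y \<in> closure D \<Longrightarrow> \<epsilon> / 2 \<le> norm (x - y) \<Longrightarrow>
       (norm (snd (W' (x, y))))\<^sup>2 + c \<le> (norm (fst (W' (x, y))))\<^sup>2"
    and n1: "\<And>x y n. (x, n) \<in> normals D \<Longrightarrow> y \<in> closure D \<Longrightarrow> \<epsilon> / 2 \<le> norm (x - y) \<Longrightarrow>
       c \<le> fst (W' (x, y)) \<bullet> n"
    and n2: "\<And>x y n. (y, n) \<in> normals D \<Longrightarrow> x \<in> closure D \<Longrightarrow> \<epsilon> / 2 \<le> norm (x - y) \<Longrightarrow>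
       c \<le> snd (W' (x, y)) \<bullet> n"
    by (rule pursuit_potential[OF D \<epsilon>2]) (rule that)
  obtain C where C: "C > 0" "\<And>z. z \<in> ?K \<Longrightarrow> \<bar>W z\<bar> \<le> C" "\<And>z. z \<in> ?K \<Longrightarrow> norm (W' z) \<le> C"
    "\<And>z z'. z \<in> ?K \<Longrightarrow> z' \<in> ?K \<Longrightarrow> \<bar>W z' - W z\<bar> \<le> C * norm (z' - z)"
    "\<And>z z'. z \<in> ?K \<Longrightarrow> z' \<in> ?K \<Longrightarrow> \<bar>W z' - W z - W' z \<bullet> (z' - z)\<bar> \<le> C * (norm (z' - z))\<^sup>2"
    by (rule taylor2_bounds[OF W cK]) (rule that)
  have Wc: "continuous_on UNIV W" "continuous_on UNIV W'" using W by (auto simp: taylor2_def)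
  have Ca: "norm (fst (W' z)) \<le> C" "norm (snd (W' z)) \<le> C" if "z \<in> ?K" for z
    using C(3)[OF that] norm_fst_le[of "fst (W' z)" "snd (W' z)"] norm_snd_le[of "snd (W' z)" "fst (W' z)"]
    by simp_all
  \<comment> \<open>The weights \<open>\<mu>\<close> and \<open>\<mu> / (1 - \<mu>)\<close> preserve
    the strict advantage if (1 - \<mu>) |W_x|^2 still exceeds |W_y|^2. Since |W_x| is at most
    \<open>C\<close>, it is enough that \<open>\<mu> * C\<^sup>2 \<le> c / 2\<close>.\<close>
  define \<mu> where "\<mu> = c / (2 * (C\<^sup>2 + c))"
  have \<mu>: "0 < \<mu>" "\<mu> < 1"
  proof -
    have "0 < 2 * (C\<^sup>2 + c)" "c < 2 * (C\<^sup>2 + c)" using c zero_le_power2[of C] by (simp_all add: add_nonneg_pos, linarith)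
    then show "0 < \<mu>" "\<mu> < 1" unfolding \<mu>_def using c by simp_all
  qed
  have \<mu>C: "\<mu> * C\<^sup>2 \<le> c / 2"
  proof -
    have "0 < C\<^sup>2 + c" using c by (simp add: add_nonneg_pos)
    moreover have "c * C\<^sup>2 \<le> c * (C\<^sup>2 + c)" using c by simp
    ultimately show ?thesis unfolding \<mu>_def by (simp add: field_simps)
  qed
  define b where "b = \<mu> * (c / 2)"
  have b: "0 < b" using \<mu> c by (simp add: b_def)
  have diff: "b \<le> \<mu> * (norm (fst (W' (x, y))))\<^sup>2 - \<mu> / (1 - \<mu>) * (norm (snd (W' (x, y))))\<^sup>2"
    if xy: "x \<in> closure D" "y \<in> closure D" "\<epsilon> \<le> norm (x - y)" for x y
  proof -
    let ?A = "(norm (fst (W' (x, y))))\<^sup>2" and ?B = "(norm (snd (W' (x, y))))\<^sup>2"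
    have "?A \<le> C\<^sup>2" using Ca(1)[of "(x, y)"] xy by (intro power_mono) auto
    then have "\<mu> * ?A \<le> \<mu> * C\<^sup>2" using \<mu> by simp
    moreover have "?B + c \<le> ?A" using gap xy \<epsilon> by simp
    ultimately have *: "c / 2 \<le> (1 - \<mu>) * ?A - ?B" using \<mu>C by (simp add: left_diff_distrib)
    then have "0 \<le> (1 - \<mu>) * ?A - ?B" using c by simp
    moreover have "1 \<le> 1 / (1 - \<mu>)" using \<mu> by simp
    ultimately have le: "1 * ((1 - \<mu>) * ?A - ?B) \<le> 1 / (1 - \<mu>) * ((1 - \<mu>) * ?A - ?B)"
      by (intro mult_right_mono) auto
    have "c / 2 \<le> 1 * ((1 - \<mu>) * ?A - ?B)" using * by simp
    also note le
    also have "1 / (1 - \<mu>) * ((1 - \<mu>) * ?A - ?B) = ?A - 1 / (1 - \<mu>) * ?B"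
      using \<mu> by (simp add: right_diff_distrib)
    finally have "c / 2 \<le> ?A - 1 / (1 - \<mu>) * ?B" .
    then have "\<mu> * (c / 2) \<le> \<mu> * (?A - 1 / (1 - \<mu>) * ?B)" using \<mu> by (intro mult_left_mono) auto
    then show ?thesis by (simp add: b_def right_diff_distrib)
  qed
  \<comment> \<open>Large enough for \<open>Kb\<close>: the quadratic gain pays the loss
    \<open>2 * k + 1\<close> of each process, with \<open>k = K * C + 1\<close>, and leaves
    1.\<close>
  define K where "K = (8 * C + 14) / b + 1"
  have K: "1 \<le> K" "0 \<le> K" unfolding K_def using C(1) b by simp_all
  have Kb: "4 * (K * C + 1) + 3 \<le> K\<^sup>2 / 2 * b"
  proof -
    have "K * b = 8 * C + 14 + b" unfolding K_def using b by (simp add: field_simps)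
    then have "8 * C + 14 \<le> K * b" using b by simp
    then have "K * (8 * C + 14) \<le> K * (K * b)" using K by (intro mult_left_mono) auto
    moreover have "K * 14 \<ge> 14" using K by simp
    ultimately show ?thesis by (simp add: power2_eq_square algebra_simps)
  qed
  define k where "k = K * C + 1"
  define s1 where "s1 = K\<^sup>2 / 2 * \<mu>"
  define s2 where "s2 = - (K\<^sup>2 / 2 * (\<mu> / (1 - \<mu>)))"
  define L where "L = k + C + \<bar>s1\<bar> + \<bar>s2\<bar> + (K\<^sup>2 * C\<^sup>2 + K ^ 3 * C ^ 3)\<^sup>2"
  have k0: "0 \<le> k" unfolding k_def using K C(1) by simp
  have L: "0 \<le> L" "K * C \<le> L" "C \<le> L" "\<bar>s1\<bar> \<le> L" "\<bar>s2\<bar> \<le> L" "k \<le> L" "(K\<^sup>2 * C\<^sup>2 + K ^ 3 * C ^ 3)\<^sup>2 \<le> L"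
  proof -
    have "K * C \<le> k" by (simp add: k_def)
    then show "0 \<le> L" "K * C \<le> L" "C \<le> L" "\<bar>s1\<bar> \<le> L" "\<bar>s2\<bar> \<le> L" "k \<le> L"
      "(K\<^sup>2 * C\<^sup>2 + K ^ 3 * C ^ 3)\<^sup>2 \<le> L"
      unfolding L_def using C(1) k0 zero_le_power2[of "K\<^sup>2 * C\<^sup>2 + K ^ 3 * C ^ 3"]
        abs_ge_zero[of s1] abs_ge_zero[of s2] by linarith+
  qed
  have "uniformly_continuous_on ?K W'"
    using Wc(2) cK by (intro compact_uniformly_continuous) (auto intro: continuous_on_subset)
  then obtain d0 where d0: "0 < d0" "\<And>z z'. z \<in> ?K \<Longrightarrow> z' \<in> ?K \<Longrightarrow> dist z' z < d0 \<Longrightarrow> dist (W' z') (W' z) < c / 2"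
    unfolding uniformly_continuous_on_def using c by (meson half_gt_zero)
  \<comment> \<open>Within distance \<open>d\<close> the gradient of \<open>W\<close> changes by
    less than \<open>c / 2\<close> and the separation stays at least \<open>\<epsilon> / 2\<close>,
    so half of the normal derivative survives when the gradient is frozen at the start of the
    step.\<close>
  define d where "d = min (d0 / 2) (\<epsilon> / 2)"
  have d: "0 < d" "d < d0" "d \<le> \<epsilon> / 2" unfolding d_def using d0(1) \<epsilon> by auto
  have c2: "0 < c / 2" using c by simp
  have Kc: "c / 2 \<le> K * t" if "c / 2 \<le> t" for t
    using mult_mono[OF K(1) that] K c by simp
  have one: "norm (\<nu> z) = 1" if "z \<in> frontier D" for z
    using \<nu> that by (simp add: inward_unit_normal_def)
  have push1: "c / 2 \<le> (K *\<^sub>R fst (W' (x, y))) \<bullet> \<nu> w"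
    if xy: "x \<in> closure D" "y \<in> closure D" "\<epsilon> \<le> norm (x - y)" and w: "w \<in> frontier D" "norm (w - x) \<le> d" for x y w
  proof -
    have wD: "w \<in> closure D" using w by (simp add: frontier_def)
    have "norm (x - y) \<le> norm (w - x) + norm (w - y)"
      using norm_triangle_ineq4[of "w - y" "w - x"] by (simp add: algebra_simps)
    then have "\<epsilon> / 2 \<le> norm (w - y)" using xy w d by linarith
    from n1[OF inward_unit_normal_normals[OF \<nu> w(1)] xy(2) this] have "c \<le> fst (W' (w, y)) \<bullet> \<nu> w" .
    moreover have "dist (W' (w, y)) (W' (x, y)) < c / 2"
      using w d xy wD by (intro d0(2)) (auto simp: dist_Pair_Pair dist_norm)
    then have "norm (fst (W' (w, y)) - fst (W' (x, y))) \<le> c / 2"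
      using dist_fst_le[of "W' (w, y)" "W' (x, y)"] by (simp add: dist_norm)
    then have "(fst (W' (w, y)) - fst (W' (x, y))) \<bullet> \<nu> w \<le> c / 2"
      using norm_cauchy_schwarz[of "fst (W' (w, y)) - fst (W' (x, y))" "\<nu> w"] one[OF w(1)] by simp
    ultimately have "c / 2 \<le> fst (W' (x, y)) \<bullet> \<nu> w" by (simp add: inner_diff_left)
    then show ?thesis using Kc by simp
  qed
  have push2: "c / 2 \<le> (K *\<^sub>R snd (W' (x, y))) \<bullet> \<nu> w"
    if xy: "x \<in> closure D" "y \<in> closure D" "\<epsilon> \<le> norm (x - y)" and w: "w \<in> frontier D" "norm (w - y) \<le> d" for x y w
  proof -
    have wD: "w \<in> closure D" using w by (simp add: frontier_def)
    have "norm (x - y) \<le> norm (x - w) + norm (w - y)"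
      using norm_triangle_ineq[of "x - w" "w - y"] by simp
    then have "\<epsilon> / 2 \<le> norm (x - w)" using xy w d by linarith
    from n2[OF inward_unit_normal_normals[OF \<nu> w(1)] xy(1) this] have "c \<le> snd (W' (x, w)) \<bullet> \<nu> w" .
    moreover have "dist (W' (x, w)) (W' (x, y)) < c / 2"
      using w d xy wD by (intro d0(2)) (auto simp: dist_Pair_Pair dist_norm)
    then have "norm (snd (W' (x, w)) - snd (W' (x, y))) \<le> c / 2"
      using dist_snd_le[of "W' (x, w)" "W' (x, y)"] by (simp add: dist_norm)
    then have "(snd (W' (x, w)) - snd (W' (x, y))) \<bullet> \<nu> w \<le> c / 2"
      using norm_cauchy_schwarz[of "snd (W' (x, w)) - snd (W' (x, y))" "\<nu> w"] one[OF w(1)] by simp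
    ultimately have "c / 2 \<le> snd (W' (x, y)) \<bullet> \<nu> w" by (simp add: inner_diff_left)
    then show ?thesis using Kc by simp
  qed
  obtain h :: real where h: "0 < h" and
    form: "\<And>(M :: 'a measure) X x t (p :: pt) (a :: pt) (s :: real) (k :: real). rbm M D \<nu> x X \<Longrightarrow> x \<in> closure D \<Longrightarrow> 0 < t \<Longrightarrow> t \<le> h \<Longrightarrow>
       norm p \<le> L \<Longrightarrow> norm a \<le> L \<Longrightarrow> \<bar>s\<bar> \<le> L \<Longrightarrow> 0 \<le> k \<Longrightarrow> k \<le> L \<Longrightarrow>
       (\<And>z. z \<in> frontier D \<Longrightarrow> norm (z - x) \<le> d \<Longrightarrow> c / 2 \<le> p \<bullet> \<nu> z) \<Longrightarrow>
       (s * (norm a)\<^sup>2 - 2 * k - 1) * t \<le> (\<integral>\<omega>. step_form p a s k L (X t \<omega> - x) \<partial>M)"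
  proof (rule rbm_step_form[where 'a='a, OF D(1,2,4) \<nu> L(1) c2 d(1)], goal_cases)
    case (1 h0)
    show thesis by (rule 1(1)[OF 1(2)]) (rule 1(3))
  qed
  define v1 where "v1 z = (s1 * (norm (fst (W' z)))\<^sup>2 - 2 * k - 1) * h" for z
  define v2 where "v2 z = (s2 * (norm (snd (W' z)))\<^sup>2 - 2 * k - 1) * h" for z
  define \<Phi> where "\<Phi> z = exp (K * W z)" for z
  define F where "F q = step_form (K *\<^sub>R fst (W' (fst q))) (fst (W' (fst q))) s1 k L (snd q - fst (fst q)) - v1 (fst q)"
    for q :: "(pt \<times> pt) \<times> pt"
  define G where "G q = step_form (K *\<^sub>R snd (W' (fst q))) (snd (W' (fst q))) s2 k L (snd q - snd (fst q)) - v2 (fst q)"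
    for q :: "(pt \<times> pt) \<times> pt"
  have cont: "continuous_on UNIV (\<lambda>q::(pt \<times> pt) \<times> pt. W' (fst q))"
    by (rule continuous_on_compose2[OF Wc(2)]) (auto intro: continuous_intros)
  have v12: "h \<le> v1 (x, y) + v2 (x, y)" if xy: "x \<in> closure D" "y \<in> closure D" "\<epsilon> \<le> norm (x - y)" for x y
  proof -
    have "K\<^sup>2 / 2 * b \<le> K\<^sup>2 / 2 * (\<mu> * (norm (fst (W' (x, y))))\<^sup>2 - \<mu> / (1 - \<mu>) * (norm (snd (W' (x, y))))\<^sup>2)"
      using diff[OF xy] by (intro mult_left_mono) auto
    also have "\<dots> = s1 * (norm (fst (W' (x, y))))\<^sup>2 + s2 * (norm (snd (W' (x, y))))\<^sup>2"
      unfolding s1_def s2_def by (simp only: ring_distribs mult.assoc minus_mult_left[symmetric])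
    finally have "1 \<le> (s1 * (norm (fst (W' (x, y))))\<^sup>2 - 2 * k - 1) + (s2 * (norm (snd (W' (x, y))))\<^sup>2 - 2 * k - 1)"
      using Kb unfolding k_def by linarith
    from mult_right_mono[OF this less_imp_le[OF h]] show ?thesis
      unfolding v1_def v2_def distrib_right by simp
  qed
  show thesis
  proof (rule that[of h \<Phi> F G])
    show "0 < h" by (rule h)
    show "continuous_on UNIV \<Phi>" unfolding \<Phi>_def by (intro continuous_intros Wc)
    show "0 < \<Phi> z" for z by (simp add: \<Phi>_def)
    show "continuous_on UNIV F" unfolding F_def v1_def step_form_def by (intro continuous_intros cont)
    show "continuous_on UNIV G" unfolding G_def v2_def step_form_def by (intro continuous_intros cont)
  next
    fix z z' assume z: "z \<in> ?K" "z' \<in> ?K" "\<epsilon> \<le> norm (fst z - snd z)"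
    have "F (z, fst z') + G (z, snd z') + (v1 z + v2 z) \<le> exp (K * (W z' - W z)) - 1"
      using exp_taylor2_step[of W' z C W z', OF C(3)[OF z(1)] C(4)[OF z(1,2)] C(5)[OF z(1,2)] K(2) \<mu> L(7)]
      unfolding F_def G_def s1_def s2_def k_def by simp
    moreover have "h \<le> v1 z + v2 z" using v12[of "fst z" "snd z"] z by auto
    ultimately have "F (z, fst z') + G (z, snd z') + h \<le> exp (K * (W z' - W z)) - 1" by linarith
    then have "\<Phi> z * (F (z, fst z') + G (z, snd z') + h) \<le> \<Phi> z * (exp (K * (W z' - W z)) - 1)"
      by (intro mult_left_mono) (auto simp: \<Phi>_def)
    also have "\<dots> = \<Phi> z' - \<Phi> z" unfolding \<Phi>_def by (simp add: right_diff_distrib exp_diff)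
    finally show "\<Phi> z * (F (z, fst z') + G (z, snd z') + h) \<le> \<Phi> z' - \<Phi> z" .
  next
    fix M :: "'a measure" and X x y
    assume X: "rbm M D \<nu> x X" and xy: "x \<in> closure D" "y \<in> closure D" "\<epsilon> \<le> norm (x - y)"
    interpret prob_space M using X by (simp add: rbm_def)
    let ?S = "\<lambda>\<omega>. step_form (K *\<^sub>R fst (W' (x, y))) (fst (W' (x, y))) s1 k L (X h \<omega> - x)"
    have le: "v1 (x, y) \<le> (\<integral>\<omega>. ?S \<omega> \<partial>M)"
      unfolding v1_def
    proof (rule form[OF X xy(1) h order_refl])
      have a: "norm (fst (W' (x, y))) \<le> C" using Ca xy by simp
      then show "norm (fst (W' (x, y))) \<le> L" using L by linarith
      have "K * norm (fst (W' (x, y))) \<le> L" using mult_left_mono[OF a K(2)] L(2) by linarith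
      then show "norm (K *\<^sub>R fst (W' (x, y))) \<le> L" using K by simp
    qed (use L k0 push1[OF xy] in auto)
    \<comment> \<open>The integral of a non-integrable function is 0, which settles the second case
      without an integrability proof.\<close>
    show "0 \<le> (\<integral>\<omega>. F ((x, y), X h \<omega>) \<partial>M)"
    proof (cases "integrable M ?S")
      case True
      then show ?thesis unfolding F_def using le by (simp add: prob_space)
    next
      case False
      then have "\<not> integrable M (\<lambda>\<omega>. F ((x, y), X h \<omega>))"
        using Bochner_Integration.integrable_add[of M "\<lambda>\<omega>. F ((x, y), X h \<omega>)" "\<lambda>_. v1 (x, y)"] unfolding F_def by auto
      then show ?thesis by (simp add: not_integrable_integral_eq)
    qed
  next
    fix M :: "'a measure" and Y x y
    assume Y: "rbm M D \<nu> y Y" and xy: "x \<in> closure D" "y \<in> closure D" "\<epsilon> \<le> norm (x - y)"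
    interpret prob_space M using Y by (simp add: rbm_def)
    let ?S = "\<lambda>\<omega>. step_form (K *\<^sub>R snd (W' (x, y))) (snd (W' (x, y))) s2 k L (Y h \<omega> - y)"
    have le: "v2 (x, y) \<le> (\<integral>\<omega>. ?S \<omega> \<partial>M)"
      unfolding v2_def
    proof (rule form[OF Y xy(2) h order_refl])
      have a: "norm (snd (W' (x, y))) \<le> C" using Ca xy by simp
      then show "norm (snd (W' (x, y))) \<le> L" using L by linarith
      have "K * norm (snd (W' (x, y))) \<le> L" using mult_left_mono[OF a K(2)] L(2) by linarith
      then show "norm (K *\<^sub>R snd (W' (x, y))) \<le> L" using K by simp
    qed (use L k0 push2[OF xy] in auto)
    show "0 \<le> (\<integral>\<omega>. G ((x, y), Y h \<omega>) \<partial>M)"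
    proof (cases "integrable M ?S")
      case True
      then show ?thesis unfolding G_def using le by (simp add: prob_space)
    next
      case False
      then have "\<not> integrable M (\<lambda>\<omega>. G ((x, y), Y h \<omega>))"
        using Bochner_Integration.integrable_add[of M "\<lambda>\<omega>. G ((x, y), Y h \<omega>)" "\<lambda>_. v2 (x, y)"] unfolding G_def by auto
      then show ?thesis by (simp add: not_integrable_integral_eq)
    qed
  qed
qed

text \<open>The weight \<open>g\<close>, which is \<Phi> at time \<open>s\<close> restricted to
  \<open>E\<close>, is known at time \<open>s\<close>. The kernel lemma is applied once to
  \<open>X\<close> with \<open>F\<close> and once to \<open>Y\<close> with \<open>G\<close>, both
  times for the same past, so the joint conditional law is never consulted.\<close>

lemma coupling_expected_gain:
  fixes D :: "pt set" and \<nu> :: "pt \<Rightarrow> pt" and h m b \<epsilon> :: real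
    and Mc :: "pt \<times> pt \<Rightarrow> 'a measure" and Xc Yc :: "pt \<times> pt \<Rightarrow> real \<Rightarrow> 'a \<Rightarrow> pt"
    and F G :: "(pt \<times> pt) \<times> pt \<Rightarrow> real"
  assumes D: "bounded D" and coupling: "coadapted_rbm_coupling D \<nu> Mc Xc Yc"
    and x0: "x0 \<in> closure D" and y0: "y0 \<in> closure D"
    and h: "0 < h" and \<Phi>: "continuous_on UNIV \<Phi>" "\<And>z. 0 < \<Phi> z"
      "\<And>z. z \<in> closure D \<times> closure D \<Longrightarrow> m \<le> \<Phi> z \<and> \<Phi> z \<le> b"
    and FG: "continuous_on UNIV F" "continuous_on UNIV G"
    and gain: "\<And>z z'. z \<in> closure D \<times> closure D \<Longrightarrow> z' \<in> closure D \<times> closure D \<Longrightarrow>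
       \<epsilon> \<le> norm (fst z - snd z) \<Longrightarrow> \<Phi> z * (F (z, fst z') + G (z, snd z') + h) \<le> \<Phi> z' - \<Phi> z"
    and F0: "\<And>(M :: 'a measure) X x y. rbm M D \<nu> x X \<Longrightarrow> x \<in> closure D \<Longrightarrow> y \<in> closure D \<Longrightarrow>
       \<epsilon> \<le> norm (x - y) \<Longrightarrow> 0 \<le> (\<integral>\<omega>. F ((x, y), X h \<omega>) \<partial>M)"
    and G0: "\<And>(M :: 'a measure) Y x y. rbm M D \<nu> y Y \<Longrightarrow> x \<in> closure D \<Longrightarrow> y \<in> closure D \<Longrightarrow>
       \<epsilon> \<le> norm (x - y) \<Longrightarrow> 0 \<le> (\<integral>\<omega>. G ((x, y), Y h \<omega>) \<partial>M)"
    and s: "0 \<le> s"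
    and E: "E \<in> sets (joint_filt (Mc (x0, y0)) (Xc (x0, y0)) (Yc (x0, y0)) s)"
      "\<And>\<omega>. \<omega> \<in> E \<Longrightarrow> \<epsilon> \<le> norm (Xc (x0, y0) s \<omega> - Yc (x0, y0) s \<omega>)"
  shows "h * m * measure (Mc (x0, y0)) E \<le> (\<integral>\<omega>. indicator E \<omega> *
      (\<Phi> (Xc (x0, y0) (s + h) \<omega>, Yc (x0, y0) (s + h) \<omega>) - \<Phi> (Xc (x0, y0) s \<omega>, Yc (x0, y0) s \<omega>)) \<partial>Mc (x0, y0))"
proof -
  define M where "M = Mc (x0, y0)"
  define X where "X = Xc (x0, y0)"
  define Y where "Y = Yc (x0, y0)"
  define A where "A = joint_filt M X Y s"
  define Z where "Z \<omega> = (X s \<omega>, Y s \<omega>)" for \<omega>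
  let ?K = "closure D \<times> closure D"
  define K where "K = ?K \<inter> {z. \<epsilon> \<le> norm (fst z - snd z)}"
  obtain P where P: "rbm_semigroup TYPE('a) D \<nu> P"
    and pair: "\<And>x y. x \<in> closure D \<Longrightarrow> y \<in> closure D \<Longrightarrow> rbm (Mc (x, y)) D \<nu> x (Xc (x, y)) \<and>
        rbm (Mc (x, y)) D \<nu> y (Yc (x, y)) \<and> coadapted (Mc (x, y)) P (Xc (x, y)) (Yc (x, y))"
    using coupling unfolding coadapted_rbm_coupling_def by blast
  have X: "rbm M D \<nu> x0 X" and Y: "rbm M D \<nu> y0 Y" and co: "coadapted M P X Y"
    using pair[OF x0 y0] unfolding M_def X_def Y_def by auto
  interpret prob_space M using X by (simp add: rbm_def)
  have Xm: "X u \<in> borel_measurable M" and Ym: "Y u \<in> borel_measurable M" if "0 \<le> u" for u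
    using X Y that by (auto simp: rbm_def)
  have sub: "subalgebra M A" unfolding A_def by (rule subalgebra_joint_filt[OF Xm Ym])
  have XA: "X s \<in> borel_measurable A" "Y s \<in> borel_measurable A"
    unfolding A_def by (rule joint_filt_measurable[OF s order_refl])+
  then have ZA: "Z \<in> borel_measurable A" unfolding Z_def by (rule borel_measurable_Pair)
  have EA: "E \<in> sets A" using E(1) unfolding A_def M_def X_def Y_def .
  then have EM: "E \<in> sets M" using sub by (auto simp: subalgebra_def)
  have sh: "0 \<le> s + h" using s h by simp
  note [measurable] = Xm[OF s] Ym[OF s] Xm[OF sh] Ym[OF sh] EM borel_measurable_continuous_onI[OF \<Phi>(1)]
  have K: "compact K" "compact (closure D)"
  proof -
    have "closed {z :: pt \<times> pt. \<epsilon> \<le> norm (fst z - snd z)}"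
      by (intro closed_Collect_le continuous_intros)
    then show "compact K" unfolding K_def using D by (intro compact_Int_closed compact_Times) auto
  qed (use D in simp)
  have inD: "AE \<omega> in M. Z \<omega> \<in> ?K \<and> (X (s + h) \<omega>, Y (s + h) \<omega>) \<in> ?K"
    using rbm_in_closure[OF X s] rbm_in_closure[OF Y s] rbm_in_closure[OF X sh] rbm_in_closure[OF Y sh]
    by eventually_elim (auto simp: Z_def)
  have EZ: "\<epsilon> \<le> norm (fst (Z \<omega>) - snd (Z \<omega>))" if "\<omega> \<in> E" for \<omega>
    using E(2)[OF that] unfolding Z_def X_def Y_def by simp
  \<comment> \<open>The minimum with \<open>b\<close> makes \<open>g\<close> bounded everywhere;
    almost surely it changes nothing, as the pair lies in the closed domain.\<close>
  define g where "g \<omega> = indicator E \<omega> * min b (\<Phi> (Z \<omega>))" for \<omega>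
  have "(x0, y0) \<in> ?K" using x0 y0 by simp
  then have b0: "0 < b" using \<Phi>(2)[of "(x0, y0)"] \<Phi>(3)[of "(x0, y0)"] by linarith
  have gA: "g \<in> borel_measurable A"
    unfolding g_def using measurable_compose[OF ZA borel_measurable_continuous_onI[OF \<Phi>(1)]] EA
    by (intro borel_measurable_times borel_measurable_min) auto
  have g: "0 \<le> g \<omega>" "g \<omega> \<le> b" for \<omega>
    unfolding g_def using b0 \<Phi>(2)[of "Z \<omega>"] by (auto simp: indicator_def)
  have gZ: "AE \<omega> in M. g \<omega> \<noteq> 0 \<longrightarrow> Z \<omega> \<in> K"
    using inD by eventually_elim (auto simp: g_def K_def indicator_def intro: EZ)
  \<comment> \<open>The coupling started at the pair \<open>z\<close> itself provides a reflected
    Brownian motion over the same sample type, whose law at time \<open>h\<close> is the one given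
    by the semigroup.\<close>
  define QX where "QX z = distr (Mc z) borel (Xc z h)" for z
  define QY where "QY z = distr (Mc z) borel (Yc z h)" for z
  have rb: "rbm (Mc z) D \<nu> (fst z) (Xc z)" "rbm (Mc z) D \<nu> (snd z) (Yc z)" if "z \<in> K" for z
    using pair[of "fst z" "snd z"] that by (auto simp: K_def)
  have meas: "Xc z h \<in> borel_measurable (Mc z)" "Yc z h \<in> borel_measurable (Mc z)" if "z \<in> K" for z
    using rb[OF that] h by (auto simp: rbm_def)
  have psp: "prob_space (Mc z)" if "z \<in> K" for z using rb(1)[OF that] by (simp add: rbm_def)
  have ZK: "fst z \<in> closure D" "snd z \<in> closure D" "\<epsilon> \<le> norm (fst z - snd z)" if "z \<in> K" for z
    using that by (auto simp: K_def)
  have clD: "closure D \<in> sets borel" by simp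
  have QX: "prob_space (QX z)" "sets (QX z) = sets borel" "AE x in QX z. x \<in> closure D"
    "measure (QX z) S = P (fst z) h S" "0 \<le> (\<integral>x. F (z, x) \<partial>QX z)"
    if z: "z \<in> K" and S: "S \<in> sets borel" for z S
  proof -
    note mz = meas(1)[OF z]
    show "prob_space (QX z)" unfolding QX_def by (rule prob_space.prob_space_distr[OF psp[OF z] mz])
    show "sets (QX z) = sets borel" by (simp add: QX_def)
    show "AE x in QX z. x \<in> closure D" unfolding QX_def
      using rbm_in_closure[OF rb(1)[OF z], of h] h by (subst AE_distr_iff[OF mz]) auto
    show "measure (QX z) S = P (fst z) h S"
      using P rb(1)[OF z] ZK(1)[OF z] h S unfolding rbm_semigroup_def QX_def
      by (subst measure_distr[OF mz S]) (auto simp: vimage_def Int_def conj_commute)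
    have "(\<integral>x. F (z, x) \<partial>QX z) = (\<integral>\<omega>. F (z, Xc z h \<omega>) \<partial>Mc z)"
      unfolding QX_def
      by (rule integral_distr[OF mz]) (intro borel_measurable_continuous_onI continuous_on_compose2[OF FG(1)] continuous_intros, auto)
    then show "0 \<le> (\<integral>x. F (z, x) \<partial>QX z)"
      using F0[OF rb(1)[OF z], of "snd z"] ZK[OF z] by simp
  qed
  have QY: "prob_space (QY z)" "sets (QY z) = sets borel" "AE x in QY z. x \<in> closure D"
    "measure (QY z) S = P (snd z) h S" "0 \<le> (\<integral>x. G (z, x) \<partial>QY z)"
    if z: "z \<in> K" and S: "S \<in> sets borel" for z S
  proof -
    note mz = meas(2)[OF z]
    show "prob_space (QY z)" unfolding QY_def by (rule prob_space.prob_space_distr[OF psp[OF z] mz])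
    show "sets (QY z) = sets borel" by (simp add: QY_def)
    show "AE x in QY z. x \<in> closure D" unfolding QY_def
      using rbm_in_closure[OF rb(2)[OF z], of h] h by (subst AE_distr_iff[OF mz]) auto
    show "measure (QY z) S = P (snd z) h S"
      using P rb(2)[OF z] ZK(2)[OF z] h S unfolding rbm_semigroup_def QY_def
      by (subst measure_distr[OF mz S]) (auto simp: vimage_def Int_def conj_commute)
    have "(\<integral>x. G (z, x) \<partial>QY z) = (\<integral>\<omega>. G (z, Yc z h \<omega>) \<partial>Mc z)"
      unfolding QY_def
      by (rule integral_distr[OF mz]) (intro borel_measurable_continuous_onI continuous_on_compose2[OF FG(2)] continuous_intros, auto)
    then show "0 \<le> (\<integral>x. G (z, x) \<partial>QY z)"
      using G0[OF rb(2)[OF z], of "fst z"] ZK[OF z] by simp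
  qed
  have condX: "AE \<omega> in M. Z \<omega> \<in> K \<longrightarrow>
      real_cond_exp M A (\<lambda>\<omega>. indicator S (X (s + h) \<omega>)) \<omega> = measure (QX (Z \<omega>)) S"
    if S: "S \<in> sets borel" for S
  proof -
    have "AE \<omega> in M. real_cond_exp M A (\<lambda>\<omega>. indicator S (X (s + h) \<omega>)) \<omega> = P (X s \<omega>) h S"
      using co s h S unfolding coadapted_def A_def by simp
    then show ?thesis by eventually_elim (use QX(4)[OF _ S] in \<open>simp add: Z_def\<close>)
  qed
  note kernelX = kernel_integral_nonneg[OF prob_space_axioms sub ZA Xm[OF sh] K rbm_in_closure[OF X sh]
    gA g gZ QX(1)[OF _ clD] QX(2)[OF _ clD] QX(3)[OF _ clD] condX FG(1) QX(5)[OF _ clD]]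
  have condY: "AE \<omega> in M. Z \<omega> \<in> K \<longrightarrow>
      real_cond_exp M A (\<lambda>\<omega>. indicator S (Y (s + h) \<omega>)) \<omega> = measure (QY (Z \<omega>)) S"
    if S: "S \<in> sets borel" for S
  proof -
    have "AE \<omega> in M. real_cond_exp M A (\<lambda>\<omega>. indicator S (Y (s + h) \<omega>)) \<omega> = P (Y s \<omega>) h S"
      using co s h S unfolding coadapted_def A_def by simp
    then show ?thesis by eventually_elim (use QY(4)[OF _ S] in \<open>simp add: Z_def\<close>)
  qed
  note kernelY = kernel_integral_nonneg[OF prob_space_axioms sub ZA Ym[OF sh] K rbm_in_closure[OF Y sh]
    gA g gZ QY(1)[OF _ clD] QY(2)[OF _ clD] QY(3)[OF _ clD] condY FG(2) QY(5)[OF _ clD]]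
  have bounded: "integrable M f" if "f \<in> borel_measurable M" "AE \<omega> in M. \<bar>f \<omega>\<bar> \<le> b" for f :: "'a \<Rightarrow> real"
    by (rule integrable_const_bound[where B=b]) (use that in auto)
  let ?d = "\<lambda>\<omega>. indicator E \<omega> * (\<Phi> (X (s + h) \<omega>, Y (s + h) \<omega>) - \<Phi> (Z \<omega>))"
  have intd: "integrable M ?d"
  proof (rule bounded)
    show "?d \<in> borel_measurable M" unfolding Z_def by measurable
    show "AE \<omega> in M. \<bar>?d \<omega>\<bar> \<le> b"
      using inD
    proof eventually_elim
      case (elim \<omega>)
      then have "\<Phi> (Z \<omega>) \<le> b" "\<Phi> (X (s + h) \<omega>, Y (s + h) \<omega>) \<le> b"
        using \<Phi>(3)[of "Z \<omega>"] \<Phi>(3)[of "(X (s + h) \<omega>, Y (s + h) \<omega>)"] by auto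
      then show ?case
        using \<Phi>(2)[of "Z \<omega>"] \<Phi>(2)[of "(X (s + h) \<omega>, Y (s + h) \<omega>)"] b0
        by (auto simp: indicator_def abs_le_iff)
    qed
  qed
  have intg: "integrable M g"
    by (rule bounded) (use g measurable_from_subalg[OF sub gA] in auto)
  have "h * (m * measure M E) = (\<integral>\<omega>. h * (m * indicator E \<omega>) \<partial>M)" using EM sets.sets_into_space[OF EM] by (simp add: Int_absorb2)
  also have "\<dots> \<le> (\<integral>\<omega>. h * g \<omega> \<partial>M)"
  proof (rule integral_mono_AE)
    show "AE \<omega> in M. h * (m * indicator E \<omega>) \<le> h * g \<omega>"
      using inD
    proof eventually_elim
      case (elim \<omega>)
      then have "m \<le> \<Phi> (Z \<omega>)" "\<Phi> (Z \<omega>) \<le> b" using \<Phi>(3)[of "Z \<omega>"] by auto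
      then show ?case using h by (auto simp: g_def indicator_def)
    qed
  qed (use intg EM in \<open>auto intro!: integrable_mult_right integrable_real_indicator simp: less_top[symmetric]\<close>)
  also have "\<dots> \<le> (\<integral>\<omega>. g \<omega> * F (Z \<omega>, X (s + h) \<omega>) \<partial>M) + (\<integral>\<omega>. g \<omega> * G (Z \<omega>, Y (s + h) \<omega>) \<partial>M) + (\<integral>\<omega>. h * g \<omega> \<partial>M)"
    using kernelX(2) kernelY(2) by simp
  also have "\<dots> = (\<integral>\<omega>. g \<omega> * F (Z \<omega>, X (s + h) \<omega>) + g \<omega> * G (Z \<omega>, Y (s + h) \<omega>) + h * g \<omega> \<partial>M)"
    using kernelX(1) kernelY(1) intg by simp
  also have "\<dots> \<le> (\<integral>\<omega>. ?d \<omega> \<partial>M)"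
  proof (rule integral_mono_AE)
    show "AE \<omega> in M. g \<omega> * F (Z \<omega>, X (s + h) \<omega>) + g \<omega> * G (Z \<omega>, Y (s + h) \<omega>) + h * g \<omega> \<le> ?d \<omega>"
      using inD
    proof eventually_elim
      case (elim \<omega>)
      show ?case
      proof (cases "\<omega> \<in> E")
        case True
        have "\<Phi> (Z \<omega>) \<le> b" using elim \<Phi>(3)[of "Z \<omega>"] by auto
        then have "g \<omega> = \<Phi> (Z \<omega>)" using True by (simp add: g_def)
        then show ?thesis
          using gain[of "Z \<omega>" "(X (s + h) \<omega>, Y (s + h) \<omega>)"] elim EZ[OF True] True
          by (simp add: algebra_simps)
      qed (simp add: g_def)
    qed
  qed (use kernelX(1) kernelY(1) intg intd in auto)
  finally show ?thesis unfolding Z_def X_def Y_def M_def by (simp add: mult.assoc)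
qed

section \<open>From the expected gain to almost sure approach\<close>

text \<open>Telescoping bounds the sum of \<open>c * p j\<close> by \<open>2 * b\<close>, and since
  \<open>p\<close> decreases this sum is at least \<open>n * (c * p n)\<close>; hence
  \<open>p n\<close> is of order \<open>1 / n\<close>.\<close>

lemma survival_vanishes:
  fixes p w :: "nat \<Rightarrow> real"
  assumes c: "0 < c" and p: "\<And>n. 0 \<le> p n" "decseq p" and b: "\<And>n. \<bar>w n\<bar> \<le> b"
    and step: "\<And>n. c * p n \<le> w (Suc n) - w n"
  shows "p \<longlonglongrightarrow> 0"
proof -
  have le: "real n * (c * p n) \<le> w n - w 0" for n
  proof (induction n)
    case (Suc n)
    have "p (Suc n) \<le> p n" using p(2) by (simp add: decseq_Suc_iff)
    then have "c * p (Suc n) \<le> c * p n" using c by simp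
    moreover from this have "real n * (c * p (Suc n)) \<le> real n * (c * p n)" by (rule mult_left_mono) simp
    ultimately show ?case using Suc step[of n] by (simp add: distrib_right)
  qed simp
  have up: "p (Suc n) \<le> 2 * b / c * inverse (real (Suc n))" for n
  proof -
    have "real (Suc n) * (c * p (Suc n)) \<le> 2 * b" using le[of "Suc n"] b[of "Suc n"] b[of 0] by linarith
    then have "p (Suc n) * (c * real (Suc n)) \<le> 2 * b" by (simp only: ac_simps)
    then have "p (Suc n) \<le> 2 * b / (c * real (Suc n))" using c by (subst pos_le_divide_eq) auto
    then show ?thesis by (simp add: divide_inverse mult.assoc)
  qed
  have "(\<lambda>n. 2 * b / c * inverse (real (Suc n))) \<longlonglongrightarrow> 2 * b / c * 0"
    by (intro tendsto_intros LIMSEQ_inverse_real_of_nat)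
  then have "(\<lambda>n. p (Suc n)) \<longlonglongrightarrow> 0"
    by (intro tendsto_sandwich[of "\<lambda>_. 0" "\<lambda>n. p (Suc n)" _ "\<lambda>n. 2 * b / c * inverse (real (Suc n))"])
      (use p up in auto)
  then show ?thesis by (rule LIMSEQ_imp_Suc)
qed

theorem theorem3p2:
  fixes D :: "pt set" and \<nu> :: "pt \<Rightarrow> pt"
    and Mc :: "pt \<times> pt \<Rightarrow> 'a measure" and Xc Yc :: "pt \<times> pt \<Rightarrow> real \<Rightarrow> 'a \<Rightarrow> pt"
  assumes "open D" and "D \<noteq> {}" and "convex D" and "bounded D"
    and "inward_unit_normal D \<nu>"
    and "coadapted_rbm_coupling D \<nu> Mc Xc Yc"
    and "x0 \<in> closure D" and "y0 \<in> closure D" and "x0 \<noteq> y0"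
    and "(\<epsilon>::real) > 0"
  shows "AE \<omega> in Mc (x0, y0). \<exists>t\<ge>0. norm (Xc (x0, y0) t \<omega> - Yc (x0, y0) t \<omega>) \<le> \<epsilon>"
proof -
  define M where "M = Mc (x0, y0)"
  define X where "X = Xc (x0, y0)"
  define Y where "Y = Yc (x0, y0)"
  have XY: "rbm M D \<nu> x0 X" "rbm M D \<nu> y0 Y"
    using assms(6-8) unfolding coadapted_rbm_coupling_def M_def X_def Y_def by blast+
  interpret prob_space M using XY(1) by (simp add: rbm_def)
  have m: "X u \<in> borel_measurable M" "Y u \<in> borel_measurable M" if "0 \<le> u" for u
    using XY that by (auto simp: rbm_def)
  let ?K = "closure D \<times> closure D"
  obtain h :: real and \<Phi> :: "pt \<times> pt \<Rightarrow> real" and F G :: "(pt \<times> pt) \<times> pt \<Rightarrow> real" where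
    h: "0 < h" and \<Phi>: "continuous_on UNIV \<Phi>" "\<And>z. 0 < \<Phi> z"
    and FG: "continuous_on UNIV F" "continuous_on UNIV G"
    and gain: "\<And>z z'. z \<in> ?K \<Longrightarrow> z' \<in> ?K \<Longrightarrow> \<epsilon> \<le> norm (fst z - snd z) \<Longrightarrow>
       \<Phi> z * (F (z, fst z') + G (z, snd z') + h) \<le> \<Phi> z' - \<Phi> z"
    and F0: "\<And>(M :: 'a measure) X x y. rbm M D \<nu> x X \<Longrightarrow> x \<in> closure D \<Longrightarrow> y \<in> closure D \<Longrightarrow>
       \<epsilon> \<le> norm (x - y) \<Longrightarrow> 0 \<le> (\<integral>\<omega>. F ((x, y), X h \<omega>) \<partial>M)"
    and G0: "\<And>(M :: 'a measure) Y x y. rbm M D \<nu> y Y \<Longrightarrow> x \<in> closure D \<Longrightarrow> y \<in> closure D \<Longrightarrow>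
       \<epsilon> \<le> norm (x - y) \<Longrightarrow> 0 \<le> (\<integral>\<omega>. G ((x, y), Y h \<omega>) \<partial>M)"
  proof (rule pursuit_gain_form[where 'a='a, OF assms(1-5,10)], goal_cases)
    case (1 h \<Phi> F G)
    show thesis
      by (rule 1(1)[OF 1(2-6)]) (use 1(7-9) in blast)+
  qed
  have ne: "?K \<noteq> {}" using assms(7) by auto
  have cK: "compact ?K" using assms(4) by (simp add: compact_Times)
  have \<Phi>K: "continuous_on ?K \<Phi>" using \<Phi>(1) by (rule continuous_on_subset) simp
  obtain zm where zm: "zm \<in> ?K" "\<And>z. z \<in> ?K \<Longrightarrow> \<Phi> zm \<le> \<Phi> z"
    using continuous_attains_inf[OF cK ne \<Phi>K] by blast
  obtain zb where zb: "zb \<in> ?K" "\<And>z. z \<in> ?K \<Longrightarrow> \<Phi> z \<le> \<Phi> zb"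
    using continuous_attains_sup[OF cK ne \<Phi>K] by blast
  define b where "b = \<Phi> zb"
  define S where "S n \<omega> = \<Phi> (X (real n * h) \<omega>, Y (real n * h) \<omega>)" for n \<omega>
  \<comment> \<open>Only the grid times are watched: a pair that stays apart forever is apart at all
    of them, so it suffices that the intersection of these events is null.\<close>
  define E where "E n = {\<omega> \<in> space M. \<forall>j\<le>n. \<epsilon> < norm (X (real j * h) \<omega> - Y (real j * h) \<omega>)}" for n :: nat
  have nh: "0 \<le> real n * h" for n using h by simp
  have EF: "E n \<in> sets (joint_filt M X Y (real n * h))" for n
  proof -
    have jm: "(\<lambda>\<omega>. norm (X (real j * h) \<omega> - Y (real j * h) \<omega>)) \<in> borel_measurable (joint_filt M X Y (real n * h))"
      if "j \<le> n" for j
    proof -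
      have "real j * h \<le> real n * h" using that h by simp
      note [measurable] = joint_filt_measurable[where M=M and X=X and Y=Y, OF nh[of j] this]
      show ?thesis by measurable
    qed
    have "E n = (\<Inter>j\<in>{..n}. {\<omega> \<in> space (joint_filt M X Y (real n * h)). \<epsilon> < norm (X (real j * h) \<omega> - Y (real j * h) \<omega>)})"
      unfolding E_def by auto
    also have "\<dots> \<in> sets (joint_filt M X Y (real n * h))"
      using jm by (intro sets.finite_INT borel_measurable_less) auto
    finally show ?thesis .
  qed
  have EM: "E n \<in> sets M" for n
    using subalgebra_joint_filt[of X M Y "real n * h", OF m] EF[of n] by (auto simp: subalgebra_def)
  have Emono: "E (Suc n) \<subseteq> E n" for n
    unfolding E_def using le_SucI by blast
  have Sm: "S n \<in> borel_measurable M" for n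
    unfolding S_def using m[OF nh[of n]]
    by (intro measurable_compose[OF _ borel_measurable_continuous_onI[OF \<Phi>(1)]] borel_measurable_Pair)
  have Sb: "AE \<omega> in M. \<bar>S n \<omega>\<bar> \<le> b" for n
    using rbm_in_closure[OF XY(1) nh[of n]] rbm_in_closure[OF XY(2) nh[of n]]
  proof eventually_elim
    case (elim \<omega>)
    then show ?case
      using zb(2)[of "(X (real n * h) \<omega>, Y (real n * h) \<omega>)"] \<Phi>(2)[of "(X (real n * h) \<omega>, Y (real n * h) \<omega>)"]
      by (simp add: S_def b_def)
  qed
  have b0: "0 \<le> b" using \<Phi>(2)[of zb] by (simp add: b_def)
  have iES: "integrable M (\<lambda>\<omega>. indicator (E k) \<omega> * S n \<omega>)" for k n
  proof (rule integrable_const_bound[where B=b])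
    show "AE \<omega> in M. norm (indicator (E k) \<omega> * S n \<omega>) \<le> b"
      using Sb[of n] by eventually_elim (use b0 in \<open>auto simp: indicator_def\<close>)
    show "(\<lambda>\<omega>. indicator (E k) \<omega> * S n \<omega>) \<in> borel_measurable M" using Sm EM by measurable
  qed
  have iE: "integrable M (indicator (E k) :: 'a \<Rightarrow> real)" for k
    using EM by (intro integrable_real_indicator) (auto simp: less_top[symmetric])
  have mE: "(\<integral>\<omega>. indicator (E k) \<omega> \<partial>M) = measure M (E k)" for k
    using sets.sets_into_space[OF EM[of k]] by (simp add: Int_absorb2)
  \<comment> \<open>Up to the constant \<open>b\<close>, the mean of the process that is frozen at
    its largest value \<open>b\<close> once the pair has been found close. Its increments are
    bounded below by the gain on \<open>E n\<close>.\<close>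
  define w where "w n = (\<integral>\<omega>. indicator (E n) \<omega> * S n \<omega> \<partial>M) - b * measure M (E n)" for n
  have "(\<lambda>n. measure M (E n)) \<longlonglongrightarrow> 0"
  proof (rule survival_vanishes[of "h * \<Phi> zm" _ w b])
    show "0 < h * \<Phi> zm" using h \<Phi>(2) by simp
    show "decseq (\<lambda>n. measure M (E n))"
      unfolding decseq_Suc_iff using finite_measure_mono[OF Emono EM] by blast
    show "\<bar>w n\<bar> \<le> b" for n
    proof -
      have int: "integrable M (\<lambda>\<omega>. indicator (E n) \<omega> * S n \<omega> - b * indicator (E n) \<omega>)"
        by (intro Bochner_Integration.integrable_diff integrable_mult_right iES iE)
      have w: "w n = (\<integral>\<omega>. indicator (E n) \<omega> * S n \<omega> - b * indicator (E n) \<omega> \<partial>M)"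
        unfolding w_def using iES iE mE by simp
      have "AE \<omega> in M. - b \<le> indicator (E n) \<omega> * S n \<omega> - b * indicator (E n) \<omega> \<and>
          indicator (E n) \<omega> * S n \<omega> - b * indicator (E n) \<omega> \<le> b"
        using Sb[of n]
      proof eventually_elim
        case (elim \<omega>)
        have "0 \<le> S n \<omega>" unfolding S_def by (rule less_imp_le[OF \<Phi>(2)])
        then show ?case using elim b0 by (auto simp: indicator_def)
      qed
      then have "AE \<omega> in M. - b \<le> indicator (E n) \<omega> * S n \<omega> - b * indicator (E n) \<omega>"
        "AE \<omega> in M. indicator (E n) \<omega> * S n \<omega> - b * indicator (E n) \<omega> \<le> b" by auto
      then have "- b \<le> w n" "w n \<le> b"
        unfolding w using integral_ge_const[OF int] integral_le_const[OF int] by blast+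
      then show ?thesis by (simp add: abs_le_iff)
    qed
    fix n
    have "h * \<Phi> zm * measure M (E n) \<le> (\<integral>\<omega>. indicator (E n) \<omega> * (S (Suc n) \<omega> - S n \<omega>) \<partial>M)"
    proof -
      have t: "real (Suc n) * h = real n * h + h" by (simp add: algebra_simps)
      show ?thesis unfolding S_def t M_def X_def Y_def
      proof (rule coupling_expected_gain[of D \<nu> Mc Xc Yc x0 y0 h \<Phi> "\<Phi> zm" b F G \<epsilon> "real n * h" "E n"])
        show "0 < \<Phi> z" for z by (rule \<Phi>(2))
        show "\<Phi> zm \<le> \<Phi> z \<and> \<Phi> z \<le> b" if "z \<in> ?K" for z
          using zm(2)[OF that] zb(2)[OF that] by (simp add: b_def)
        show "\<Phi> z * (F (z, fst z') + G (z, snd z') + h) \<le> \<Phi> z' - \<Phi> z"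
          if "z \<in> ?K" "z' \<in> ?K" "\<epsilon> \<le> norm (fst z - snd z)" for z z'
          using that by (rule gain)
        show "0 \<le> (\<integral>\<omega>. F ((x, y), X h \<omega>) \<partial>M)"
          if "rbm M D \<nu> x X" "x \<in> closure D" "y \<in> closure D" "\<epsilon> \<le> norm (x - y)"
          for M :: "'a measure" and X x y using that by (rule F0)
        show "0 \<le> (\<integral>\<omega>. G ((x, y), Y h \<omega>) \<partial>M)"
          if "rbm M D \<nu> y Y" "x \<in> closure D" "y \<in> closure D" "\<epsilon> \<le> norm (x - y)"
          for M :: "'a measure" and Y x y using that by (rule G0)
        show "E n \<in> sets (joint_filt (Mc (x0, y0)) (Xc (x0, y0)) (Yc (x0, y0)) (real n * h))"
          using EF[of n] unfolding M_def X_def Y_def .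
        show "\<epsilon> \<le> norm (Xc (x0, y0) (real n * h) \<omega> - Yc (x0, y0) (real n * h) \<omega>)" if "\<omega> \<in> E n" for \<omega>
          using that less_imp_le unfolding E_def M_def X_def Y_def by blast
      qed (rule assms(4) assms(6-8) h \<Phi>(1) FG nh)+
    qed
    also have "\<dots> = (\<integral>\<omega>. indicator (E n) \<omega> * S (Suc n) \<omega> \<partial>M) - (\<integral>\<omega>. indicator (E n) \<omega> * S n \<omega> \<partial>M)"
      unfolding right_diff_distrib by (rule Bochner_Integration.integral_diff[OF iES iES])
    \<comment> \<open>On the part of \<open>E n\<close> that is lost at the next grid time, the
      potential is replaced by its upper bound \<open>b\<close>.\<close>
    also have "(\<integral>\<omega>. indicator (E n) \<omega> * S (Suc n) \<omega> \<partial>M)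
        \<le> (\<integral>\<omega>. indicator (E (Suc n)) \<omega> * S (Suc n) \<omega> + b * (indicator (E n) \<omega> - indicator (E (Suc n)) \<omega>) \<partial>M)"
    proof (rule integral_mono_AE)
      show "AE \<omega> in M. indicator (E n) \<omega> * S (Suc n) \<omega>
          \<le> indicator (E (Suc n)) \<omega> * S (Suc n) \<omega> + b * (indicator (E n) \<omega> - indicator (E (Suc n)) \<omega>)"
        using Sb[of "Suc n"]
      proof eventually_elim
        case (elim \<omega>)
        then show ?case using Emono[of n] by (auto simp: indicator_def)
      qed
    qed (use iES iE in auto)
    also have "\<dots> = (\<integral>\<omega>. indicator (E (Suc n)) \<omega> * S (Suc n) \<omega> \<partial>M) + b * (measure M (E n) - measure M (E (Suc n)))"
      using iES iE mE by simp
    finally show "h * \<Phi> zm * measure M (E n) \<le> w (Suc n) - w n"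
      unfolding w_def by (simp add: algebra_simps)
  qed simp
  moreover have "measure M (\<Inter>n. E n) \<le> measure M (E n)" for n
    using EM by (intro finite_measure_mono) auto
  ultimately have "measure M (\<Inter>n. E n) \<le> 0"
    by (intro LIMSEQ_le_const[of "\<lambda>n. measure M (E n)"]) auto
  then have "measure M (\<Inter>n. E n) = 0" by (simp add: measure_le_0_iff)
  then have "(\<Inter>n. E n) \<in> null_sets M"
    using EM by (auto simp: null_sets_def emeasure_eq_measure)
  from AE_not_in[OF this] AE_space
  have "AE \<omega> in M. \<exists>t\<ge>0. norm (X t \<omega> - Y t \<omega>) \<le> \<epsilon>"
  proof eventually_elim
    case (elim \<omega>)
    then obtain n where "\<omega> \<notin> E n" by blast
    then obtain j where "norm (X (real j * h) \<omega> - Y (real j * h) \<omega>) \<le> \<epsilon>"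
      using elim(2) unfolding E_def by (auto simp: not_less)
    then show ?case using nh by blast
  qed
  then show ?thesis unfolding M_def X_def Y_def .
qed

end
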